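(* Let $(X(t))$ be a strong Markov process on $E\subset\mathbb{R}^d$ as in the context, satisfying Assumption (A) (stated in the context), and let $r^*$ be its spectral radius. Then for any $x,y\in\mathcal{E}$, $$\log r^* \;=\; -I^* \;=\; -I_{[0,1]}(\overline{0}) \;=\; -\limsup_{t\to+\infty} \frac{I(t,x,y)}{t} \;=\; -\inf_{\phi(0)=\phi(1)} I_{[0,1]}(\phi),$$ where the infimum is taken over all continuous functions $\phi:[0,1]\to\mathcal{E}$ with $\phi(0)=\phi(1)$.
   Context: **Process.** $E\subset\mathbb{R}^d$ is closed and unbounded, endowed with a non-negative Radon measure $m$ such that $m(O)\neq 0$ for every non-empty (relatively) open $O\subset E$. $(X(t))_{t\ge 0}$ is a strong Markov process on $E$ with right continuous sample paths having left limits; $\mathbb{P}_x,\mathbb{E}_x$ refer to $X(0)=x$. For closed $V\subset E$, $\tau(V)=\inf\{t>0: X(t)\in V\}$, $\tau(\emptyset)=+\infty$. For every closed $V\subset E$ and every bounded measurable $\varphi:E\to\mathbb{R}$, the map $(t,x)\mapsto\mathbb{E}_x(\varphi(X(t));\,\tau(V)>t)$ is assumed Borel measurable on $\mathbb{R}_+\times E$. **Spectral radius.** $r^*$ is the infimum of all $r>0$ for which, for every compact $W\subset E$, the function $x\mapsto\int_0^\infty r^{-t}\,\mathbb{P}_x(X(t)\in W)\,dt$ is $m$-integrable on compact subsets of $E$. **Assumption (A).** Let $\mathcal{E}$ be the set of all possible limits $\lim_{a\to\infty}x_a/a$ with $x_a\in E$. $D([0,T],\mathcal{E})$ is the space of functions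 $[0,T]\to\mathcal{E}$ that are right continuous with left limits, with the Skorohod metric. Put $Z_a(t)=X(at)/a$; $\mathbb{P}_{az}$ means $Z_a(0)=z$, i.e. $X(0)=az$. - $(a_0)$ $E\subset\mathcal{E}\neq\{0\}$ and $\mathcal{E}\setminus\{0\}$ is convex. - $(a_1)$ For every $T>0$ the family $(Z_a(t),t\in[0,T])$ satisfies the sample path large deviation principle in $D([0,T],\mathcal{E})$ with a good rate function $I_{[0,T]}:D([0,T],\mathcal{E})\to[0,+\infty]$. That is: for any $c>0$ and compact $V\subset\mathcal{E}$ the set $\{\phi:\phi(0)\in V,\ I_{[0,T]}(\phi)\le c\}$ is compact; and for every $x\in\mathcal{E}$, for every open $\mathcal{O}\subset D([0,T],\mathcal{E})$, $\lim_{\varepsilon\to0}\liminf_{a\to\infty}\inf_{z}\frac1a\log\mathbb{P}_{az}(Z_a(\cdot)\in\mathcal{O})\ge-\inf_{\phi\in\mathcal{O}:\phi(0)=x}I_{[0,T]}(\phi)$, and for every closed $F\subset D([0,T],\mathcal{E})$, $\lim_{\varepsilon\to0}\limsup_{a\to\infty}\sup_{z}\frac1a\log\mathbb{P}_{az}(Z_a(\cdot)\in F)\le-\inf_{\phi\in F:\phi(0)=x}I_{[0,T]}(\phi)$, where $z$ ranges over $z\in\frac1aE$ with $|z-x|<\varepsilon$. - $(a_2)$ There is a function $L:\mathcal{E}\times\mathbb{R}^d\to\mathbb{R}_+$ such that $I_{[0,T]}(\phi)=\int_0^TL(\phi(t),\dot\phi(t))\,dt$ if $\phi:[0,T]\to\mathcal{E}$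 is absolutely continuous, and $I_{[0,T]}(\phi)=+\infty$ otherwise. - $(a_3)$ There are convex functions $l_1,l_2$ on $\mathbb{R}^d$ ($l_2$ may take the value $+\infty$) with $0\le l_1(v)\le L(x,v)\le l_2(v)$ for all $x\in\mathcal{E}$, $v\in\mathbb{R}^d$; $l_2$ is finite in a neighborhood of zero; and $\lim_{n\to\infty}\inf_{|v|\ge n}l_1(v)/|v|>0$. **Notation.** $I(t,x,y)$ is the infimum of $I_{[0,t]}(\phi)$ over all continuous $\phi:[0,t]\to\mathcal{E}$ with $\phi(0)=x$, $\phi(t)=y$. $I^*=I(1,0,0)$. $\overline{0}$ is the constant function equal to $0$. *)

theory Defs
  imports "HOL-Probability.Probability"
begin

section \<open>Strong Markov processes on a closed set\<close>

text \<open>Time of a filtration and values of stopping times range over \<open>[0, \<infinity>]\<close>, i.e. \<^typ>\<open>ennreal\<close>;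
  the process itself is indexed by the reals, of which only \<open>t \<ge> 0\<close> matters.\<close>

definition hitting_time :: "(real \<Rightarrow> 'w \<Rightarrow> 'a) \<Rightarrow> 'a set \<Rightarrow> 'w \<Rightarrow> ennreal" where
  "hitting_time X V \<omega> = Inf (ennreal ` {t. 0 < t \<and> X t \<omega> \<in> V})"

text \<open>The probability measure \<open>P x\<close> governs the process started at \<open>x\<close>; only \<open>x \<in> E\<close> matters.
  The filtration is neither assumed complete nor right continuous. The measurability of hitting
  times is what gives a meaning to the expectations in \<open>killed_measurable\<close>.\<close>

locale strong_markov_process = filtration "space M" F
  for M :: "'w measure" and F :: "ennreal \<Rightarrow> 'w measure" +
  fixes E :: "'a::euclidean_space set"
    and P :: "'a \<Rightarrow> 'w measure"
    and X :: "real \<Rightarrow> 'w \<Rightarrow> 'a"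
  assumes F_sub: "sets (F t) \<subseteq> sets M"
    and prob: "x \<in> E \<Longrightarrow> prob_space (P x)"
    and sets_P: "x \<in> E \<Longrightarrow> sets (P x) = sets M"
    and start: "x \<in> E \<Longrightarrow> AE \<omega> in P x. X 0 \<omega> = x"
    and in_E: "\<omega> \<in> space M \<Longrightarrow> 0 \<le> t \<Longrightarrow> X t \<omega> \<in> E"
    and adapted: "0 \<le> t \<Longrightarrow> X t \<in> F (ennreal t) \<rightarrow>\<^sub>M borel"
    and right_continuous:
      "\<omega> \<in> space M \<Longrightarrow> 0 \<le> t \<Longrightarrow> ((\<lambda>s. X s \<omega>) \<longlongrightarrow> X t \<omega>) (at_right t)"
    and left_limits:
      "\<omega> \<in> space M \<Longrightarrow> 0 < t \<Longrightarrow> \<exists>l. ((\<lambda>s. X s \<omega>) \<longlongrightarrow> l) (at_left t)"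
    and hitting_measurable:
      "closed V \<Longrightarrow> V \<subseteq> E \<Longrightarrow> hitting_time X V \<in> borel_measurable M"
    and killed_measurable:
      "closed V \<Longrightarrow> V \<subseteq> E \<Longrightarrow> \<phi> \<in> borel_measurable (restrict_space borel E) \<Longrightarrow> bounded (\<phi> ` E) \<Longrightarrow>
       (\<lambda>(t, x). LINT \<omega>:{\<omega> \<in> space M. ennreal t < hitting_time X V \<omega>}|P x. (\<phi> (X t \<omega>) :: real))
         \<in> borel_measurable (restrict_space borel ({0..} \<times> E))"
    and strong_markov:
      "x \<in> E \<Longrightarrow> stopping_time F \<tau> \<Longrightarrow> 0 \<le> t \<Longrightarrow> B \<in> sets borel \<Longrightarrow>
       AE \<omega> in P x. \<tau> \<omega> < \<infinity> \<longrightarrow>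
         real_cond_exp (P x) (pre_sigma \<tau>)
           (indicator {\<omega> \<in> space M. \<tau> \<omega> < \<infinity> \<and> X (enn2real (\<tau> \<omega>) + t) \<omega> \<in> B}) \<omega>
         = measure (P (X (enn2real (\<tau> \<omega>)) \<omega>)) {\<omega>' \<in> space M. X t \<omega>' \<in> B}"

definition radon_measure_on :: "'a::topological_space set \<Rightarrow> 'a measure \<Rightarrow> bool" where
  "radon_measure_on E m \<longleftrightarrow>
     space m = E \<and> sets m = sets (restrict_space borel E) \<and>
     (\<forall>K. compact K \<and> K \<subseteq> E \<longrightarrow> emeasure m K < \<infinity>) \<and>
     (\<forall>B\<in>sets m. emeasure m B = (SUP K\<in>{K. compact K \<and> K \<subseteq> B}. emeasure m K))"


section \<open>Spectral radius\<close>

definition green_function ::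
  "'w measure \<Rightarrow> ('a \<Rightarrow> 'w measure) \<Rightarrow> (real \<Rightarrow> 'w \<Rightarrow> 'a) \<Rightarrow> real \<Rightarrow> 'a set \<Rightarrow> 'a \<Rightarrow> ennreal" where
  "green_function M P X r W x =
     (\<integral>\<^sup>+t\<in>{0..}. ennreal (r powr (- t) * measure (P x) {\<omega> \<in> space M. X t \<omega> \<in> W}) \<partial>lborel)"

definition spectral_radius ::
  "'w measure \<Rightarrow> ('a \<Rightarrow> 'w measure) \<Rightarrow> (real \<Rightarrow> 'w \<Rightarrow> 'a) \<Rightarrow> 'a::topological_space set \<Rightarrow> 'a measure \<Rightarrow> real"
where
  "spectral_radius M P X E m =
     Inf {r. 0 < r \<and> (\<forall>W. compact W \<and> W \<subseteq> E \<longrightarrow>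
       green_function M P X r W \<in> borel_measurable m \<and>
       (\<forall>K. compact K \<and> K \<subseteq> E \<longrightarrow> (\<integral>\<^sup>+x\<in>K. green_function M P X r W x \<partial>m) < \<infinity>))}"

text \<open>The extended logarithm, with \<open>log 0 = -\<infinity>\<close> (whereas \<open>ln 0 = 0\<close>).\<close>

definition elog :: "real \<Rightarrow> ereal" where
  "elog p = (if p \<le> 0 then -\<infinity> else ereal (ln p))"


section \<open>The Skorohod space\<close>

text \<open>Functions on \<open>[0, T]\<close> are represented by functions on the reals that are \<open>undefined\<close>
  outside \<open>{0..T}\<close>.\<close>

definition cadlag :: "real \<Rightarrow> 'a::topological_space set \<Rightarrow> (real \<Rightarrow> 'a) set" where
  "cadlag T S = {\<phi> \<in> {0..T} \<rightarrow>\<^sub>E S.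
     (\<forall>t\<in>{0..<T}. (\<phi> \<longlongrightarrow> \<phi> t) (at_right t)) \<and>
     (\<forall>t\<in>{0<..T}. \<exists>l\<in>S. (\<phi> \<longlongrightarrow> l) (at_left t))}"

definition cont_paths :: "real \<Rightarrow> 'a::topological_space set \<Rightarrow> (real \<Rightarrow> 'a) set" where
  "cont_paths T S = {\<phi> \<in> {0..T} \<rightarrow>\<^sub>E S. continuous_on {0..T} \<phi>}"

definition time_changes :: "real \<Rightarrow> (real \<Rightarrow> real) set" where
  "time_changes T = {h. strict_mono_on {0..T} h \<and> continuous_on {0..T} h \<and> h ` {0..T} = {0..T}}"

definition skorohod_cost :: "real \<Rightarrow> (real \<Rightarrow> 'a::metric_space) \<Rightarrow> (real \<Rightarrow> 'a) \<Rightarrow> (real \<Rightarrow> real) \<Rightarrow> ennreal" where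
  "skorohod_cost T \<phi> \<psi> h =
     max (SUP t\<in>{0..T}. ennreal \<bar>h t - t\<bar>) (SUP t\<in>{0..T}. ennreal (dist (\<phi> t) (\<psi> (h t))))"

definition skorohod_dist :: "real \<Rightarrow> (real \<Rightarrow> 'a::metric_space) \<Rightarrow> (real \<Rightarrow> 'a) \<Rightarrow> real" where
  "skorohod_dist T \<phi> \<psi> = enn2real (INF h\<in>time_changes T. skorohod_cost T \<phi> \<psi> h)"

lemma skorohod_cost_le_iff: "skorohod_cost T \<phi> \<psi> h \<le> c \<longleftrightarrow> (\<forall>t\<in>{0..T}. ennreal \<bar>h t - t\<bar> \<le> c \<and> ennreal (dist (\<phi> t) (\<psi> (h t))) \<le> c)"
  by (auto simp: skorohod_cost_def SUP_le_iff)

lemma id_time_change: "(\<lambda>t. t) \<in> time_changes T"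
  by (auto simp: time_changes_def strict_mono_on_def)

lemma inv_time_change: assumes "h \<in> time_changes T" shows "inv_into {0..T} h \<in> time_changes T"
proof -
  have h: "strict_mono_on {0..T} h" "continuous_on {0..T} h" "h ` {0..T} = {0..T}"
    using assms by (auto simp: time_changes_def)
  have inj: "inj_on h {0..T}" using h(1) strict_mono_on_imp_inj_on by blast
  have "continuous_on (h ` {0..T}) (inv_into {0..T} h)"
    by (rule continuous_on_inv) (use h inj in \<open>auto intro: inv_into_f_f\<close>)
  moreover have "inv_into {0..T} h ` {0..T} = {0..T}"
    using inv_into_image_cancel[OF inj, of "{0..T}"] h(3) by simp
  moreover have "strict_mono_on {0..T} (inv_into {0..T} h)"
  proof (rule strict_mono_onI)
    fix r s assume a: "r \<in> {0..T}" "s \<in> {0..T}" "r < s"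
    let ?g = "inv_into {0..T} h"
    have b: "?g r \<in> {0..T}" "?g s \<in> {0..T}" "h (?g r) = r" "h (?g s) = s"
      using a h(3) by (metis inv_into_into, metis inv_into_into, metis f_inv_into_f, metis f_inv_into_f)
    show "?g r < ?g s"
    proof (rule ccontr)
      assume "\<not> ?thesis"
      then have "?g s \<le> ?g r" by simp
      then have "h (?g s) \<le> h (?g r)" using h(1) b
        by (metis order_le_less strict_mono_onD)
      then show False using a b by simp
    qed
  qed
  ultimately show ?thesis using h(3) by (simp add: time_changes_def)
qed

lemma skorohod_cost_inv: assumes "h \<in> time_changes T" shows "skorohod_cost T \<psi> \<phi> (inv_into {0..T} h) \<le> skorohod_cost T \<phi> \<psi> h"
  unfolding skorohod_cost_le_iff
proof
  have h: "h ` {0..T} = {0..T}" using assms by (auto simp: time_changes_def)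
  fix t assume t: "t \<in> {0..T}"
  let ?s = "inv_into {0..T} h t"
  have s: "?s \<in> {0..T}" "h ?s = t" using t h by (metis inv_into_into, metis f_inv_into_f)
  have "ennreal \<bar>h ?s - ?s\<bar> \<le> skorohod_cost T \<phi> \<psi> h" "ennreal (dist (\<phi> ?s) (\<psi> (h ?s))) \<le> skorohod_cost T \<phi> \<psi> h"
    using skorohod_cost_le_iff[of T \<phi> \<psi> h "skorohod_cost T \<phi> \<psi> h"] s(1) by auto
  then show "ennreal \<bar>?s - t\<bar> \<le> skorohod_cost T \<phi> \<psi> h \<and> ennreal (dist (\<psi> t) (\<phi> ?s)) \<le> skorohod_cost T \<phi> \<psi> h"
    by (simp add: s(2) abs_minus_commute dist_commute)
qed

lemma skorohod_dist_commute: "skorohod_dist T \<phi> \<psi> = skorohod_dist T \<psi> \<phi>"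
proof -
  have "(INF h\<in>time_changes T. skorohod_cost T \<phi> \<psi> h) \<le> (INF h\<in>time_changes T. skorohod_cost T \<psi> \<phi> h)" for \<phi> \<psi> :: "real \<Rightarrow> 'a"
    by (rule INF_mono) (metis skorohod_cost_inv inv_time_change)
  then show ?thesis unfolding skorohod_dist_def by (metis antisym)
qed

lemma cadlag_bounded: assumes "\<phi> \<in> cadlag T S" shows "bounded (\<phi> ` {0..T})"
proof -
  have ex: "\<exists>U. open U \<and> t \<in> U \<and> bounded (\<phi> ` (U \<inter> {0..T}))" if t: "t \<in> {0..T}" for t
  proof -
    have "\<exists>b>t. bounded (\<phi> ` ({t<..<b} \<inter> {0..T}))"
    proof (cases "t < T")
      case True
      then have "(\<phi> \<longlongrightarrow> \<phi> t) (at_right t)" using t assms by (auto simp: cadlag_def)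
      then have "\<forall>\<^sub>F s in at_right t. dist (\<phi> s) (\<phi> t) < 1" by (rule tendstoD) simp
      then obtain b where "b > t" "\<And>s. t < s \<Longrightarrow> s < b \<Longrightarrow> dist (\<phi> s) (\<phi> t) < 1"
        unfolding eventually_at_right_field by blast
      then show ?thesis
        by (intro exI[of _ b]) (auto simp: bounded_def dist_commute intro!: exI[of _ "\<phi> t"] exI[of _ 1] less_imp_le)
    next
      case False
      then have "{t<..<t+1} \<inter> {0..T} = {}" using t by auto
      then show ?thesis by (intro exI[of _ "t+1"]) simp
    qed
    then obtain b where b: "b > t" "bounded (\<phi> ` ({t<..<b} \<inter> {0..T}))" by blast
    have "\<exists>a<t. bounded (\<phi> ` ({a<..<t} \<inter> {0..T}))"
    proof (cases "0 < t")
      case True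
      then obtain l where "(\<phi> \<longlongrightarrow> l) (at_left t)" using t assms unfolding cadlag_def by fastforce
      then have "\<forall>\<^sub>F s in at_left t. dist (\<phi> s) l < 1" by (rule tendstoD) simp
      then obtain b where "b < t" "\<And>s. b < s \<Longrightarrow> s < t \<Longrightarrow> dist (\<phi> s) l < 1"
        unfolding eventually_at_left_field by blast
      then show ?thesis
        by (intro exI[of _ b]) (auto simp: bounded_def dist_commute intro!: exI[of _ l] exI[of _ 1] less_imp_le)
    next
      case False
      then have "{t-1<..<t} \<inter> {0..T} = {}" using t by auto
      then show ?thesis by (intro exI[of _ "t-1"]) simp
    qed
    then obtain a where a: "a < t" "bounded (\<phi> ` ({a<..<t} \<inter> {0..T}))" by blast
    have "\<phi> ` ({a<..<b} \<inter> {0..T}) \<subseteq> insert (\<phi> t) (\<phi> ` ({t<..<b} \<inter> {0..T}) \<union> \<phi> ` ({a<..<t} \<inter> {0..T}))"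
    proof
      fix z assume "z \<in> \<phi> ` ({a<..<b} \<inter> {0..T})"
      then obtain s where s: "s \<in> {a<..<b}" "s \<in> {0..T}" "z = \<phi> s" by auto
      consider "s = t" | "s < t" | "s > t" by linarith
      then show "z \<in> insert (\<phi> t) (\<phi> ` ({t<..<b} \<inter> {0..T}) \<union> \<phi> ` ({a<..<t} \<inter> {0..T}))"
        using s by cases auto
    qed
    then have "bounded (\<phi> ` ({a<..<b} \<inter> {0..T}))"
      using a(2) b(2) by (meson bounded_Un bounded_insert bounded_subset)
    then show ?thesis using a b by (intro exI[of _ "{a<..<b}"]) auto
  qed
  then obtain U where U: "\<And>t. t \<in> {0..T} \<Longrightarrow> open (U t) \<and> t \<in> U t \<and> bounded (\<phi> ` (U t \<inter> {0..T}))"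
    by metis
  have op: "\<And>t. t \<in> {0..T} \<Longrightarrow> open (U t)" and cov: "{0..T} \<subseteq> (\<Union>t\<in>{0..T}. U t)" using U by auto
  obtain C where C: "C \<subseteq> {0..T}" "finite C" "{0..T} \<subseteq> (\<Union>t\<in>C. U t)"
    using compactE_image[OF compact_Icc op cov] by blast
  have "bounded (\<Union>t\<in>C. \<phi> ` (U t \<inter> {0..T}))" using C U by (intro bounded_UN) auto
  moreover have "\<phi> ` {0..T} \<subseteq> (\<Union>t\<in>C. \<phi> ` (U t \<inter> {0..T}))" using C(3) by blast
  ultimately show ?thesis using bounded_subset by blast
qed

lemma skorohod_dist_finite: assumes "\<phi> \<in> cadlag T S" "\<psi> \<in> cadlag T S"
  shows "(INF h\<in>time_changes T. skorohod_cost T \<phi> \<psi> h) < \<infinity>"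
proof -
  have "bounded (\<phi> ` {0..T} \<union> \<psi> ` {0..T})" using assms cadlag_bounded by auto
  then obtain e where e: "\<And>x y. x \<in> \<phi> ` {0..T} \<union> \<psi> ` {0..T} \<Longrightarrow> y \<in> \<phi> ` {0..T} \<union> \<psi> ` {0..T} \<Longrightarrow> dist x y \<le> e"
    by (metis bounded_two_points)
  have "skorohod_cost T \<phi> \<psi> (\<lambda>t. t) \<le> ennreal e"
    unfolding skorohod_cost_le_iff using e by (auto intro!: ennreal_leI)
  then have "(INF h\<in>time_changes T. skorohod_cost T \<phi> \<psi> h) \<le> ennreal e"
    using id_time_change by (meson INF_lower2)
  then show ?thesis by (simp add: le_less_trans)
qed

lemma ennreal_less_add_pos:
  fixes a :: ennreal
  assumes "a < \<infinity>" "0 < e"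
  shows "a < a + ennreal e"
  using assms by (cases a) (auto simp: ennreal_plus[symmetric] ennreal_less_iff simp del: ennreal_plus)

lemma skorohod_dist_triangle: 
  assumes "x \<in> cadlag T S" "y \<in> cadlag T S" "z \<in> cadlag T S"
  shows "skorohod_dist T x z \<le> skorohod_dist T x y + skorohod_dist T y z"
proof -
  have "(INF h\<in>time_changes T. skorohod_cost T x z h) \<le> skorohod_cost T x y f + skorohod_cost T y z g"
    if f: "f \<in> time_changes T" and g: "g \<in> time_changes T" for f g
  proof (rule INF_lower2[of "g \<circ> f"])
    show "g \<circ> f \<in> time_changes T"
    proof -
      have f': "strict_mono_on {0..T} f" "continuous_on {0..T} f" "f ` {0..T} = {0..T}"
        and g': "strict_mono_on {0..T} g" "continuous_on {0..T} g" "g ` {0..T} = {0..T}"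
        using f g by (auto simp: time_changes_def)
      have "strict_mono_on {0..T} (g \<circ> f)"
      proof (rule strict_mono_onI)
        fix r s assume rs: "r \<in> {0..T}" "s \<in> {0..T}" "r < s"
        have "f r \<in> {0..T}" "f s \<in> {0..T}" using f'(3) rs by blast+
        moreover have "f r < f s" using f'(1) rs by (rule strict_mono_onD)
        ultimately show "(g \<circ> f) r < (g \<circ> f) s" using strict_mono_onD[OF g'(1)] by simp
      qed
      moreover have "continuous_on {0..T} (g \<circ> f)"
        using f' g' by (intro continuous_on_compose) simp_all
      moreover have "(g \<circ> f) ` {0..T} = {0..T}" using f'(3) g'(3) by (metis image_comp)
      ultimately show ?thesis by (simp add: time_changes_def)
    qed
    show "skorohod_cost T x z (g \<circ> f) \<le> skorohod_cost T x y f + skorohod_cost T y z g"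
      unfolding skorohod_cost_le_iff
    proof
      fix t assume t: "t \<in> {0..T}"
      then have ft: "f t \<in> {0..T}" using f by (auto simp: time_changes_def)
      have 1: "ennreal \<bar>f t - t\<bar> \<le> skorohod_cost T x y f" "ennreal (dist (x t) (y (f t))) \<le> skorohod_cost T x y f"
        using skorohod_cost_le_iff[of T x y f "skorohod_cost T x y f"] t by auto
      have 2: "ennreal \<bar>g (f t) - f t\<bar> \<le> skorohod_cost T y z g" "ennreal (dist (y (f t)) (z (g (f t)))) \<le> skorohod_cost T y z g"
        using skorohod_cost_le_iff[of T y z g "skorohod_cost T y z g"] ft by auto
      have "\<bar>g (f t) - t\<bar> \<le> \<bar>f t - t\<bar> + \<bar>g (f t) - f t\<bar>" by linarith
      then have "ennreal \<bar>g (f t) - t\<bar> \<le> ennreal \<bar>f t - t\<bar> + ennreal \<bar>g (f t) - f t\<bar>"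
        by (metis ennreal_leI ennreal_plus abs_ge_zero)
      moreover have "ennreal (dist (x t) (z (g (f t)))) \<le> ennreal (dist (x t) (y (f t))) + ennreal (dist (y (f t)) (z (g (f t))))"
        by (metis ennreal_leI ennreal_plus zero_le_dist dist_triangle)
      ultimately show "ennreal \<bar>(g \<circ> f) t - t\<bar> \<le> skorohod_cost T x y f + skorohod_cost T y z g \<and>
         ennreal (dist (x t) (z ((g \<circ> f) t))) \<le> skorohod_cost T x y f + skorohod_cost T y z g"
        using 1 2 by (auto intro: order_trans add_mono)
    qed
  qed
  note le = this
  have *: "(INF h\<in>time_changes T. skorohod_cost T x z h)
      \<le> (INF f\<in>time_changes T. skorohod_cost T x y f) + (INF g\<in>time_changes T. skorohod_cost T y z g)"
    (is "?C \<le> ?A + ?B")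
  proof (rule ennreal_le_epsilon)
    fix e :: real assume e: "0 < e"
    have "?A < ?A + ennreal (e / 2)"
      using e by (intro ennreal_less_add_pos skorohod_dist_finite[OF assms(1,2)]) simp
    then obtain f where f: "f \<in> time_changes T" "skorohod_cost T x y f < ?A + ennreal (e / 2)"
      by (metis (no_types, lifting) INF_less_iff)
    have "?B < ?B + ennreal (e / 2)"
      using e by (intro ennreal_less_add_pos skorohod_dist_finite[OF assms(2,3)]) simp
    then obtain g where g: "g \<in> time_changes T" "skorohod_cost T y z g < ?B + ennreal (e / 2)"
      by (metis (no_types, lifting) INF_less_iff)
    have "?C \<le> skorohod_cost T x y f + skorohod_cost T y z g" using f g by (intro le)
    also have "\<dots> \<le> (?A + ennreal (e / 2)) + (?B + ennreal (e / 2))"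
      using f g by (intro add_mono less_imp_le)
    also have "\<dots> = ?A + ?B + (ennreal (e / 2) + ennreal (e / 2))" by (simp add: ac_simps)
    also have "ennreal (e / 2) + ennreal (e / 2) = ennreal e"
      using e by (subst ennreal_plus[symmetric]) auto
    finally show "?C \<le> ?A + ?B + ennreal e" .
  qed
  show ?thesis unfolding skorohod_dist_def
    using * skorohod_dist_finite[OF assms(1,2)] skorohod_dist_finite[OF assms(2,3)]
    by (subst enn2real_plus[symmetric]) (auto intro!: enn2real_mono)
qed

lemma skorohod_dist_zero:
  assumes x: "x \<in> cadlag T S" and y: "y \<in> cadlag T S" and d: "skorohod_dist T x y = 0"
  shows "x = y"
proof -
  have I0: "(INF h\<in>time_changes T. skorohod_cost T x y h) = 0"
    using d skorohod_dist_finite[OF x y] by (auto simp: skorohod_dist_def enn2real_eq_0_iff)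
  have ap: "\<exists>h\<in>time_changes T. \<forall>t\<in>{0..T}. \<bar>h t - t\<bar> < e \<and> dist (x t) (y (h t)) < e" if "e > 0" for e
  proof -
    have "(INF h\<in>time_changes T. skorohod_cost T x y h) < ennreal e" using I0 that by simp
    then obtain h where h: "h \<in> time_changes T" "skorohod_cost T x y h < ennreal e" by (auto simp: INF_less_iff)
    have "ennreal \<bar>h t - t\<bar> < ennreal e \<and> ennreal (dist (x t) (y (h t))) < ennreal e" if "t \<in> {0..T}" for t
      using skorohod_cost_le_iff[of T x y h "skorohod_cost T x y h"] h(2) that le_less_trans by blast
    then show ?thesis using h(1) by (intro bexI[of _ h]) (auto simp: ennreal_less_iff)
  qed
  have "x t = y t" if t: "t \<in> {0..T}" for t
  proof (cases "t < T")
    case False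
    then have tT: "t = T" using t by simp
    have "dist (x t) (y t) < e" if e: "e > 0" for e
    proof -
      obtain h where h: "h \<in> time_changes T" "\<forall>t\<in>{0..T}. dist (x t) (y (h t)) < e" using ap[OF e] by blast
      have "h T = T"
      proof -
        have "T \<in> h ` {0..T}" using h(1) t tT by (simp add: time_changes_def)
        then obtain s where s: "s \<in> {0..T}" "h s = T" by (metis imageE)
        have "h T \<le> T" using h(1) t tT unfolding time_changes_def by auto
        have sm: "strict_mono_on {0..T} h" using h(1) by (simp add: time_changes_def)
        have "h s \<le> h T"
        proof (cases "s = T")
          case False
          then have "s < T" "T \<in> {0..T}" using s(1) by auto
          then show ?thesis using strict_mono_onD[OF sm s(1)] by (simp add: less_imp_le)
        qed simp
        then show ?thesis using s \<open>h T \<le> T\<close> by simp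
      qed
      moreover have "T \<in> {0..T}" using t tT by simp
      ultimately show ?thesis using h(2)[rule_format, of T] tT by simp
    qed
    from this[of "dist (x t) (y t)"] show ?thesis by auto
  next
    case True
    have xr: "(x \<longlongrightarrow> x t) (at_right t)" and yr: "(y \<longlongrightarrow> y t) (at_right t)" using True t x y by (auto simp: cadlag_def)
    have "dist (x t) (y t) < 3 * e" if e: "e > 0" for e
    proof -
      obtain b where b: "b > t" "\<And>s. t < s \<Longrightarrow> s < b \<Longrightarrow> dist (x s) (x t) < e"
        using tendstoD[OF xr e] unfolding eventually_at_right_field by blast
      obtain c where c: "c > t" "\<And>s. t < s \<Longrightarrow> s < c \<Longrightarrow> dist (y s) (y t) < e"
        using tendstoD[OF yr e] unfolding eventually_at_right_field by blast
      define s where "s = (t + min (min b c) T) / 2"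
      have s: "t < s" "s < b" "s < c" "s < T" using b c True by (auto simp: s_def)
      define k where "k = min e (min (s - t) (c - s))"
      have k: "k > 0" using e s by (simp add: k_def)
      obtain h where h: "\<forall>t\<in>{0..T}. \<bar>h t - t\<bar> < k \<and> dist (x t) (y (h t)) < k" using ap[OF k] by blast
      have sT: "s \<in> {0..T}" using s t by auto
      have "t < h s" "h s < c" "dist (x s) (y (h s)) < e" using h[rule_format, OF sT] by (auto simp: k_def)
      then have "dist (y (h s)) (y t) < e" "dist (x s) (x t) < e" "dist (x s) (y (h s)) < e" using b c s by auto
      then show ?thesis
        using dist_triangle[of "x t" "y t" "x s"] dist_triangle[of "x s" "y t" "y (h s)"] by (simp add: dist_commute)
    qed
    from this[of "dist (x t) (y t) / 3"] show ?thesis by auto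
  qed
  moreover have "x \<in> {0..T} \<rightarrow>\<^sub>E S" "y \<in> {0..T} \<rightarrow>\<^sub>E S" using x y by (simp_all add: cadlag_def)
  ultimately show ?thesis by (intro PiE_ext[of x "{0..T}" "\<lambda>_. S" y]) simp_all
qed

lemma Metric_space_skorohod: "Metric_space (cadlag T S) (skorohod_dist T)"
proof
  fix x y z :: "real \<Rightarrow> 'a"
  show "0 \<le> skorohod_dist T x y" by (simp add: skorohod_dist_def)
  show "skorohod_dist T x y = skorohod_dist T y x" by (rule skorohod_dist_commute)
  show "(skorohod_dist T x y = 0) = (x = y)" if "x \<in> cadlag T S" "y \<in> cadlag T S"
  proof
    assume "x = y"
    have "skorohod_cost T y y (\<lambda>t. t) \<le> 0" unfolding skorohod_cost_le_iff by simp
    then have "(INF h\<in>time_changes T. skorohod_cost T y y h) \<le> 0" using id_time_change by (meson INF_lower2)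
    then show "skorohod_dist T x y = 0" using \<open>x = y\<close> by (simp add: skorohod_dist_def)
  qed (use skorohod_dist_zero that in blast)
  show "skorohod_dist T x z \<le> skorohod_dist T x y + skorohod_dist T y z"
    if "x \<in> cadlag T S" "y \<in> cadlag T S" "z \<in> cadlag T S" using skorohod_dist_triangle that by blast
qed

definition skorohod_topology :: "real \<Rightarrow> 'a::metric_space set \<Rightarrow> (real \<Rightarrow> 'a) topology" where
  "skorohod_topology T S = Metric_space.mtopology (cadlag T S) (skorohod_dist T)"


section \<open>The sample path large deviation assumptions\<close>

definition limit_cone :: "'a::real_normed_vector set \<Rightarrow> 'a set" where
  "limit_cone E = {z. \<exists>x. (\<forall>a. x a \<in> E) \<and> ((\<lambda>a::real. x a /\<^sub>R a) \<longlongrightarrow> z) at_top}"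

definition rescaled_path ::
  "(real \<Rightarrow> 'w \<Rightarrow> 'a::real_vector) \<Rightarrow> real \<Rightarrow> real \<Rightarrow> 'w \<Rightarrow> real \<Rightarrow> 'a" where
  "rescaled_path X a T \<omega> = (\<lambda>t\<in>{0..T}. X (a * t) \<omega> /\<^sub>R a)"

definition log_prob_rescaled ::
  "'w measure \<Rightarrow> ('a::real_vector \<Rightarrow> 'w measure) \<Rightarrow> (real \<Rightarrow> 'w \<Rightarrow> 'a) \<Rightarrow>
   real \<Rightarrow> (real \<Rightarrow> 'a) set \<Rightarrow> real \<Rightarrow> 'a \<Rightarrow> ereal" where
  "log_prob_rescaled M P X T \<A> a z =
     elog (measure (P (a *\<^sub>R z)) {\<omega> \<in> space M. rescaled_path X a T \<omega> \<in> \<A>}) / ereal a"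

definition starts_near :: "'a::real_normed_vector set \<Rightarrow> real \<Rightarrow> 'a \<Rightarrow> real \<Rightarrow> 'a set" where
  "starts_near E a x \<epsilon> = {z. a *\<^sub>R z \<in> E \<and> norm (z - x) < \<epsilon>}"

definition sample_path_LDP ::
  "'w measure \<Rightarrow> ('a::real_normed_vector \<Rightarrow> 'w measure) \<Rightarrow> (real \<Rightarrow> 'w \<Rightarrow> 'a) \<Rightarrow> 'a set \<Rightarrow>
   real \<Rightarrow> ((real \<Rightarrow> 'a) \<Rightarrow> ereal) \<Rightarrow> bool" where
  "sample_path_LDP M P X E T J \<longleftrightarrow>
     (\<forall>\<phi>\<in>cadlag T (limit_cone E). 0 \<le> J \<phi>) \<and>
     (\<forall>c>0. \<forall>V. compact V \<and> V \<subseteq> limit_cone E \<longrightarrow>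
        compactin (skorohod_topology T (limit_cone E))
          {\<phi> \<in> cadlag T (limit_cone E). \<phi> 0 \<in> V \<and> J \<phi> \<le> ereal c}) \<and>
     (\<forall>x\<in>limit_cone E. \<forall>\<O>. openin (skorohod_topology T (limit_cone E)) \<O> \<longrightarrow>
        (\<exists>l. ((\<lambda>\<epsilon>. Liminf at_top (\<lambda>a. INF z\<in>starts_near E a x \<epsilon>. log_prob_rescaled M P X T \<O> a z))
                \<longlongrightarrow> l) (at_right 0) \<and>
             l \<ge> - (INF \<phi>\<in>{\<phi> \<in> \<O>. \<phi> 0 = x}. J \<phi>))) \<and>
     (\<forall>x\<in>limit_cone E. \<forall>C. closedin (skorohod_topology T (limit_cone E)) C \<longrightarrow>
        (\<exists>l. ((\<lambda>\<epsilon>. Limsup at_top (\<lambda>a. SUP z\<in>starts_near E a x \<epsilon>. log_prob_rescaled M P X T C a z))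
                \<longlongrightarrow> l) (at_right 0) \<and>
             l \<le> - (INF \<phi>\<in>{\<phi> \<in> C. \<phi> 0 = x}. J \<phi>)))"

definition abs_continuous_on :: "real \<Rightarrow> (real \<Rightarrow> 'a::real_normed_vector) \<Rightarrow> bool" where
  "abs_continuous_on T \<phi> \<longleftrightarrow>
     (\<forall>\<epsilon>>0. \<exists>\<delta>>0. \<forall>(n::nat) a b.
        (\<forall>i<n. 0 \<le> a i \<and> a i \<le> b i \<and> b i \<le> T) \<and>
        disjoint_family_on (\<lambda>i. {a i<..<b i}) {..<n} \<and> (\<Sum>i<n. b i - a i) < \<delta> \<longrightarrow>
        (\<Sum>i<n. norm (\<phi> (b i) - \<phi> (a i))) < \<epsilon>)"

text \<open>An absolutely continuous function is differentiable almost everywhere, so the (arbitrary)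
  value of \<^const>\<open>vector_derivative\<close> at the remaining points is irrelevant.\<close>

definition action_functional ::
  "('a::real_normed_vector \<Rightarrow> 'a \<Rightarrow> real) \<Rightarrow> real \<Rightarrow> (real \<Rightarrow> 'a) \<Rightarrow> ereal" where
  "action_functional L T \<phi> = enn2ereal
     (\<integral>\<^sup>+t\<in>{0..T}. ennreal (L (\<phi> t) (vector_derivative \<phi> (at t within {0..T}))) \<partial>lebesgue)"

text \<open>The measurability clause is what makes the integral in the second clause meaningful.\<close>

definition lagrangian_for ::
  "'a::real_normed_vector set \<Rightarrow> (real \<Rightarrow> (real \<Rightarrow> 'a) \<Rightarrow> ereal) \<Rightarrow> ('a \<Rightarrow> 'a \<Rightarrow> real) \<Rightarrow> bool" where
  "lagrangian_for S I L \<longleftrightarrow>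
     (\<forall>x\<in>S. \<forall>v. 0 \<le> L x v) \<and>
     (\<forall>T>0. \<forall>\<phi>\<in>cadlag T S. abs_continuous_on T \<phi> \<longrightarrow>
        set_borel_measurable lebesgue {0..T}
          (\<lambda>t. L (\<phi> t) (vector_derivative \<phi> (at t within {0..T}))) \<and>
        I T \<phi> = action_functional L T \<phi>) \<and>
     (\<forall>T>0. \<forall>\<phi>\<in>cadlag T S. \<not> abs_continuous_on T \<phi> \<longrightarrow> I T \<phi> = \<infinity>)"

definition ereal_convex :: "('a::real_vector \<Rightarrow> ereal) \<Rightarrow> bool" where
  "ereal_convex f \<longleftrightarrow>
     (\<forall>x y u. 0 < u \<and> u < 1 \<longrightarrow>
        f ((1 - u) *\<^sub>R x + u *\<^sub>R y) \<le> ereal (1 - u) * f x + ereal u * f y)"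

definition lagrangian_bounds ::
  "'a::real_normed_vector set \<Rightarrow> ('a \<Rightarrow> 'a \<Rightarrow> real) \<Rightarrow> ('a \<Rightarrow> real) \<Rightarrow> ('a \<Rightarrow> ereal) \<Rightarrow> bool" where
  "lagrangian_bounds S L l1 l2 \<longleftrightarrow>
     convex_on UNIV l1 \<and> ereal_convex l2 \<and>
     (\<forall>x\<in>S. \<forall>v. 0 \<le> l1 v \<and> l1 v \<le> L x v \<and> ereal (L x v) \<le> l2 v) \<and>
     (\<forall>\<^sub>F v in nhds 0. l2 v < \<infinity>) \<and>
     (\<exists>c>0. (\<lambda>n::nat. INF v\<in>{v. real n \<le> norm v}. ereal (l1 v / norm v)) \<longlonglongrightarrow> c)"

definition assumption_A ::
  "'w measure \<Rightarrow> ('a::real_normed_vector \<Rightarrow> 'w measure) \<Rightarrow> (real \<Rightarrow> 'w \<Rightarrow> 'a) \<Rightarrow> 'a set \<Rightarrow>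
   (real \<Rightarrow> (real \<Rightarrow> 'a) \<Rightarrow> ereal) \<Rightarrow> bool" where
  "assumption_A M P X E I \<longleftrightarrow>
     E \<subseteq> limit_cone E \<and> limit_cone E \<noteq> {0} \<and> convex (limit_cone E - {0}) \<and>
     (\<forall>T>0. sample_path_LDP M P X E T (I T)) \<and>
     (\<exists>L. lagrangian_for (limit_cone E) I L \<and>
        (\<exists>l1 l2. lagrangian_bounds (limit_cone E) L l1 l2))"

definition min_cost ::
  "'a::topological_space set \<Rightarrow> (real \<Rightarrow> (real \<Rightarrow> 'a) \<Rightarrow> ereal) \<Rightarrow> real \<Rightarrow> 'a \<Rightarrow> 'a \<Rightarrow> ereal" where
  "min_cost S I t x y = (INF \<phi>\<in>{\<phi> \<in> cont_paths t S. \<phi> 0 = x \<and> \<phi> t = y}. I t \<phi>)"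

end

theory Submission
  imports Defs
begin

text \<open>Let \<open>q = I\<^bsub>[0,1]\<^esub>(0)\<close>. Confronting the large deviation bounds for \<open>Z\<^bsub>a\<^esub>\<close> and \<open>Z\<^bsub>ka\<^esub>\<close> shows that the
  rate function is invariant under \<open>\<phi> \<mapsto> \<phi>(k \<cdot>) / k\<close>. Hence a loop can be run \<open>n\<close> times on the scale
  \<open>1 / n\<close> at unchanged cost; these paths converge to the path at rest in \<open>0\<close>, so lower semicontinuity
  shows that a loop of duration \<open>T\<close> costs at least \<open>T q\<close>. Since any two points of the limit cone are
  joined through \<open>0\<close> in a fixed time at finite cost, all the variational expressions equal \<open>q\<close>.
  For the spectral radius, the upper large deviation bound gives \<open>P\<^bsub>x\<^esub>(X(t) \<in> W) \<le> exp (-(q - \<eta>) t)\<close>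
  for large \<open>t\<close>, uniformly on compact sets. Conversely, the lower bound gives
  \<open>P\<^bsub>x\<^esub>(\<bar>X(a)\<bar> \<le> R) \<ge> exp (-(q + \<eta>) a)\<close> uniformly for \<open>\<bar>x\<bar> \<le> R\<close> and \<open>a\<close> in an interval
  \<open>[t\<^sub>0, 2 t\<^sub>0]\<close>, and iterating it with the Markov property covers all \<open>t \<ge> t\<^sub>0\<close>.\<close>

section \<open>Limit cones\<close>

text \<open>\<open>L\<close> is only squeezed between \<open>l1\<close> and \<open>l2\<close>;
  neither continuity in the position nor convexity of \<open>L\<close> itself is available, so the
  cost of loops cannot be bounded by a Jensen argument. The scaling symmetry is therefore read off
  the probabilities, where it is exact, and lower semicontinuity replaces convexity. What the
  Lagrangian supplies is additivity under concatenation and a cheap way to move: slow velocities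
  cost at most \<open>B\<close> per unit of time, and in a cone the segment to the origin stays
  inside. A path that ends near 0 can thus be closed up by a short detour of small cost.

  Measurability is the second obstacle. The preimage of a general Skorohod open set is not known to
  be an event, and \<open>measure\<close> is 0 on non-measurable sets. Comparisons of probabilities
  are arranged so that the larger set is an event, which is enough for monotonicity.

  In the iteration one fixed ball has to serve as start and target for all step lengths in an
  interval. Aiming at half the starting radius absorbs the factor 2 between the ends of that
  interval.\<close>

lemma dist_scaleR_left:
  fixes x y :: "'a::real_normed_vector"
  shows "dist (a *\<^sub>R x) (a *\<^sub>R y) = \<bar>a\<bar> * dist x y"
  by (simp add: dist_norm scaleR_right_diff_distrib[symmetric])

text \<open>Nearest points of \<open>E\<close> are an optimal choice of approximants, so the
  existential over families \<open>x\<close> disappears. What remains is a condition on functions of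
  \<open>z\<close> that are 1-Lipschitz for every \<open>a > 0\<close>, which suits the closedness
  proof.\<close>

lemma limit_cone_iff_infdist:
  fixes E :: "'a::euclidean_space set"
  assumes "closed E" "E \<noteq> {}"
  shows "z \<in> limit_cone E \<longleftrightarrow> ((\<lambda>a::real. infdist (a *\<^sub>R z) E / a) \<longlongrightarrow> 0) at_top"
proof
  assume "z \<in> limit_cone E"
  then obtain x where x: "\<And>a. x a \<in> E" "((\<lambda>a::real. x a /\<^sub>R a) \<longlongrightarrow> z) at_top"
    unfolding limit_cone_def by auto
  have le: "infdist (a *\<^sub>R z) E / a \<le> dist (x a /\<^sub>R a) z" if "a > 0" for a
  proof -
    have "infdist (a *\<^sub>R z) E \<le> dist (a *\<^sub>R z) (x a)" by (rule infdist_le) (rule x)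
    also have "x a = a *\<^sub>R (x a /\<^sub>R a)" using that by simp
    also have "dist (a *\<^sub>R z) (a *\<^sub>R (x a /\<^sub>R a)) = a * dist (x a /\<^sub>R a) z"
      using that by (simp only: dist_scaleR_left abs_of_pos dist_commute)
    finally show ?thesis using that by (simp add: divide_simps mult.commute)
  qed
  have "\<forall>\<^sub>F a in at_top. norm (infdist (a *\<^sub>R z) E / a) \<le> dist (x a /\<^sub>R a) z"
    using eventually_gt_at_top[of 0]
    by eventually_elim (use le in \<open>auto simp: infdist_nonneg\<close>)
  then show "((\<lambda>a::real. infdist (a *\<^sub>R z) E / a) \<longlongrightarrow> 0) at_top"
    by (rule Lim_null_comparison) (rule tendsto_dist_iff[THEN iffD1, OF x(2)])
next
  assume lim: "((\<lambda>a::real. infdist (a *\<^sub>R z) E / a) \<longlongrightarrow> 0) at_top"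
  have "\<exists>y\<in>E. infdist (a *\<^sub>R z) E = dist (a *\<^sub>R z) y" for a
    using infdist_attains_inf[OF assms, of "a *\<^sub>R z"] by metis
  then obtain x where x: "\<And>a. x a \<in> E" "\<And>a. infdist (a *\<^sub>R z) E = dist (a *\<^sub>R z) (x a)"
    by metis
  have eq: "dist (x a /\<^sub>R a) z = infdist (a *\<^sub>R z) E / a" if "a > 0" for a
  proof -
    have "dist (a *\<^sub>R z) (x a) = dist (a *\<^sub>R z) (a *\<^sub>R (x a /\<^sub>R a))" using that by simp
    also have "\<dots> = a * dist (x a /\<^sub>R a) z"
      using that by (simp only: dist_scaleR_left abs_of_pos dist_commute)
    finally show ?thesis using that x by simp
  qed
  have "\<forall>\<^sub>F a in at_top. infdist (a *\<^sub>R z) E / a = dist (x a /\<^sub>R a) z"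
    using eventually_gt_at_top[of 0] by eventually_elim (use eq in simp)
  then have "((\<lambda>a. dist (x a /\<^sub>R a) z) \<longlongrightarrow> 0) at_top"
    by (rule Lim_transform_eventually[OF lim])
  then have "((\<lambda>a::real. x a /\<^sub>R a) \<longlongrightarrow> z) at_top" by (rule tendsto_dist_iff[THEN iffD2])
  then show "z \<in> limit_cone E" using x(1) unfolding limit_cone_def by blast
qed

lemma zero_in_limit_cone:
  assumes "E \<noteq> {}" shows "0 \<in> limit_cone E"
proof -
  obtain e where e: "e \<in> E" using assms by auto
  have "((\<lambda>a::real. inverse a *\<^sub>R e) \<longlongrightarrow> 0 *\<^sub>R e) at_top"
    by (intro tendsto_intros tendsto_inverse_0_at_top filterlim_ident)
  then show ?thesis unfolding limit_cone_def using e by (auto intro!: exI[of _ "\<lambda>_. e"])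
qed

text \<open>Reparametrise the scale: \<open>x (c * a)\<close> divided by \<open>a\<close> is
  \<open>c\<close> times \<open>x (c * a)\<close> divided by \<open>c * a\<close>. This cone
  property keeps rescaled paths and segments to the origin inside the state space.\<close>

lemma scaleR_in_limit_cone:
  assumes z: "z \<in> limit_cone E" and c: "c \<ge> 0" shows "c *\<^sub>R z \<in> limit_cone E"
proof (cases "c = 0")
  case True
  have "E \<noteq> {}" using z by (auto simp: limit_cone_def)
  then show ?thesis using True zero_in_limit_cone by simp
next
  case False
  then have c: "c > 0" using c by simp
  obtain x where x: "\<And>a. x a \<in> E" "((\<lambda>a::real. x a /\<^sub>R a) \<longlongrightarrow> z) at_top"
    using z unfolding limit_cone_def by auto
  have "filterlim (\<lambda>a. c * a) at_top at_top"
    by (rule filterlim_tendsto_pos_mult_at_top[OF tendsto_const c filterlim_ident])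
  then have "((\<lambda>a. c *\<^sub>R (x (c * a) /\<^sub>R (c * a))) \<longlongrightarrow> c *\<^sub>R z) at_top"
    by (intro tendsto_intros filterlim_compose[OF x(2)])
  moreover have "c *\<^sub>R (x (c * a) /\<^sub>R (c * a)) = x (c * a) /\<^sub>R a" for a
    using c by (simp only: scaleR_scaleR) simp
  ultimately have "((\<lambda>a. x (c * a) /\<^sub>R a) \<longlongrightarrow> c *\<^sub>R z) at_top" by (simp only:)
  then show ?thesis unfolding limit_cone_def using x(1)
    by (intro CollectI exI[of _ "\<lambda>a. x (c * a)"] conjI allI)
qed

text \<open>Serves twice: left limits of rescaled paths stay in the cone, and its intersection with
  a closed ball is compact.\<close>

lemma closed_limit_cone:
  fixes E :: "'a::euclidean_space set"
  assumes "closed E" shows "closed (limit_cone E)"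
proof (cases "E = {}")
  case True then show ?thesis by (simp add: limit_cone_def)
next
  case False
  have "z \<in> limit_cone E" if z: "z \<in> closure (limit_cone E)" for z
    unfolding limit_cone_iff_infdist[OF assms False]
  proof (rule tendstoI)
    fix e :: real assume e: "e > 0"
    obtain y where y: "y \<in> limit_cone E" "dist y z < e / 2"
      using z e unfolding closure_approachable by (meson half_gt_zero)
    have "((\<lambda>a::real. infdist (a *\<^sub>R y) E / a) \<longlongrightarrow> 0) at_top"
      using y(1) unfolding limit_cone_iff_infdist[OF assms False] .
    then have "\<forall>\<^sub>F a in at_top. dist (infdist (a *\<^sub>R y) E / a) 0 < e / 2"
      by (rule tendstoD) (use e in simp)
    then show "\<forall>\<^sub>F a in at_top. dist (infdist (a *\<^sub>R z) E / a) 0 < e"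
      using eventually_gt_at_top[of 0]
    proof eventually_elim
      case (elim a)
      have "infdist (a *\<^sub>R z) E \<le> infdist (a *\<^sub>R y) E + dist (a *\<^sub>R z) (a *\<^sub>R y)"
        by (rule infdist_triangle)
      also have "dist (a *\<^sub>R z) (a *\<^sub>R y) = a * dist y z"
        using elim by (simp add: dist_scaleR_left dist_commute)
      finally have "infdist (a *\<^sub>R z) E / a \<le> infdist (a *\<^sub>R y) E / a + dist y z"
        using elim by (simp add: field_simps)
      moreover have "infdist (a *\<^sub>R y) E / a < e / 2"
        using elim by (simp add: infdist_nonneg)
      ultimately have "infdist (a *\<^sub>R z) E / a < e" using y(2) by linarith
      then show ?case using elim by (simp add: infdist_nonneg)
    qed
  qed
  then show ?thesis using closure_subset_eq by blast
qed

text \<open>The large deviation bounds quantify over starting points in \<open>E\<close> divided by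
  \<open>a\<close>. Without an actual such point, playing a lower bound against an upper bound would
  be vacuous.\<close>

lemma eventually_starts_near_nonempty:
  assumes "x \<in> limit_cone E" "\<epsilon> > 0"
  shows "\<forall>\<^sub>F a in at_top. starts_near E a x \<epsilon> \<noteq> {}"
proof -
  obtain y where y: "\<And>a. y a \<in> E" "((\<lambda>a::real. y a /\<^sub>R a) \<longlongrightarrow> x) at_top"
    using assms(1) unfolding limit_cone_def by auto
  have "\<forall>\<^sub>F a in at_top. dist (y a /\<^sub>R a) x < \<epsilon>" using y(2) assms(2) by (rule tendstoD)
  then show ?thesis using eventually_gt_at_top[of 0]
  proof eventually_elim
    case (elim a)
    then have "y a /\<^sub>R a \<in> starts_near E a x \<epsilon>" using y(1) by (simp add: starts_near_def dist_norm)
    then show ?case by blast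
  qed
qed

section \<open>The Skorohod metric\<close>

lemma time_change_end:
  assumes h: "h \<in> time_changes T" and "0 \<le> T" shows "h T = T"
proof -
  have im: "h ` {0..T} = {0..T}" and sm: "strict_mono_on {0..T} h"
    using h by (auto simp: time_changes_def)
  obtain s where s: "s \<in> {0..T}" "h s = T" using im \<open>0 \<le> T\<close> by (metis atLeastAtMost_iff imageE order_refl)
  have "h T \<le> T" using im \<open>0 \<le> T\<close> by auto
  moreover have "h s \<le> h T"
    using strict_mono_onD[OF sm s(1), of T] s(1) \<open>0 \<le> T\<close> by (cases "s = T") auto
  ultimately show ?thesis using s by simp
qed

lemma time_change_in:
  "h \<in> time_changes T \<Longrightarrow> t \<in> {0..T} \<Longrightarrow> h t \<in> {0..T}"
  unfolding time_changes_def by auto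

lemma skorohod_dist_le_uniform:
  assumes "\<And>t. t \<in> {0..T} \<Longrightarrow> dist (\<phi> t) (\<psi> t) \<le> r" "0 \<le> r"
  shows "skorohod_dist T \<phi> \<psi> \<le> r"
proof -
  have "skorohod_cost T \<phi> \<psi> (\<lambda>t. t) \<le> ennreal r"
    unfolding skorohod_cost_le_iff using assms by (auto intro!: ennreal_leI)
  then have "(INF h\<in>time_changes T. skorohod_cost T \<phi> \<psi> h) \<le> ennreal r"
    using id_time_change by (meson INF_lower2)
  then show ?thesis unfolding skorohod_dist_def using assms(2)
    by (metis enn2real_ennreal enn2real_mono ennreal_less_top)
qed

lemma skorohod_dist_lessD:
  assumes "\<phi> \<in> cadlag T S" "\<psi> \<in> cadlag T S" "skorohod_dist T \<phi> \<psi> < r"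
  obtains h where "h \<in> time_changes T"
    "\<And>t. t \<in> {0..T} \<Longrightarrow> \<bar>h t - t\<bar> < r" "\<And>t. t \<in> {0..T} \<Longrightarrow> dist (\<phi> t) (\<psi> (h t)) < r"
proof -
  \<comment> \<open>\<open>enn2real\<close> sends infinity to 0, so a small
    \<open>skorohod_dist\<close> bounds the infimum only once that infimum is known to be
    finite.\<close>
  have fin: "(INF h\<in>time_changes T. skorohod_cost T \<phi> \<psi> h) < \<infinity>"
    by (rule skorohod_dist_finite[OF assms(1,2)])
  have "(INF h\<in>time_changes T. skorohod_cost T \<phi> \<psi> h) < ennreal r"
    using assms(3) fin unfolding skorohod_dist_def
    by (metis enn2real_nonneg ennreal_enn2real ennreal_less_iff infinity_ennreal_def)
  then obtain h where h: "h \<in> time_changes T" "skorohod_cost T \<phi> \<psi> h < ennreal r"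
    by (auto simp: INF_less_iff)
  have "ennreal \<bar>h t - t\<bar> < ennreal r \<and> ennreal (dist (\<phi> t) (\<psi> (h t))) < ennreal r"
    if "t \<in> {0..T}" for t
    using skorohod_cost_le_iff[of T \<phi> \<psi> h "skorohod_cost T \<phi> \<psi> h"] h(2) that le_less_trans by blast
  then show thesis using that h(1) by (auto simp: ennreal_less_iff)
qed

lemma topspace_skorohod [simp]: "topspace (skorohod_topology T S) = cadlag T S"
  by (simp add: skorohod_topology_def Metric_space.topspace_mtopology[OF Metric_space_skorohod])

lemma openin_skorohod_iff:
  "openin (skorohod_topology T S) U \<longleftrightarrow>
     U \<subseteq> cadlag T S \<and> (\<forall>\<phi>\<in>U. \<exists>r>0. \<forall>\<psi>\<in>cadlag T S. skorohod_dist T \<phi> \<psi> < r \<longrightarrow> \<psi> \<in> U)"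
proof -
  have "Metric_space.mball (cadlag T S) (skorohod_dist T) \<phi> r \<subseteq> U \<longleftrightarrow>
      (\<forall>\<psi>\<in>cadlag T S. skorohod_dist T \<phi> \<psi> < r \<longrightarrow> \<psi> \<in> U)" if "\<phi> \<in> cadlag T S" for \<phi> r
    using that by (auto simp: subset_iff Metric_space.in_mball[OF Metric_space_skorohod])
  then show ?thesis
    unfolding skorohod_topology_def Metric_space.openin_mtopology[OF Metric_space_skorohod]
    by (metis subset_iff)
qed

lemma closedin_skorohod_iff:
  "closedin (skorohod_topology T S) C \<longleftrightarrow>
     C \<subseteq> cadlag T S \<and>
     (\<forall>\<phi>\<in>cadlag T S - C. \<exists>r>0. \<forall>\<psi>\<in>cadlag T S. skorohod_dist T \<phi> \<psi> < r \<longrightarrow> \<psi> \<notin> C)"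
  unfolding closedin_def openin_skorohod_iff by auto

lemma openin_skorohod_ball:
  "openin (skorohod_topology T S) {\<psi> \<in> cadlag T S. skorohod_dist T \<phi> \<psi> < r}" if "\<phi> \<in> cadlag T S"
proof -
  have "{\<psi> \<in> cadlag T S. skorohod_dist T \<phi> \<psi> < r} = Metric_space.mball (cadlag T S) (skorohod_dist T) \<phi> r"
    using that by (auto simp: Metric_space.in_mball[OF Metric_space_skorohod])
  then show ?thesis
    by (simp add: skorohod_topology_def Metric_space.openin_mball[OF Metric_space_skorohod])
qed

lemma compactin_skorohod_closedin:
  "compactin (skorohod_topology T S) C \<Longrightarrow> closedin (skorohod_topology T S) C"
  by (rule compactin_imp_closedin)
     (auto simp: skorohod_topology_def Metric_space.Hausdorff_space_mtopology[OF Metric_space_skorohod])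

text \<open>Evaluation at an interior time is not Skorohod continuous, but every time change fixes
  \<open>T\<close>. Hence conditions on the final value define open and closed sets of paths, and
  these correspond to events about a single variable of the process.\<close>

lemma skorohod_dist_end:
  assumes "\<phi> \<in> cadlag T S" "\<psi> \<in> cadlag T S" "0 \<le> T"
  shows "dist (\<phi> T) (\<psi> T) \<le> skorohod_dist T \<phi> \<psi>"
proof (rule dense_ge)
  fix r assume "skorohod_dist T \<phi> \<psi> < r"
  then obtain h where h: "h \<in> time_changes T" "\<And>t. t \<in> {0..T} \<Longrightarrow> \<bar>h t - t\<bar> < r"
      "\<And>t. t \<in> {0..T} \<Longrightarrow> dist (\<phi> t) (\<psi> (h t)) < r"
    by (rule skorohod_dist_lessD[OF assms(1,2)]) blast
  then show "dist (\<phi> T) (\<psi> T) \<le> r"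
    using h(3)[of T] time_change_end[OF h(1) assms(3)] assms(3) by simp
qed

lemma openin_skorohod_end:
  fixes S :: "'a::real_normed_vector set"
  assumes "0 \<le> T"
  shows "openin (skorohod_topology T S) {\<phi> \<in> cadlag T S. norm (\<phi> T) < \<delta>}"
  unfolding openin_skorohod_iff
proof (intro conjI ballI)
  fix \<phi> assume \<phi>: "\<phi> \<in> {\<phi> \<in> cadlag T S. norm (\<phi> T) < \<delta>}"
  show "\<exists>r>0. \<forall>\<psi>\<in>cadlag T S. skorohod_dist T \<phi> \<psi> < r \<longrightarrow> \<psi> \<in> {\<phi> \<in> cadlag T S. norm (\<phi> T) < \<delta>}"
  proof (intro exI[of _ "\<delta> - norm (\<phi> T)"] conjI ballI impI)
    fix \<psi> assume \<psi>: "\<psi> \<in> cadlag T S" "skorohod_dist T \<phi> \<psi> < \<delta> - norm (\<phi> T)"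
    have "dist (\<phi> T) (\<psi> T) < \<delta> - norm (\<phi> T)"
      using skorohod_dist_end[of \<phi> T S \<psi>] \<phi> \<psi> assms by auto
    then show "\<psi> \<in> {\<phi> \<in> cadlag T S. norm (\<phi> T) < \<delta>}" using \<psi>(1)
      using norm_triangle_ineq2[of "\<psi> T" "\<phi> T"] by (simp add: dist_norm norm_minus_commute)
  qed (use \<phi> in auto)
qed auto

lemma closedin_skorohod_end:
  fixes S :: "'a::real_normed_vector set"
  assumes "0 \<le> T"
  shows "closedin (skorohod_topology T S) {\<phi> \<in> cadlag T S. norm (\<phi> T) \<le> \<delta>}"
  unfolding closedin_skorohod_iff
proof (intro conjI ballI)
  fix \<phi> assume \<phi>: "\<phi> \<in> cadlag T S - {\<phi> \<in> cadlag T S. norm (\<phi> T) \<le> \<delta>}"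
  show "\<exists>r>0. \<forall>\<psi>\<in>cadlag T S. skorohod_dist T \<phi> \<psi> < r \<longrightarrow> \<psi> \<notin> {\<phi> \<in> cadlag T S. norm (\<phi> T) \<le> \<delta>}"
  proof (intro exI[of _ "norm (\<phi> T) - \<delta>"] conjI ballI impI)
    fix \<psi> assume \<psi>: "\<psi> \<in> cadlag T S" "skorohod_dist T \<phi> \<psi> < norm (\<phi> T) - \<delta>"
    have "dist (\<phi> T) (\<psi> T) < norm (\<phi> T) - \<delta>"
      using skorohod_dist_end[of \<phi> T S \<psi>] \<phi> \<psi> assms by auto
    then show "\<psi> \<notin> {\<phi> \<in> cadlag T S. norm (\<phi> T) \<le> \<delta>}"
      using norm_triangle_ineq2[of "\<phi> T" "\<psi> T"] by (simp add: dist_norm norm_minus_commute)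
  qed (use \<phi> in auto)
qed auto

text \<open>Uniform neighbourhoods of continuous paths are used instead of Skorohod balls because they
  are determined by the path at countably many times, hence measurable events.\<close>

definition uniform_tube :: "real \<Rightarrow> 'a::metric_space set \<Rightarrow> (real \<Rightarrow> 'a) \<Rightarrow> real \<Rightarrow> (real \<Rightarrow> 'a) set" where
  "uniform_tube T S \<phi> \<rho> = {\<psi> \<in> cadlag T S. \<forall>t\<in>{0..T}. dist (\<psi> t) (\<phi> t) \<le> \<rho>}"

lemma cont_paths_subset_cadlag: "cont_paths T S \<subseteq> cadlag T S"
proof
  fix \<phi> assume "\<phi> \<in> cont_paths T S"
  then have \<phi>: "\<phi> \<in> {0..T} \<rightarrow>\<^sub>E S" "continuous_on {0..T} \<phi>" by (auto simp: cont_paths_def)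
  have "(\<phi> \<longlongrightarrow> \<phi> t) (at_right t)" if "t \<in> {0..<T}" for t
  proof -
    have "continuous_on {t..T} \<phi>" by (rule continuous_on_subset[OF \<phi>(2)]) (use that in auto)
    then show ?thesis using that by (intro continuous_on_Icc_at_rightD) auto
  qed
  moreover have "\<exists>l\<in>S. (\<phi> \<longlongrightarrow> l) (at_left t)" if "t \<in> {0<..T}" for t
  proof
    show "\<phi> t \<in> S" using \<phi>(1) that by auto
    have "continuous_on {0..t} \<phi>" by (rule continuous_on_subset[OF \<phi>(2)]) (use that in auto)
    then show "(\<phi> \<longlongrightarrow> \<phi> t) (at_left t)" using that by (intro continuous_on_Icc_at_leftD) auto
  qed
  ultimately show "\<phi> \<in> cadlag T S" using \<phi>(1) unfolding cadlag_def by auto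
qed

text \<open>Skorohod closeness controls a path only at the displaced time \<open>h t\<close>;
  continuity of the centre \<open>\<phi>\<close> pays for comparing \<open>\<phi> (h t)\<close> with
  \<open>\<phi> t\<close>.\<close>

lemma closedin_uniform_tube:
  assumes "\<phi> \<in> cont_paths T S"
  shows "closedin (skorohod_topology T S) (uniform_tube T S \<phi> \<rho>)"
  unfolding closedin_skorohod_iff
proof (intro conjI ballI)
  show "uniform_tube T S \<phi> \<rho> \<subseteq> cadlag T S" by (auto simp: uniform_tube_def)
  fix \<psi> assume "\<psi> \<in> cadlag T S - uniform_tube T S \<phi> \<rho>"
  then obtain t where \<psi>: "\<psi> \<in> cadlag T S" and t: "t \<in> {0..T}" "dist (\<psi> t) (\<phi> t) > \<rho>"
    by (auto simp: uniform_tube_def not_le)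
  \<comment> \<open>Half of the excess over \<open>\<rho>\<close>: one half is spent on the Skorohod
    distance, the other on the modulus of continuity of \<open>\<phi>\<close>.\<close>
  define e where "e = (dist (\<psi> t) (\<phi> t) - \<rho>) / 2"
  have e: "e > 0" using t by (simp add: e_def)
  have cont: "continuous_on {0..T} \<phi>" using assms by (simp add: cont_paths_def)
  obtain d where d: "d > 0" "\<And>s. s \<in> {0..T} \<Longrightarrow> dist s t < d \<Longrightarrow> dist (\<phi> s) (\<phi> t) < e"
    using cont[unfolded continuous_on_iff, rule_format, OF t(1) e] by blast
  show "\<exists>r>0. \<forall>\<eta>\<in>cadlag T S. skorohod_dist T \<psi> \<eta> < r \<longrightarrow> \<eta> \<notin> uniform_tube T S \<phi> \<rho>"
  proof (intro exI[of _ "min d e"] conjI ballI impI notI)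
    fix \<eta> assume \<eta>: "\<eta> \<in> cadlag T S" "skorohod_dist T \<psi> \<eta> < min d e" "\<eta> \<in> uniform_tube T S \<phi> \<rho>"
    obtain h where h0: "h \<in> time_changes T" "\<And>t. t \<in> {0..T} \<Longrightarrow> \<bar>h t - t\<bar> < min d e"
        "\<And>t. t \<in> {0..T} \<Longrightarrow> dist (\<psi> t) (\<eta> (h t)) < min d e"
      by (rule skorohod_dist_lessD[OF \<psi> \<eta>(1,2)]) blast
    note h = h0(1) h0(2)[OF t(1)] h0(3)[OF t(1)]
    have ht: "h t \<in> {0..T}" using time_change_in[OF h(1) t(1)] .
    have "dist (\<phi> (h t)) (\<phi> t) < e" using d(2)[OF ht] h(2) by (simp add: dist_real_def)
    moreover have "dist (\<eta> (h t)) (\<phi> (h t)) \<le> \<rho>" using \<eta>(3) ht by (auto simp: uniform_tube_def)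
    moreover have "dist (\<psi> t) (\<phi> t) \<le> dist (\<psi> t) (\<eta> (h t)) + dist (\<eta> (h t)) (\<phi> (h t)) + dist (\<phi> (h t)) (\<phi> t)"
      using dist_triangle[of "\<psi> t" "\<phi> t" "\<eta> (h t)"] dist_triangle[of "\<eta> (h t)" "\<phi> t" "\<phi> (h t)"] by linarith
    ultimately show False using h(3) by (simp add: e_def field_simps)
  qed (use d e in auto)
qed

text \<open>Around a continuous path Skorohod and uniform neighbourhoods are equivalent. The tube,
  which is closed and gives an event, thus contains an open set to which the lower bound
  applies.\<close>

lemma skorohod_ball_subset_uniform_tube:
  assumes "\<phi> \<in> cont_paths T S" "\<rho> > 0"
  obtains r where "r > 0" "{\<psi> \<in> cadlag T S. skorohod_dist T \<phi> \<psi> < r} \<subseteq> uniform_tube T S \<phi> \<rho>"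
proof -
  have uc: "uniformly_continuous_on {0..T} \<phi>"
    using assms by (intro compact_uniformly_continuous) (auto simp: cont_paths_def)
  obtain d where d: "d > 0"
    "\<And>s t. s \<in> {0..T} \<Longrightarrow> t \<in> {0..T} \<Longrightarrow> dist s t < d \<Longrightarrow> dist (\<phi> s) (\<phi> t) < \<rho> / 2"
    using uc[unfolded uniformly_continuous_on_def, rule_format, OF half_gt_zero[OF assms(2)]]
    by (metis dist_commute)
  have "\<psi> \<in> uniform_tube T S \<phi> \<rho>" if \<psi>: "\<psi> \<in> cadlag T S" "skorohod_dist T \<phi> \<psi> < min d (\<rho> / 2)" for \<psi>
  proof -
    obtain h where h: "h \<in> time_changes T" "\<And>t. t \<in> {0..T} \<Longrightarrow> \<bar>h t - t\<bar> < min d (\<rho> / 2)"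
        "\<And>t. t \<in> {0..T} \<Longrightarrow> dist (\<phi> t) (\<psi> (h t)) < min d (\<rho> / 2)"
      by (rule skorohod_dist_lessD[OF subsetD[OF cont_paths_subset_cadlag assms(1)] \<psi>]) blast
    have "dist (\<psi> t) (\<phi> t) \<le> \<rho>" if "t \<in> {0..T}" for t
    proof -
      have "t \<in> h ` {0..T}" using h(1) that by (simp add: time_changes_def)
      then obtain s where s: "s \<in> {0..T}" "t = h s" by auto
      have "dist (\<phi> s) (\<phi> t) < \<rho> / 2" using d(2)[OF s(1) that] h(2)[OF s(1)] s(2)
        by (simp add: dist_real_def abs_minus_commute)
      moreover have "dist (\<phi> s) (\<psi> t) < \<rho> / 2" using h(3)[OF s(1)] s(2) by simp
      ultimately show ?thesis using dist_triangle2[of "\<psi> t" "\<phi> t" "\<phi> s"] by (simp add: dist_commute)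
    qed
    then show ?thesis using \<psi>(1) by (simp add: uniform_tube_def)
  qed
  then show thesis using that[of "min d (\<rho> / 2)"] d assms(2) by auto
qed

section \<open>Exponential estimates drawn from the large deviation principle\<close>

lemma elog_quotient_greaterD:
  assumes "ereal (- c) < elog p / ereal a" "0 < a"
  shows "exp (- c * a) < p"
proof -
  have p: "p > 0" using assms by (cases "p > 0") (auto simp: elog_def)
  then have "- c < ln p / a" using assms by (simp add: elog_def)
  then have "- c * a < ln p" using assms(2) by (simp add: pos_less_divide_eq)
  then show ?thesis using p by (metis exp_less_mono exp_ln)
qed

lemma elog_quotient_lessD:
  assumes "elog p / ereal a < ereal (- c)" "0 < a"
  shows "p \<le> exp (- c * a)"
proof (cases "p > 0")
  case True
  then have "ln p / a < - c" using assms by (simp add: elog_def)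
  then have "ln p < - c * a" using assms(2) by (simp add: pos_divide_less_eq)
  then show ?thesis using True by (metis exp_less_mono exp_ln less_imp_le)
next
  case False
  then show ?thesis by (meson exp_ge_zero not_less order_trans)
qed

text \<open>A single path of the open set bounds the infimum. The strict margin
  \<open>J \<phi> < c\<close> then survives at some fixed \<open>\<epsilon>\<close>, so that the two
  limits become one explicit inequality for all large \<open>a\<close>.\<close>

lemma LDP_lower:
  assumes LDP: "sample_path_LDP M P X E T J"
    and x: "\<phi> 0 \<in> limit_cone E" and U: "openin (skorohod_topology T (limit_cone E)) U"
    and \<phi>: "\<phi> \<in> U" "J \<phi> < ereal c"
  shows "\<exists>\<epsilon>>0. \<forall>\<^sub>F a in at_top. \<forall>z\<in>starts_near E a (\<phi> 0) \<epsilon>.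
    exp (- c * a) < measure (P (a *\<^sub>R z)) {\<omega> \<in> space M. rescaled_path X a T \<omega> \<in> U}"
proof -
  obtain l where l: "((\<lambda>\<epsilon>. Liminf at_top (\<lambda>a. INF z\<in>starts_near E a (\<phi> 0) \<epsilon>. log_prob_rescaled M P X T U a z))
                \<longlongrightarrow> l) (at_right 0)" "l \<ge> - (INF \<psi>\<in>{\<psi> \<in> U. \<psi> 0 = \<phi> 0}. J \<psi>)"
    using LDP x U unfolding sample_path_LDP_def by meson
  have "(INF \<psi>\<in>{\<psi> \<in> U. \<psi> 0 = \<phi> 0}. J \<psi>) \<le> J \<phi>" using \<phi> by (intro INF_lower) simp
  then have "(INF \<psi>\<in>{\<psi> \<in> U. \<psi> 0 = \<phi> 0}. J \<psi>) < ereal c" using \<phi>(2) by (rule le_less_trans)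
  then have "ereal (- c) < - (INF \<psi>\<in>{\<psi> \<in> U. \<psi> 0 = \<phi> 0}. J \<psi>)"
    by (simp only: uminus_ereal.simps(1)[symmetric] ereal_minus_less_minus)
  then have "ereal (- c) < l" using l(2) by (rule less_le_trans)
  then have "\<forall>\<^sub>F \<epsilon> in at_right 0. ereal (- c) <
      Liminf at_top (\<lambda>a. INF z\<in>starts_near E a (\<phi> 0) \<epsilon>. log_prob_rescaled M P X T U a z)"
    by (rule order_tendstoD(1)[OF l(1)])
  then have "\<forall>\<^sub>F \<epsilon> in at_right 0. 0 < \<epsilon> \<and> ereal (- c) <
      Liminf at_top (\<lambda>a. INF z\<in>starts_near E a (\<phi> 0) \<epsilon>. log_prob_rescaled M P X T U a z)"
    using eventually_at_right_less by eventually_elim simp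
  then obtain \<epsilon> :: real where \<epsilon>: "0 < \<epsilon>" "ereal (- c) <
      Liminf at_top (\<lambda>a. INF z\<in>starts_near E a (\<phi> 0) \<epsilon>. log_prob_rescaled M P X T U a z)"
    using eventually_happens'[OF trivial_limit_at_right_real] by blast
  have "\<forall>\<^sub>F a in at_top. \<forall>z\<in>starts_near E a (\<phi> 0) \<epsilon>.
    exp (- c * a) < measure (P (a *\<^sub>R z)) {\<omega> \<in> space M. rescaled_path X a T \<omega> \<in> U}"
    using less_LiminfD[OF \<epsilon>(2)] eventually_gt_at_top[of 0]
  proof eventually_elim
    case (elim a)
    show ?case
    proof
      fix z assume "z \<in> starts_near E a (\<phi> 0) \<epsilon>"
      then have "ereal (- c) < log_prob_rescaled M P X T U a z" using elim(1) by (meson less_INF_D)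
      then show "exp (- c * a) < measure (P (a *\<^sub>R z)) {\<omega> \<in> space M. rescaled_path X a T \<omega> \<in> U}"
        unfolding log_prob_rescaled_def using elim(2) by (rule elog_quotient_greaterD)
    qed
  qed
  then show ?thesis using \<epsilon>(1) by blast
qed

text \<open>The gap between \<open>b\<close> and \<open>c\<close> plays the part of the strict
  margin in the lower bound. The condition on \<open>J\<close> concerns only paths of
  \<open>C\<close> that start at \<open>x\<close>; it holds vacuously if there are none.\<close>

lemma LDP_upper:
  assumes LDP: "sample_path_LDP M P X E T J"
    and x: "x \<in> limit_cone E" and C: "closedin (skorohod_topology T (limit_cone E)) C"
    and J: "\<And>\<phi>. \<phi> \<in> C \<Longrightarrow> \<phi> 0 = x \<Longrightarrow> ereal c \<le> J \<phi>" and b: "b < c"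
  shows "\<exists>\<epsilon>>0. \<forall>\<^sub>F a in at_top. \<forall>z\<in>starts_near E a x \<epsilon>.
    measure (P (a *\<^sub>R z)) {\<omega> \<in> space M. rescaled_path X a T \<omega> \<in> C} \<le> exp (- b * a)"
proof -
  obtain l where l: "((\<lambda>\<epsilon>. Limsup at_top (\<lambda>a. SUP z\<in>starts_near E a x \<epsilon>. log_prob_rescaled M P X T C a z))
                \<longlongrightarrow> l) (at_right 0)" "l \<le> - (INF \<psi>\<in>{\<psi> \<in> C. \<psi> 0 = x}. J \<psi>)"
    using LDP x C unfolding sample_path_LDP_def by meson
  have "ereal c \<le> (INF \<psi>\<in>{\<psi> \<in> C. \<psi> 0 = x}. J \<psi>)" using J by (intro INF_greatest) simp
  then have "- (INF \<psi>\<in>{\<psi> \<in> C. \<psi> 0 = x}. J \<psi>) \<le> ereal (- c)"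
    by (simp only: uminus_ereal.simps(1)[symmetric] ereal_minus_le_minus)
  also have "ereal (- c) < ereal (- b)" using b by simp
  finally have "l < ereal (- b)" using l(2) by (rule le_less_trans[rotated])
  then have "\<forall>\<^sub>F \<epsilon> in at_right 0.
      Limsup at_top (\<lambda>a. SUP z\<in>starts_near E a x \<epsilon>. log_prob_rescaled M P X T C a z) < ereal (- b)"
    by (rule order_tendstoD(2)[OF l(1)])
  then have "\<forall>\<^sub>F \<epsilon> in at_right 0. 0 < \<epsilon> \<and>
      Limsup at_top (\<lambda>a. SUP z\<in>starts_near E a x \<epsilon>. log_prob_rescaled M P X T C a z) < ereal (- b)"
    using eventually_at_right_less by eventually_elim simp
  then obtain \<epsilon> :: real where \<epsilon>: "0 < \<epsilon>" 
      "Limsup at_top (\<lambda>a. SUP z\<in>starts_near E a x \<epsilon>. log_prob_rescaled M P X T C a z) < ereal (- b)"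
    using eventually_happens'[OF trivial_limit_at_right_real] by blast
  have "\<forall>\<^sub>F a in at_top. \<forall>z\<in>starts_near E a x \<epsilon>.
    measure (P (a *\<^sub>R z)) {\<omega> \<in> space M. rescaled_path X a T \<omega> \<in> C} \<le> exp (- b * a)"
    using Limsup_lessD[OF \<epsilon>(2)] eventually_gt_at_top[of 0]
  proof eventually_elim
    case (elim a)
    show ?case
    proof
      fix z assume "z \<in> starts_near E a x \<epsilon>"
      then have "log_prob_rescaled M P X T C a z < ereal (- b)" using elim(1) by (meson SUP_lessD)
      then show "measure (P (a *\<^sub>R z)) {\<omega> \<in> space M. rescaled_path X a T \<omega> \<in> C} \<le> exp (- b * a)"
        unfolding log_prob_rescaled_def using elim(2) by (rule elog_quotient_lessD)
    qed
  qed
  then show ?thesis using \<epsilon>(1) by blast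
qed

text \<open>Compact level sets are closed because the Skorohod topology is Hausdorff. Goodness is
  assumed only for initial points in a compact set and for positive levels, hence \<open>V\<close>
  and \<open>0 < c\<close>. Approximation is uniform, which implies Skorohod approximation through
  the identity time change.\<close>

lemma LDP_lower_semicontinuous:
  assumes LDP: "sample_path_LDP M P X E T J"
    and \<phi>: "\<phi> \<in> cadlag T (limit_cone E)" and c: "0 < c" and V: "compact V" "V \<subseteq> limit_cone E"
    and approx: "\<And>r. r > 0 \<Longrightarrow> \<exists>\<psi>\<in>cadlag T (limit_cone E). \<psi> 0 \<in> V \<and> J \<psi> \<le> ereal c \<and>
      (\<forall>t\<in>{0..T}. dist (\<psi> t) (\<phi> t) \<le> r)"
  shows "J \<phi> \<le> ereal c"
proof -
  let ?C = "{\<psi> \<in> cadlag T (limit_cone E). \<psi> 0 \<in> V \<and> J \<psi> \<le> ereal c}"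
  have "compactin (skorohod_topology T (limit_cone E)) ?C"
    using LDP c V unfolding sample_path_LDP_def by meson
  then have cl: "closedin (skorohod_topology T (limit_cone E)) ?C" by (rule compactin_skorohod_closedin)
  have "\<phi> \<in> ?C"
  proof (rule ccontr)
    assume "\<phi> \<notin> ?C"
    then obtain r where r: "r > 0"
      "\<And>\<psi>. \<psi> \<in> cadlag T (limit_cone E) \<Longrightarrow> skorohod_dist T \<phi> \<psi> < r \<Longrightarrow> \<psi> \<notin> ?C"
      using cl \<phi> unfolding closedin_skorohod_iff by blast
    obtain \<psi> where \<psi>: "\<psi> \<in> ?C" "\<forall>t\<in>{0..T}. dist (\<psi> t) (\<phi> t) \<le> r / 2"
      using approx[of "r / 2"] r(1) by auto
    have "skorohod_dist T \<phi> \<psi> \<le> r / 2"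
      using \<psi>(2) r(1) by (intro skorohod_dist_le_uniform) (auto simp: dist_commute)
    then show False using r(2)[of \<psi>] \<psi>(1) r(1) by auto
  qed
  then show ?thesis by simp
qed

section \<open>Events of the rescaled process\<close>

locale sample_path_LDP_process = strong_markov_process M F E P X
  for M :: "'w measure" and F :: "ennreal \<Rightarrow> 'w measure" and E :: "'a::euclidean_space set"
    and P :: "'a \<Rightarrow> 'w measure" and X :: "real \<Rightarrow> 'w \<Rightarrow> 'a" +
  fixes I :: "real \<Rightarrow> (real \<Rightarrow> 'a) \<Rightarrow> ereal"
  assumes closed_E: "closed E" and unbounded_E: "\<not> bounded E"
    and assumption_A: "assumption_A M P X E I"
begin

abbreviation S :: "'a set" where "S \<equiv> limit_cone E"

lemma E_nonempty: "E \<noteq> {}"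
  using unbounded_E by auto

lemma E_subset_S: "E \<subseteq> S"
  using assumption_A by (simp add: assumption_A_def)

lemma LDP: "0 < T \<Longrightarrow> sample_path_LDP M P X E T (I T)"
  using assumption_A by (simp add: assumption_A_def)

lemma zero_in_S: "0 \<in> S"
  by (rule zero_in_limit_cone[OF E_nonempty])

lemma X_measurable: "0 \<le> t \<Longrightarrow> X t \<in> M \<rightarrow>\<^sub>M borel"
proof (rule measurableI)
  fix A :: "'a set" assume "0 \<le> t" "A \<in> sets borel"
  then have "X t -` A \<inter> space (F (ennreal t)) \<in> sets (F (ennreal t))"
    by (intro measurable_sets[OF adapted])
  then show "X t -` A \<inter> space M \<in> sets M" using F_sub by (auto simp: space_F)
qed auto

text \<open>The values lie in the cone because \<open>E \<subseteq> S\<close> and \<open>S\<close>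
  is invariant under positive scaling; closedness of \<open>S\<close> then keeps the left limits
  there, as membership in \<open>cadlag\<close> demands.\<close>

lemma rescaled_path_cadlag:
  assumes \<omega>: "\<omega> \<in> space M" and a: "0 < a"
  shows "rescaled_path X a T \<omega> \<in> cadlag T S"
proof -
  have inS: "X (a * t) \<omega> /\<^sub>R a \<in> S" if "0 \<le> t" for t
    using in_E[OF \<omega>, of "a * t"] that a E_subset_S by (intro scaleR_in_limit_cone) auto
  have "(rescaled_path X a T \<omega> \<longlongrightarrow> rescaled_path X a T \<omega> t) (at_right t)" if t: "t \<in> {0..<T}" for t
  proof -
    have "((\<lambda>s. X s \<omega>) \<longlongrightarrow> X (a * t) \<omega>) (at_right (a * t))"
      using right_continuous[OF \<omega>, of "a * t"] t a by simp
    then have "((\<lambda>s. X (a * s) \<omega>) \<longlongrightarrow> X (a * t) \<omega>) (at_right t)"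
      by (rule filterlim_compose) (rule filterlim_times_pos[OF filterlim_ident a refl])
    then have "((\<lambda>s. X (a * s) \<omega> /\<^sub>R a) \<longlongrightarrow> X (a * t) \<omega> /\<^sub>R a) (at_right t)"
      by (intro tendsto_intros)
    moreover have "\<forall>\<^sub>F s in at_right t. X (a * s) \<omega> /\<^sub>R a = rescaled_path X a T \<omega> s"
      unfolding eventually_at_right_field using t
      by (intro exI[of _ T]) (auto simp: rescaled_path_def)
    ultimately have "(rescaled_path X a T \<omega> \<longlongrightarrow> X (a * t) \<omega> /\<^sub>R a) (at_right t)"
      by (rule Lim_transform_eventually)
    then show ?thesis using t by (simp add: rescaled_path_def)
  qed
  moreover have "\<exists>l\<in>S. (rescaled_path X a T \<omega> \<longlongrightarrow> l) (at_left t)" if t: "t \<in> {0<..T}" for t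
  proof -
    obtain l where l: "((\<lambda>s. X s \<omega>) \<longlongrightarrow> l) (at_left (a * t))"
      using left_limits[OF \<omega>, of "a * t"] t a by auto
    have "((\<lambda>s. a * s) \<longlongrightarrow> a * t) (at_left t)" by (intro tendsto_intros)
    then have "filterlim (\<lambda>s. a * s) (at_left (a * t)) (at_left t)"
      unfolding filterlim_at using a
      by (auto simp: eventually_at_left_field intro!: exI[of _ "t - 1"])
    then have "((\<lambda>s. X (a * s) \<omega>) \<longlongrightarrow> l) (at_left t)" by (rule filterlim_compose[OF l])
    then have "((\<lambda>s. X (a * s) \<omega> /\<^sub>R a) \<longlongrightarrow> l /\<^sub>R a) (at_left t)"
      by (intro tendsto_intros)
    moreover have ev: "\<forall>\<^sub>F s in at_left t. X (a * s) \<omega> /\<^sub>R a = rescaled_path X a T \<omega> s \<and>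
        X (a * s) \<omega> /\<^sub>R a \<in> S"
      unfolding eventually_at_left_field using t inS
      by (intro exI[of _ 0]) (auto simp: rescaled_path_def)
    ultimately have "(rescaled_path X a T \<omega> \<longlongrightarrow> l /\<^sub>R a) (at_left t)"
      by (elim Lim_transform_eventually) (auto elim: eventually_mono)
    moreover have "l /\<^sub>R a \<in> S"
      by (rule Lim_in_closed_set[OF closed_limit_cone[OF closed_E] eventually_mono[OF ev] _ \<open>((\<lambda>s. X (a * s) \<omega> /\<^sub>R a) \<longlongrightarrow> l /\<^sub>R a) (at_left t)\<close>])
         auto
    ultimately show ?thesis by blast
  qed
  ultimately show ?thesis using inS unfolding cadlag_def by (auto simp: rescaled_path_def)
qed

lemma uniform_tube_event:
  assumes \<phi>: "\<phi> \<in> cont_paths T S" and a: "0 < a" and T: "0 < T"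
  shows "{\<omega> \<in> space M. rescaled_path X a T \<omega> \<in> uniform_tube T S \<phi> \<rho>} \<in> sets M"
proof -
  \<comment> \<open>Rational times suffice by right continuity, except for \<open>T\<close>: no
    times of the interval lie to its right, so it is added by hand.\<close>
  define D where "D = insert T ({0..T} \<inter> \<rat>)"
  have D: "countable D" "D \<subseteq> {0..T}" using T countable_rat by (auto simp: D_def)
  have "(\<forall>t\<in>{0..T}. dist (rescaled_path X a T \<omega> t) (\<phi> t) \<le> \<rho>) \<longleftrightarrow>
      (\<forall>t\<in>D. dist (X (a * t) \<omega> /\<^sub>R a) (\<phi> t) \<le> \<rho>)" if \<omega>: "\<omega> \<in> space M" for \<omega>
  proof
    assume "\<forall>t\<in>{0..T}. dist (rescaled_path X a T \<omega> t) (\<phi> t) \<le> \<rho>"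
    then show "\<forall>t\<in>D. dist (X (a * t) \<omega> /\<^sub>R a) (\<phi> t) \<le> \<rho>"
      using D(2) by (force simp: rescaled_path_def)
  next
    assume *: "\<forall>t\<in>D. dist (X (a * t) \<omega> /\<^sub>R a) (\<phi> t) \<le> \<rho>"
    let ?Z = "rescaled_path X a T \<omega>"
    have DZ: "dist (?Z t) (\<phi> t) \<le> \<rho>" if "t \<in> D" for t
      using * that D(2) by (auto simp: rescaled_path_def)
    have "dist (?Z t) (\<phi> t) \<le> \<rho>" if t: "t \<in> {0..<T}" for t
    proof (rule ccontr)
      assume "\<not> dist (?Z t) (\<phi> t) \<le> \<rho>"
      then have gt: "\<rho> < dist (?Z t) (\<phi> t)" by simp
      have "((\<lambda>s. dist (?Z s) (\<phi> s)) \<longlongrightarrow> dist (?Z t) (\<phi> t)) (at_right t)"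
        using rescaled_path_cadlag[OF \<omega> a, of T] subsetD[OF cont_paths_subset_cadlag \<phi>] t
        by (intro tendsto_intros) (auto simp: cadlag_def)
      then have "\<forall>\<^sub>F s in at_right t. \<rho> < dist (?Z s) (\<phi> s)" using gt by (rule order_tendstoD(1))
      then obtain b where b: "b > t" "\<And>s. t < s \<Longrightarrow> s < b \<Longrightarrow> \<rho> < dist (?Z s) (\<phi> s)"
        unfolding eventually_at_right_field by blast
      obtain s where s: "s \<in> \<rat>" "t < s" "s < min b T"
        using Rats_dense_in_real[of t "min b T"] b(1) t by auto
      then have "s \<in> D" using t by (auto simp: D_def)
      then show False using DZ[of s] b(2)[of s] s by auto
    qed
    moreover have "dist (?Z T) (\<phi> T) \<le> \<rho>" by (rule DZ) (simp add: D_def)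
    ultimately show "\<forall>t\<in>{0..T}. dist (?Z t) (\<phi> t) \<le> \<rho>" by (metis atLeastAtMost_iff atLeastLessThan_iff order_le_less)
  qed
  then have "{\<omega> \<in> space M. rescaled_path X a T \<omega> \<in> uniform_tube T S \<phi> \<rho>} =
      {\<omega> \<in> space M. \<forall>t\<in>D. dist (X (a * t) \<omega> /\<^sub>R a) (\<phi> t) \<le> \<rho>}"
    using rescaled_path_cadlag[OF _ a] by (auto simp: uniform_tube_def)
  also have "\<dots> = (\<Inter>t\<in>D. {\<omega> \<in> space M. dist (X (a * t) \<omega> /\<^sub>R a) (\<phi> t) \<le> \<rho>})"
    by (auto simp: D_def)
  also have "\<dots> \<in> sets M"
  proof (rule sets.countable_INT'[OF D(1)])
    show "(\<lambda>t. {\<omega> \<in> space M. dist (X (a * t) \<omega> /\<^sub>R a) (\<phi> t) \<le> \<rho>}) ` D \<subseteq> sets M"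
    proof (rule image_subsetI)
      fix t assume "t \<in> D"
      then have [measurable]: "X (a * t) \<in> M \<rightarrow>\<^sub>M borel" using D(2) a by (intro X_measurable) auto
      show "{\<omega> \<in> space M. dist (X (a * t) \<omega> /\<^sub>R a) (\<phi> t) \<le> \<rho>} \<in> sets M" by measurable
    qed
  qed (auto simp: D_def)
  finally show ?thesis .
qed

lemma end_event:
  assumes "0 < a"
  shows "{\<omega> \<in> space M. rescaled_path X a 1 \<omega> \<in> {\<phi> \<in> cadlag 1 S. norm (\<phi> 1) < \<delta>}} =
      {\<omega> \<in> space M. norm (X a \<omega>) < \<delta> * a}"
    "{\<omega> \<in> space M. rescaled_path X a 1 \<omega> \<in> {\<phi> \<in> cadlag 1 S. norm (\<phi> 1) \<le> \<delta>}} =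
      {\<omega> \<in> space M. norm (X a \<omega>) \<le> \<delta> * a}"
  using rescaled_path_cadlag[OF _ assms] assms
  by (auto simp: rescaled_path_def field_simps)

end

section \<open>Concatenation of paths\<close>

lemma abs_continuous_on_lipschitz:
  assumes lip: "\<And>s t. s \<in> {0..T} \<Longrightarrow> t \<in> {0..T} \<Longrightarrow> s \<le> t \<Longrightarrow> norm (\<phi> t - \<phi> s) \<le> K * (t - s)"
  shows "abs_continuous_on T \<phi>"
  unfolding abs_continuous_on_def
proof (intro allI impI)
  fix \<epsilon> :: real assume \<epsilon>: "\<epsilon> > 0"
  \<comment> \<open>Positive even for \<open>K = 0\<close>, the value used for the path at rest, so
    that dividing by it is legitimate.\<close>
  define K' where "K' = \<bar>K\<bar> + 1"
  have K': "K' > 0" "K \<le> K'" by (auto simp: K'_def)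
  show "\<exists>\<delta>>0. \<forall>(n::nat) a b.
        (\<forall>i<n. 0 \<le> a i \<and> a i \<le> b i \<and> b i \<le> T) \<and>
        disjoint_family_on (\<lambda>i. {a i<..<b i}) {..<n} \<and> (\<Sum>i<n. b i - a i) < \<delta> \<longrightarrow>
        (\<Sum>i<n. norm (\<phi> (b i) - \<phi> (a i))) < \<epsilon>"
  proof (intro exI[of _ "\<epsilon> / K'"] conjI allI impI)
    fix n :: nat and a b :: "nat \<Rightarrow> real"
    assume ab: "(\<forall>i<n. 0 \<le> a i \<and> a i \<le> b i \<and> b i \<le> T) \<and>
        disjoint_family_on (\<lambda>i. {a i<..<b i}) {..<n} \<and> (\<Sum>i<n. b i - a i) < \<epsilon> / K'"
    have "(\<Sum>i<n. norm (\<phi> (b i) - \<phi> (a i))) \<le> (\<Sum>i<n. K' * (b i - a i))"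
    proof (rule sum_mono)
      fix i assume "i \<in> {..<n}"
      then have i: "0 \<le> a i" "a i \<le> b i" "b i \<le> T" using ab by auto
      have "norm (\<phi> (b i) - \<phi> (a i)) \<le> K * (b i - a i)" using i by (intro lip) auto
      also have "\<dots> \<le> K' * (b i - a i)" using K' i by (intro mult_right_mono) auto
      finally show "norm (\<phi> (b i) - \<phi> (a i)) \<le> K' * (b i - a i)" .
    qed
    also have "\<dots> = K' * (\<Sum>i<n. b i - a i)" by (simp add: sum_distrib_left)
    also have "\<dots> < K' * (\<epsilon> / K')" using ab K' by (intro mult_strict_left_mono) auto
    also have "\<dots> = \<epsilon>" using K' by simp
    finally show "(\<Sum>i<n. norm (\<phi> (b i) - \<phi> (a i))) < \<epsilon>" .
  qed (use \<epsilon> K' in auto)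
qed

lemma abs_continuous_on_imp_continuous_on:
  assumes "abs_continuous_on T \<phi>"
  shows "continuous_on {0..T} \<phi>"
  unfolding continuous_on_iff
proof (intro ballI allI impI)
  fix t and e :: real assume t: "t \<in> {0..T}" and e: "0 < e"
  obtain d where d: "d > 0" and ac: "\<And>(n::nat) a b.
        (\<forall>i<n. 0 \<le> a i \<and> a i \<le> b i \<and> b i \<le> T) \<and>
        disjoint_family_on (\<lambda>i. {a i<..<b i}) {..<n} \<and> (\<Sum>i<n. b i - a i) < d \<longrightarrow>
        (\<Sum>i<n. norm (\<phi> (b i) - \<phi> (a i))) < e"
    using assms[unfolded abs_continuous_on_def, rule_format, OF e] by blast
  show "\<exists>d>0. \<forall>s\<in>{0..T}. dist s t < d \<longrightarrow> dist (\<phi> s) (\<phi> t) < e"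
  proof (intro exI[of _ d] conjI ballI impI)
    fix s assume s: "s \<in> {0..T}" "dist s t < d"
    have "norm (\<phi> (max s t) - \<phi> (min s t)) < e"
      using ac[of 1 "\<lambda>_. min s t" "\<lambda>_. max s t"] s t
      by (auto simp: dist_real_def disjoint_family_on_def lessThan_Suc)
    then show "dist (\<phi> s) (\<phi> t) < e"
      by (cases "s \<le> t") (auto simp: dist_norm norm_minus_commute max_def min_def)
  qed (rule d)
qed

definition concat_path :: "real \<Rightarrow> real \<Rightarrow> (real \<Rightarrow> 'a) \<Rightarrow> (real \<Rightarrow> 'a) \<Rightarrow> real \<Rightarrow> 'a" where
  "concat_path T1 T2 \<phi>1 \<phi>2 = (\<lambda>t\<in>{0..T1 + T2}. if t \<le> T1 then \<phi>1 t else \<phi>2 (t - T1))"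

lemma concat_path_left: "0 \<le> t \<Longrightarrow> t \<le> T1 \<Longrightarrow> 0 \<le> T2 \<Longrightarrow> concat_path T1 T2 \<phi>1 \<phi>2 t = \<phi>1 t"
  by (simp add: concat_path_def)

lemma concat_path_right:
  assumes "\<phi>1 T1 = \<phi>2 0" "0 \<le> T1" "T1 \<le> t" "t \<le> T1 + T2"
  shows "concat_path T1 T2 \<phi>1 \<phi>2 t = \<phi>2 (t - T1)"
  using assms by (cases "t = T1") (auto simp: concat_path_def)

lemma concat_path_cont_paths:
  assumes \<phi>1: "\<phi>1 \<in> cont_paths T1 S" and \<phi>2: "\<phi>2 \<in> cont_paths T2 S"
    and eq: "\<phi>1 T1 = \<phi>2 0" and T: "0 \<le> T1" "0 \<le> T2"
  shows "concat_path T1 T2 \<phi>1 \<phi>2 \<in> cont_paths (T1 + T2) S"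
proof -
  have "continuous_on {0..T1 + T2} (\<lambda>t. if t \<le> T1 then \<phi>1 t else \<phi>2 (t - T1))"
  proof (rule continuous_on_cases_le[where h = "\<lambda>t. t"])
    show "continuous_on {t \<in> {0..T1 + T2}. t \<le> T1} \<phi>1"
      using \<phi>1 by (auto simp: cont_paths_def elim: continuous_on_subset)
    have "continuous_on {0..T2} \<phi>2" using \<phi>2 by (simp add: cont_paths_def)
    then show "continuous_on {t \<in> {0..T1 + T2}. T1 \<le> t} (\<lambda>t. \<phi>2 (t - T1))"
      by (rule continuous_on_compose2) (auto intro!: continuous_intros)
  qed (use eq in \<open>auto intro!: continuous_intros\<close>)
  then have "continuous_on {0..T1 + T2} (concat_path T1 T2 \<phi>1 \<phi>2)"
    by (rule continuous_on_eq) (simp add: concat_path_def)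
  moreover have "concat_path T1 T2 \<phi>1 \<phi>2 \<in> {0..T1 + T2} \<rightarrow>\<^sub>E S"
    using \<phi>1 \<phi>2 by (auto simp: concat_path_def cont_paths_def PiE_def Pi_def)
  ultimately show ?thesis by (simp add: cont_paths_def)
qed

lemma abs_continuous_on_concat_path:
  assumes ac1: "abs_continuous_on T1 \<phi>1" and ac2: "abs_continuous_on T2 \<phi>2"
    and eq: "\<phi>1 T1 = \<phi>2 0" and T: "0 \<le> T1" "0 \<le> T2"
  shows "abs_continuous_on (T1 + T2) (concat_path T1 T2 \<phi>1 \<phi>2)"
  unfolding abs_continuous_on_def
proof (intro allI impI)
  fix \<epsilon> :: real assume "\<epsilon> > 0"
  then have \<epsilon>: "\<epsilon> / 2 > 0" by simp
  obtain d1 where d1: "d1 > 0" and ac1': "\<And>(n::nat) a b.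
        (\<forall>i<n. 0 \<le> a i \<and> a i \<le> b i \<and> b i \<le> T1) \<and>
        disjoint_family_on (\<lambda>i. {a i<..<b i}) {..<n} \<and> (\<Sum>i<n. b i - a i) < d1 \<longrightarrow>
        (\<Sum>i<n. norm (\<phi>1 (b i) - \<phi>1 (a i))) < \<epsilon> / 2"
    using ac1[unfolded abs_continuous_on_def, rule_format, OF \<epsilon>] by blast
  obtain d2 where d2: "d2 > 0" and ac2': "\<And>(n::nat) a b.
        (\<forall>i<n. 0 \<le> a i \<and> a i \<le> b i \<and> b i \<le> T2) \<and>
        disjoint_family_on (\<lambda>i. {a i<..<b i}) {..<n} \<and> (\<Sum>i<n. b i - a i) < d2 \<longrightarrow>
        (\<Sum>i<n. norm (\<phi>2 (b i) - \<phi>2 (a i))) < \<epsilon> / 2"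
    using ac2[unfolded abs_continuous_on_def, rule_format, OF \<epsilon>] by blast
  let ?\<phi> = "concat_path T1 T2 \<phi>1 \<phi>2"
  show "\<exists>\<delta>>0. \<forall>(n::nat) a b.
        (\<forall>i<n. 0 \<le> a i \<and> a i \<le> b i \<and> b i \<le> T1 + T2) \<and>
        disjoint_family_on (\<lambda>i. {a i<..<b i}) {..<n} \<and> (\<Sum>i<n. b i - a i) < \<delta> \<longrightarrow>
        (\<Sum>i<n. norm (?\<phi> (b i) - ?\<phi> (a i))) < \<epsilon>"
  proof (intro exI[of _ "min d1 d2"] conjI allI impI)
    fix n :: nat and a b :: "nat \<Rightarrow> real"
    assume ab: "(\<forall>i<n. 0 \<le> a i \<and> a i \<le> b i \<and> b i \<le> T1 + T2) \<and>
        disjoint_family_on (\<lambda>i. {a i<..<b i}) {..<n} \<and> (\<Sum>i<n. b i - a i) < min d1 d2"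
    \<comment> \<open>\<open>l\<close> and \<open>r\<close> clip a time to the first and second
      piece. An interval across the seam is thereby cut at \<open>T1\<close>, and the increment of
      the joined path is the sum of the two clipped increments, without cases on the position of the
      interval.\<close>
    define l where "l = (\<lambda>t::real. min t T1)"
    define r where "r = (\<lambda>t::real. max (t - T1) 0)"
    have split: "?\<phi> t - ?\<phi> s = (\<phi>1 (l t) - \<phi>1 (l s)) + (\<phi>2 (r t) - \<phi>2 (r s))"
      if "0 \<le> s" "s \<le> t" "t \<le> T1 + T2" for s t
      using that T eq by (auto simp: concat_path_def l_def r_def min_def max_def)
    have dj: "disjoint_family_on (\<lambda>i. {a i<..<b i}) {..<n}" using ab by simp
    have "disjoint_family_on (\<lambda>i. {l (a i)<..<l (b i)}) {..<n}"
    proof -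
      have "{l (a i)<..<l (b i)} \<subseteq> {a i<..<b i}" for i by (auto simp: l_def)
      then show ?thesis using dj unfolding disjoint_family_on_def by blast
    qed
    moreover have "(\<Sum>i<n. l (b i) - l (a i)) \<le> (\<Sum>i<n. b i - a i)"
      using ab by (intro sum_mono) (auto simp: l_def)
    ultimately have 1: "(\<Sum>i<n. norm (\<phi>1 (l (b i)) - \<phi>1 (l (a i)))) < \<epsilon> / 2"
      using ab T by (intro ac1'[rule_format]) (auto simp: l_def)
    have "disjoint_family_on (\<lambda>i. {r (a i)<..<r (b i)}) {..<n}"
    proof -
      have "x + T1 \<in> {a i<..<b i}" if "x \<in> {r (a i)<..<r (b i)}" for x i
        using that by (auto simp: r_def)
      then show ?thesis using dj unfolding disjoint_family_on_def by blast
    qed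
    moreover have "(\<Sum>i<n. r (b i) - r (a i)) \<le> (\<Sum>i<n. b i - a i)"
      using ab by (intro sum_mono) (auto simp: r_def)
    ultimately have 2: "(\<Sum>i<n. norm (\<phi>2 (r (b i)) - \<phi>2 (r (a i)))) < \<epsilon> / 2"
      using ab T by (intro ac2'[rule_format]) (auto simp: r_def)
    have "(\<Sum>i<n. norm (?\<phi> (b i) - ?\<phi> (a i))) \<le>
        (\<Sum>i<n. norm (\<phi>1 (l (b i)) - \<phi>1 (l (a i))) + norm (\<phi>2 (r (b i)) - \<phi>2 (r (a i))))"
    proof (rule sum_mono)
      fix i assume "i \<in> {..<n}"
      then show "norm (?\<phi> (b i) - ?\<phi> (a i)) \<le>
          norm (\<phi>1 (l (b i)) - \<phi>1 (l (a i))) + norm (\<phi>2 (r (b i)) - \<phi>2 (r (a i)))"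
        using ab by (subst split) (auto intro: norm_triangle_ineq)
    qed
    then show "(\<Sum>i<n. norm (?\<phi> (b i) - ?\<phi> (a i))) < \<epsilon>" using 1 2 by (simp add: sum.distrib)
  qed (use d1 d2 in auto)
qed

text \<open>An equivalence rather than an implication, so that \<open>vector_derivative\<close>,
  which is a choice, is translated correctly even where no derivative exists.\<close>

lemma has_vector_derivative_translate:
  "((\<lambda>t. f (t - c)) has_vector_derivative D) (at t) \<longleftrightarrow> (f has_vector_derivative D) (at (t - c))"
proof
  assume "((\<lambda>t. f (t - c)) has_vector_derivative D) (at t)"
  moreover have "((\<lambda>s. s + c) has_vector_derivative 1) (at (t - c))"
    by (auto intro!: derivative_eq_intros simp: has_real_derivative_iff_has_vector_derivative[symmetric])
  ultimately have "((\<lambda>t. f (t - c)) \<circ> (\<lambda>s. s + c) has_vector_derivative 1 *\<^sub>R D) (at (t - c))"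
    by (intro vector_diff_chain_at) simp_all
  then show "(f has_vector_derivative D) (at (t - c))" by (simp add: o_def)
next
  assume "(f has_vector_derivative D) (at (t - c))"
  moreover have "((\<lambda>s. s - c) has_vector_derivative 1) (at t)"
    by (auto intro!: derivative_eq_intros simp: has_real_derivative_iff_has_vector_derivative[symmetric])
  ultimately have "(f \<circ> (\<lambda>s. s - c) has_vector_derivative 1 *\<^sub>R D) (at t)"
    by (intro vector_diff_chain_at) simp_all
  then show "((\<lambda>t. f (t - c)) has_vector_derivative D) (at t)" by (simp add: o_def)
qed

lemma vector_derivative_translate:
  "vector_derivative (\<lambda>t. f (t - c)) (at t) = vector_derivative f (at (t - c))"
  unfolding vector_derivative_def has_vector_derivative_translate ..

lemma concat_path_vector_derivative:
  assumes T: "0 \<le> T1" "0 \<le> T2"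
  shows "0 < t \<Longrightarrow> t < T1 \<Longrightarrow>
      vector_derivative (concat_path T1 T2 \<phi>1 \<phi>2) (at t within {0..T1 + T2}) =
      vector_derivative \<phi>1 (at t within {0..T1})"
    and "T1 < t \<Longrightarrow> t < T1 + T2 \<Longrightarrow>
      vector_derivative (concat_path T1 T2 \<phi>1 \<phi>2) (at t within {0..T1 + T2}) =
      vector_derivative \<phi>2 (at (t - T1) within {0..T2})"
proof -
  assume t: "0 < t" "t < T1"
  have "\<forall>\<^sub>F s in nhds t. s \<in> UNIV \<longrightarrow> concat_path T1 T2 \<phi>1 \<phi>2 s = \<phi>1 s"
    using eventually_nhds_in_open[of "{0<..<T1}" t] t T
    by (auto elim!: eventually_mono simp: concat_path_def)
  then have "vector_derivative (concat_path T1 T2 \<phi>1 \<phi>2) (at t) = vector_derivative \<phi>1 (at t)"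
    by (rule vector_derivative_cong_eq) auto
  then show "vector_derivative (concat_path T1 T2 \<phi>1 \<phi>2) (at t within {0..T1 + T2}) =
      vector_derivative \<phi>1 (at t within {0..T1})"
    using t T by (simp add: at_within_Icc_at)
next
  assume t: "T1 < t" "t < T1 + T2"
  have "\<forall>\<^sub>F s in nhds t. s \<in> UNIV \<longrightarrow> concat_path T1 T2 \<phi>1 \<phi>2 s = \<phi>2 (s - T1)"
    using eventually_nhds_in_open[of "{T1<..<T1 + T2}" t] t T
    by (auto elim!: eventually_mono simp: concat_path_def)
  then have "vector_derivative (concat_path T1 T2 \<phi>1 \<phi>2) (at t) = vector_derivative (\<lambda>s. \<phi>2 (s - T1)) (at t)"
    by (rule vector_derivative_cong_eq) auto
  then show "vector_derivative (concat_path T1 T2 \<phi>1 \<phi>2) (at t within {0..T1 + T2}) =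
      vector_derivative \<phi>2 (at (t - T1) within {0..T2})"
    using t T by (simp add: at_within_Icc_at vector_derivative_translate)
qed

lemma action_functional_concat_path:
  assumes m1: "set_borel_measurable lebesgue {0..T1}
      (\<lambda>t. L (\<phi>1 t) (vector_derivative \<phi>1 (at t within {0..T1})))"
    and m2: "set_borel_measurable lebesgue {0..T2}
      (\<lambda>t. L (\<phi>2 t) (vector_derivative \<phi>2 (at t within {0..T2})))"
    and T: "0 \<le> T1" "0 \<le> T2"
  shows "action_functional L (T1 + T2) (concat_path T1 T2 \<phi>1 \<phi>2) =
      action_functional L T1 \<phi>1 + action_functional L T2 \<phi>2"
proof -
  let ?\<phi> = "concat_path T1 T2 \<phi>1 \<phi>2"
  define g where "g = (\<lambda>T (\<phi> :: real \<Rightarrow> 'a) t.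
    ennreal (L (\<phi> t) (vector_derivative \<phi> (at t within {0..T}))) * indicator {0..T} t)"
  have meas: "g T \<phi> \<in> borel_measurable lebesgue"
    if "set_borel_measurable lebesgue {0..T} (\<lambda>t. L (\<phi> t) (vector_derivative \<phi> (at t within {0..T})))" for T \<phi>
  proof -
    have "g T \<phi> = (\<lambda>t. ennreal (indicator {0..T} t *\<^sub>R L (\<phi> t) (vector_derivative \<phi> (at t within {0..T}))))"
      by (auto simp: g_def indicator_def)
    then show ?thesis using that unfolding set_borel_measurable_def by simp
  qed
  have g1: "g T1 \<phi>1 \<in> borel_measurable lebesgue" and g2: "g T2 \<phi>2 \<in> borel_measurable lebesgue"
    using meas m1 m2 by blast+
  \<comment> \<open>The integrands are only Lebesgue measurable, so the translation has to be
    measurable for the completed sigma-algebra on both sides.\<close>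
  have shift: "(\<lambda>t::real. t - T1) \<in> lebesgue \<rightarrow>\<^sub>M lebesgue"
    using lebesgue_affine_measurable[of "\<lambda>_::real. 1" "- T1"] by simp
  \<comment> \<open>At the two ends and at the seam the derivatives within the different intervals
    may disagree; three points do not affect the integral.\<close>
  have N: "{0, T1, T1 + T2} \<in> null_sets lebesgue"
    by (intro null_sets_completionI finite_imp_null_set_lborel) simp
  have "AE t in lebesgue. g (T1 + T2) ?\<phi> t = g T1 \<phi>1 t + g T2 \<phi>2 (t - T1)"
    using AE_not_in[OF N]
  proof eventually_elim
    case (elim t)
    then consider "t < 0" | "0 < t" "t < T1" | "T1 < t" "t < T1 + T2" | "T1 + T2 < t" by force
    then show ?case
    proof cases
      case 2
      then show ?thesis
        using T by (simp add: g_def concat_path_vector_derivative concat_path_left)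
    next
      case 3
      then have "?\<phi> t = \<phi>2 (t - T1)" using T by (simp add: concat_path_def)
      then show ?thesis
        using T 3 by (simp add: g_def concat_path_vector_derivative)
    qed (use T in \<open>auto simp: g_def indicator_def\<close>)
  qed
  then have "integral\<^sup>N lebesgue (g (T1 + T2) ?\<phi>) = (\<integral>\<^sup>+t. g T1 \<phi>1 t + g T2 \<phi>2 (t - T1) \<partial>lebesgue)"
    by (rule nn_integral_cong_AE)
  also have "\<dots> = integral\<^sup>N lebesgue (g T1 \<phi>1) + (\<integral>\<^sup>+t. g T2 \<phi>2 (t - T1) \<partial>lebesgue)"
    by (rule nn_integral_add[OF g1 measurable_compose[OF shift g2]])
  also have "(\<integral>\<^sup>+t. g T2 \<phi>2 (t - T1) \<partial>lebesgue) = integral\<^sup>N lebesgue (g T2 \<phi>2)"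
    using nn_integral_real_affine_lebesgue[OF g2, of 1 "- T1"] by (simp add: add.commute)
  finally show ?thesis unfolding action_functional_def g_def by (simp add: plus_ennreal.rep_eq)
qed

section \<open>Bounds on the action\<close>

lemma action_functional_le:
  assumes "\<And>t. t \<in> {0..T} \<Longrightarrow> L (\<phi> t) (vector_derivative \<phi> (at t within {0..T})) \<le> B" "0 \<le> B" "0 \<le> T"
  shows "action_functional L T \<phi> \<le> ereal (B * T)"
proof -
  have "(\<integral>\<^sup>+t\<in>{0..T}. ennreal (L (\<phi> t) (vector_derivative \<phi> (at t within {0..T}))) \<partial>lebesgue) \<le>
      (\<integral>\<^sup>+t. ennreal B * indicator {0..T} t \<partial>lebesgue)"
    by (intro nn_integral_mono) (auto simp: indicator_def intro!: ennreal_leI assms)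
  also have "\<dots> = ennreal (B * T)"
    using assms by (simp add: nn_integral_cmult_indicator ennreal_mult'')
  finally have "action_functional L T \<phi> \<le> enn2ereal (ennreal (B * T))"
    unfolding action_functional_def by (simp add: less_eq_ennreal.rep_eq)
  then show ?thesis using assms by (simp add: enn2ereal_ennreal)
qed

text \<open>Finiteness near 0 alone gives no bound. In finite dimension a finite convex function on
  an open ball is continuous, hence bounded on a smaller closed ball.\<close>

lemma ereal_convex_bounded_near_0:
  fixes f :: "'a::euclidean_space \<Rightarrow> ereal"
  assumes conv: "ereal_convex f" and nonneg: "\<And>v. 0 \<le> f v" and fin: "\<forall>\<^sub>F v in nhds 0. f v < \<infinity>"
  obtains c B where "0 < c" "0 < B" "\<And>v. norm v \<le> c \<Longrightarrow> f v \<le> ereal B"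
proof -
  obtain d where d: "d > 0" "\<And>v. dist v 0 < d \<Longrightarrow> f v < \<infinity>"
    using fin unfolding eventually_nhds_metric by blast
  define g where "g = (\<lambda>v. real_of_ereal (f v))"
  have fg: "f v = ereal (g v)" if "v \<in> ball 0 d" for v
    using d(2)[of v] nonneg[of v] that by (cases "f v") (auto simp: g_def)
  have "convex_on (ball 0 d) g"
  proof (rule convex_onI)
    fix t :: real and x y :: 'a assume t: "0 < t" "t < 1" and xy: "x \<in> ball 0 d" "y \<in> ball 0 d"
    have z: "(1 - t) *\<^sub>R x + t *\<^sub>R y \<in> ball 0 d"
      using xy t by (intro convexD_alt[OF convex_ball]) auto
    have "f ((1 - t) *\<^sub>R x + t *\<^sub>R y) \<le> ereal (1 - t) * f x + ereal t * f y"
      using conv t unfolding ereal_convex_def by blast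
    then show "g ((1 - t) *\<^sub>R x + t *\<^sub>R y) \<le> (1 - t) * g x + t * g y"
      using fg[OF z] fg[OF xy(1)] fg[OF xy(2)] by simp
  qed (rule convex_ball)
  then have "continuous_on (ball 0 d) g" by (intro convex_on_continuous) auto
  then have "continuous_on (cball 0 (d / 2)) g"
    by (rule continuous_on_subset) (use d in auto)
  then have "compact (g ` cball 0 (d / 2))" by (intro compact_continuous_image) auto
  then obtain B where B: "\<And>v. v \<in> cball 0 (d / 2) \<Longrightarrow> norm (g v) \<le> B"
    using compact_imp_bounded bounded_iff by (metis imageI)
  have "f v \<le> ereal (\<bar>B\<bar> + 1)" if "norm v \<le> d / 2" for v
    using B[of v] fg[of v] that d(1) by auto
  then show thesis using that[of "d / 2" "\<bar>B\<bar> + 1"] d(1) by auto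
qed

context sample_path_LDP_process
begin

text \<open>Distils the Lagrangian assumptions into the form used below: besides the integral
  formula, slow velocities have a cost rate bounded uniformly in the position.\<close>

lemma lagrangian_exists:
  "\<exists>L c B. lagrangian_for S I L \<and> 0 < c \<and> 0 < B \<and> (\<forall>x\<in>S. \<forall>v. norm v \<le> c \<longrightarrow> L x v \<le> B)"
proof -
  obtain L l1 l2 where L: "lagrangian_for S I L" and b: "lagrangian_bounds S L l1 l2"
    using assumption_A unfolding assumption_A_def by blast
  have le: "0 \<le> L x v" "ereal (L x v) \<le> l2 v" if "x \<in> S" for x v
    using b that unfolding lagrangian_bounds_def by (meson order_trans)+
  \<comment> \<open>The bounds hold only at positions in the cone, so some position is required; the
    origin serves.\<close>
  have "0 \<le> l2 v" for v
    using le[OF zero_in_S, of v] by (metis ereal_less_eq(5) order_trans)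
  then obtain c B where "0 < c" "0 < B" "\<And>v. norm v \<le> c \<Longrightarrow> l2 v \<le> ereal B"
    using ereal_convex_bounded_near_0[of l2] b unfolding lagrangian_bounds_def by metis
  moreover have "L x v \<le> B" if "x \<in> S" "norm v \<le> c" for x v
    using le(2)[OF that(1), of v] calculation(3)[OF that(2)] by (metis ereal_less_eq(3) order_trans)
  ultimately show ?thesis using L by blast
qed

lemma I_nonneg: "0 < T \<Longrightarrow> \<phi> \<in> cadlag T S \<Longrightarrow> 0 \<le> I T \<phi>"
  using LDP unfolding sample_path_LDP_def by blast

lemma I_finite_imp_abs_continuous:
  "0 < T \<Longrightarrow> \<phi> \<in> cadlag T S \<Longrightarrow> I T \<phi> \<noteq> \<infinity> \<Longrightarrow> abs_continuous_on T \<phi>"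
  using lagrangian_exists unfolding lagrangian_for_def by blast

lemma I_finite_imp_cont_path:
  assumes "0 < T" "\<phi> \<in> cadlag T S" "I T \<phi> \<noteq> \<infinity>"
  shows "\<phi> \<in> cont_paths T S"
  using abs_continuous_on_imp_continuous_on[OF I_finite_imp_abs_continuous[OF assms]] assms(2)
  by (simp add: cont_paths_def cadlag_def)

lemma I_concat_path_le:
  assumes \<phi>1: "\<phi>1 \<in> cont_paths T1 S" and \<phi>2: "\<phi>2 \<in> cont_paths T2 S"
    and eq: "\<phi>1 T1 = \<phi>2 0" and T: "0 < T1" "0 < T2"
  shows "I (T1 + T2) (concat_path T1 T2 \<phi>1 \<phi>2) \<le> I T1 \<phi>1 + I T2 \<phi>2"
proof (cases "I T1 \<phi>1 = \<infinity> \<or> I T2 \<phi>2 = \<infinity>")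
  case True
  moreover have "0 \<le> I T1 \<phi>1" "0 \<le> I T2 \<phi>2"
    using I_nonneg T subsetD[OF cont_paths_subset_cadlag] \<phi>1 \<phi>2 by blast+
  ultimately have sum: "I T1 \<phi>1 + I T2 \<phi>2 = \<infinity>" by auto
  show ?thesis unfolding sum by simp
next
  case False
  have c: "\<phi>1 \<in> cadlag T1 S" "\<phi>2 \<in> cadlag T2 S"
    using \<phi>1 \<phi>2 cont_paths_subset_cadlag by blast+
  have ac: "abs_continuous_on T1 \<phi>1" "abs_continuous_on T2 \<phi>2"
    using I_finite_imp_abs_continuous c T False by blast+
  have ac3: "abs_continuous_on (T1 + T2) (concat_path T1 T2 \<phi>1 \<phi>2)"
    using abs_continuous_on_concat_path[OF ac eq] T by simp
  have c3: "concat_path T1 T2 \<phi>1 \<phi>2 \<in> cadlag (T1 + T2) S"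
    using concat_path_cont_paths[OF \<phi>1 \<phi>2 eq] T cont_paths_subset_cadlag by (meson less_imp_le subsetD)
  obtain L where L: "\<And>T \<phi>. 0 < T \<Longrightarrow> \<phi> \<in> cadlag T S \<Longrightarrow> abs_continuous_on T \<phi> \<Longrightarrow>
      set_borel_measurable lebesgue {0..T} (\<lambda>t. L (\<phi> t) (vector_derivative \<phi> (at t within {0..T}))) \<and>
      I T \<phi> = action_functional L T \<phi>"
    using lagrangian_exists unfolding lagrangian_for_def by blast
  show ?thesis
    using L[OF T(1) c(1) ac(1)] L[OF T(2) c(2) ac(2)] L[OF _ c3 ac3] T
      action_functional_concat_path[of T1 L \<phi>1 T2 \<phi>2]
    by simp
qed

lemma straight_path_cost:
  obtains c B where "0 < c" "0 < B"
    "\<And>s x v. 0 < s \<Longrightarrow> norm v \<le> c \<Longrightarrow> (\<And>t. t \<in> {0..s} \<Longrightarrow> x + t *\<^sub>R v \<in> S) \<Longrightarrow>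
      (\<lambda>t\<in>{0..s}. x + t *\<^sub>R v) \<in> cont_paths s S \<and> I s (\<lambda>t\<in>{0..s}. x + t *\<^sub>R v) \<le> ereal (B * s)"
proof -
  obtain L c B where L: "lagrangian_for S I L" and cB: "0 < c" "0 < B"
    and bnd: "\<And>x v. x \<in> S \<Longrightarrow> norm v \<le> c \<Longrightarrow> L x v \<le> B"
    using lagrangian_exists by blast
  have "(\<lambda>t\<in>{0..s}. x + t *\<^sub>R v) \<in> cont_paths s S \<and> I s (\<lambda>t\<in>{0..s}. x + t *\<^sub>R v) \<le> ereal (B * s)"
    if s: "0 < s" and v: "norm v \<le> c" and x: "\<And>t. t \<in> {0..s} \<Longrightarrow> x + t *\<^sub>R v \<in> S" for s x v
  proof
    let ?\<phi> = "\<lambda>t\<in>{0..s}. x + t *\<^sub>R v"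
    have "continuous_on {0..s} (\<lambda>t. x + t *\<^sub>R v)" by (intro continuous_intros)
    then have "continuous_on {0..s} ?\<phi>" by (rule continuous_on_eq) simp
    then show cp: "?\<phi> \<in> cont_paths s S" using x by (auto simp: cont_paths_def)
    have "abs_continuous_on s ?\<phi>"
      by (rule abs_continuous_on_lipschitz[where K = "norm v"])
         (auto simp: scaleR_left_diff_distrib[symmetric] mult.commute)
    then have "I s ?\<phi> = action_functional L s ?\<phi>"
      using L s cp cont_paths_subset_cadlag unfolding lagrangian_for_def by blast
    also have "\<dots> \<le> ereal (B * s)"
    proof (rule action_functional_le)
      fix t assume t: "t \<in> {0..s}"
      have "((\<lambda>t. x + t *\<^sub>R v) has_vector_derivative v) (at t within {0..s})"
        by (auto intro!: derivative_eq_intros)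
      then have "(?\<phi> has_vector_derivative v) (at t within {0..s})"
        by (rule has_vector_derivative_transform[rotated 2]) (use t in auto)
      then have "vector_derivative ?\<phi> (at t within {0..s}) = v"
        using t s by (intro vector_derivative_within_closed_interval) auto
      then show "L (?\<phi> t) (vector_derivative ?\<phi> (at t within {0..s})) \<le> B"
        using bnd[OF x[OF t] v] t by simp
    qed (use cB s in auto)
    finally show "I s ?\<phi> \<le> ereal (B * s)" .
  qed
  then show thesis using that cB by blast
qed

text \<open>The segment between \<open>x\<close> and 0 consists of nonnegative multiples of
  \<open>x\<close>, so it stays in the cone. Duration \<open>s\<close> with
  \<open>norm x \<le> c * s\<close> keeps the speed below \<open>c\<close>, where the cost rate is
  at most \<open>B\<close>.\<close>

lemma travel_cost:
  obtains c B where "0 < c" "0 < B"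
    "\<And>s x. 0 < s \<Longrightarrow> x \<in> S \<Longrightarrow> norm x \<le> c * s \<Longrightarrow>
      \<exists>\<phi>\<in>cont_paths s S. \<phi> 0 = x \<and> \<phi> s = 0 \<and> I s \<phi> \<le> ereal (B * s)"
    "\<And>s x. 0 < s \<Longrightarrow> x \<in> S \<Longrightarrow> norm x \<le> c * s \<Longrightarrow>
      \<exists>\<phi>\<in>cont_paths s S. \<phi> 0 = 0 \<and> \<phi> s = x \<and> I s \<phi> \<le> ereal (B * s)"
proof -
  obtain c B where cB: "0 < c" "0 < B" and cost:
    "\<And>s x v. 0 < s \<Longrightarrow> norm v \<le> c \<Longrightarrow> (\<And>t. t \<in> {0..s} \<Longrightarrow> x + t *\<^sub>R v \<in> S) \<Longrightarrow>
      (\<lambda>t\<in>{0..s}. x + t *\<^sub>R v) \<in> cont_paths s S \<and> I s (\<lambda>t\<in>{0..s}. x + t *\<^sub>R v) \<le> ereal (B * s)"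
    using straight_path_cost by blast
  have v: "norm (x /\<^sub>R s) \<le> c" if "0 < s" "norm x \<le> c * s" for s and x :: 'a
    using that by (simp add: field_simps)
  show thesis
  proof (rule that[OF cB])
    fix s x assume s: "0 < s" and x: "x \<in> S" "norm x \<le> c * s"
    have "x + t *\<^sub>R (- (x /\<^sub>R s)) \<in> S" if "t \<in> {0..s}" for t
    proof -
      have "(1 - t / s) *\<^sub>R x \<in> S" using that s by (intro scaleR_in_limit_cone x) auto
      then show ?thesis by (simp add: algebra_simps divide_inverse)
    qed
    then show "\<exists>\<phi>\<in>cont_paths s S. \<phi> 0 = x \<and> \<phi> s = 0 \<and> I s \<phi> \<le> ereal (B * s)"
      using cost[of s "- (x /\<^sub>R s)" x] s v[OF s x(2)]
      by (intro bexI[of _ "\<lambda>t\<in>{0..s}. x + t *\<^sub>R (- (x /\<^sub>R s))"]) auto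
    have "0 + t *\<^sub>R (x /\<^sub>R s) \<in> S" if "t \<in> {0..s}" for t
    proof -
      have "(t / s) *\<^sub>R x \<in> S" using that s by (intro scaleR_in_limit_cone x) auto
      then show ?thesis by (simp add: divide_inverse)
    qed
    then show "\<exists>\<phi>\<in>cont_paths s S. \<phi> 0 = 0 \<and> \<phi> s = x \<and> I s \<phi> \<le> ereal (B * s)"
      using cost[of s "x /\<^sub>R s" 0] s v[OF s x(2)]
      by (intro bexI[of _ "\<lambda>t\<in>{0..s}. 0 + t *\<^sub>R (x /\<^sub>R s)"]) auto
  qed
qed

section \<open>The path at rest in the origin\<close>

abbreviation rest :: "real \<Rightarrow> real \<Rightarrow> 'a" where "rest T \<equiv> \<lambda>t\<in>{0..T}. 0"

text \<open>The number \<open>q\<close> of the overview. The conversion to a real loses nothing,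
  since the cost turns out to be finite.\<close>

definition rest_rate :: real where "rest_rate = real_of_ereal (I 1 (rest 1))"

lemma rest_cont_path: "rest T \<in> cont_paths T S"
proof -
  have "continuous_on {0..T} (rest T)" by (rule continuous_on_eq[of _ "\<lambda>_. 0"]) auto
  then show ?thesis using zero_in_S by (auto simp: cont_paths_def)
qed

text \<open>The integrand is the constant \<open>L 0 0\<close>, which is therefore the rate, and the
  cost is linear in the duration.\<close>

lemma I_rest: "0 < T \<Longrightarrow> I T (rest T) = ereal (T * rest_rate)"
  and rest_rate_nonneg: "0 \<le> rest_rate"
proof -
  obtain L where L: "lagrangian_for S I L" using lagrangian_exists by blast
  have L0: "0 \<le> L 0 0" using L zero_in_S unfolding lagrangian_for_def by blast
  have I: "I T (rest T) = ereal (T * L 0 0)" if T: "0 < T" for T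
  proof -
    have "abs_continuous_on T (rest T)"
      by (rule abs_continuous_on_lipschitz[where K = 0]) auto
    then have "I T (rest T) = action_functional L T (rest T)"
      using L T rest_cont_path cont_paths_subset_cadlag unfolding lagrangian_for_def by blast
    also have "\<dots> = enn2ereal (\<integral>\<^sup>+t. ennreal (L 0 0) * indicator {0..T} t \<partial>lebesgue)"
      unfolding action_functional_def
    proof (intro arg_cong[of _ _ enn2ereal] nn_integral_cong)
      fix t
      have "vector_derivative (rest T) (at t within {0..T}) = 0" if t: "t \<in> {0..T}"
      proof -
        have "((\<lambda>t. 0) has_vector_derivative 0) (at t within {0..T})" by simp
        then have "(rest T has_vector_derivative 0) (at t within {0..T})"
          by (rule has_vector_derivative_transform[rotated 2]) (use t in auto)
        then show ?thesis using t T by (intro vector_derivative_within_closed_interval) auto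
      qed
      then show "ennreal (L (rest T t) (vector_derivative (rest T) (at t within {0..T}))) * indicator {0..T} t =
          ennreal (L 0 0) * indicator {0..T} t"
        by (auto simp: indicator_def)
    qed
    also have "\<dots> = ereal (T * L 0 0)"
      using T L0 by (simp add: nn_integral_cmult_indicator ennreal_mult''[symmetric] enn2ereal_ennreal mult.commute)
    finally show ?thesis .
  qed
  have "rest_rate = L 0 0" using I[of 1] by (simp add: rest_rate_def)
  then show "0 < T \<Longrightarrow> I T (rest T) = ereal (T * rest_rate)" "0 \<le> rest_rate"
    using I L0 by auto
qed

section \<open>Scale invariance of the rate function and the cost of loops\<close>

text \<open>The scale invariance of the rate function comes from the identity
  \<open>Z\<^bsub>ka\<^esub>(t) = Z\<^bsub>a\<^esub>(kt) / k\<close>: the lower bound for \<open>Z\<^bsub>a\<^esub>\<close> in a tube is confronted with the upper bound for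
  \<open>Z\<^bsub>ka\<^esub>\<close> in the rescaled tube.\<close>

lemma I_rescale_le:
  assumes \<phi>: "\<phi> \<in> cont_paths T S" and T: "0 < T" and k: "0 < k" and c: "I T \<phi> < ereal c"
  defines "\<psi> \<equiv> \<lambda>t\<in>{0..T / k}. \<phi> (k * t) /\<^sub>R k"
  shows "\<psi> \<in> cont_paths (T / k) S" "I (T / k) \<psi> \<le> ereal (c / k)"
proof -
  have Tk: "0 < T / k" using T k by simp
  have kt: "k * t \<in> {0..T}" if "t \<in> {0..T / k}" for t
    using that k by (auto simp: field_simps)
  have "continuous_on {0..T} \<phi>" using \<phi> by (simp add: cont_paths_def)
  then have "continuous_on {0..T / k} (\<lambda>t. \<phi> (k * t))"
    by (rule continuous_on_compose2) (use kt in \<open>auto intro!: continuous_intros\<close>)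
  then have "continuous_on {0..T / k} (\<lambda>t. \<phi> (k * t) /\<^sub>R k)" by (intro continuous_intros)
  then have "continuous_on {0..T / k} \<psi>" by (rule continuous_on_eq) (simp add: \<psi>_def)
  moreover have "\<psi> t \<in> S" if "t \<in> {0..T / k}" for t
  proof -
    have "\<phi> (k * t) \<in> S" using \<phi> kt[OF that] by (auto simp: cont_paths_def)
    then show ?thesis using that k by (simp add: \<psi>_def scaleR_in_limit_cone)
  qed
  ultimately show \<psi>: "\<psi> \<in> cont_paths (T / k) S" by (auto simp: cont_paths_def \<psi>_def)
  have cpos: "0 < c"
    using c I_nonneg[OF T subsetD[OF cont_paths_subset_cadlag \<phi>]] by (metis ereal_less(2) le_less_trans)
  show "I (T / k) \<psi> \<le> ereal (c / k)"
  proof (rule ccontr)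
    assume "\<not> I (T / k) \<psi> \<le> ereal (c / k)"
    then obtain c' where c': "c / k < c'" "\<not> I (T / k) \<psi> \<le> ereal c'"
      by (meson ereal_dense2 less_ereal.simps(1) not_le)
    have \<psi>0: "\<psi> 0 \<in> S" using \<psi> Tk by (auto simp: cont_paths_def)
    have c'pos: "0 < c'" using c' cpos k by (metis divide_pos_pos less_trans)
    \<comment> \<open>Lower semicontinuity at \<open>\<psi>\<close>: were there cheaper paths from
      \<open>\<psi> 0\<close> in every tube, \<open>\<psi>\<close> itself would cost at most
      \<open>c'\<close>.\<close>
    have "\<exists>r>0. \<forall>\<eta>\<in>uniform_tube (T / k) S \<psi> r. \<eta> 0 = \<psi> 0 \<longrightarrow> ereal c' \<le> I (T / k) \<eta>"
    proof (rule ccontr)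
      assume n: "\<not> ?thesis"
      have "I (T / k) \<psi> \<le> ereal c'"
      proof (rule LDP_lower_semicontinuous[OF LDP[OF Tk] subsetD[OF cont_paths_subset_cadlag \<psi>] c'pos])
        fix r :: real assume "r > 0"
        then obtain \<eta> where "\<eta> \<in> uniform_tube (T / k) S \<psi> r" "\<eta> 0 = \<psi> 0" "\<not> ereal c' \<le> I (T / k) \<eta>"
          using n by blast
        then show "\<exists>\<eta>\<in>cadlag (T / k) S. \<eta> 0 \<in> {\<psi> 0} \<and> I (T / k) \<eta> \<le> ereal c' \<and>
            (\<forall>t\<in>{0..T / k}. dist (\<eta> t) (\<psi> t) \<le> r)"
          unfolding uniform_tube_def by (intro bexI[of _ \<eta>]) auto
      qed (use \<psi>0 in auto)
      with c'(2) show False by simp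
    qed
    then obtain r where r: "r > 0"
      and tube: "\<And>\<eta>. \<eta> \<in> uniform_tube (T / k) S \<psi> r \<Longrightarrow> \<eta> 0 = \<psi> 0 \<Longrightarrow> ereal c' \<le> I (T / k) \<eta>"
      by blast
    obtain b where b: "c / k < b" "b < c'" using c'(1) dense by blast
    obtain e2 where e2: "e2 > 0" "\<forall>\<^sub>F a in at_top. \<forall>z\<in>starts_near E a (\<psi> 0) e2.
        measure (P (a *\<^sub>R z)) {\<omega> \<in> space M. rescaled_path X a (T / k) \<omega> \<in> uniform_tube (T / k) S \<psi> r}
          \<le> exp (- b * a)"
      using LDP_upper[OF LDP[OF Tk] \<psi>0 closedin_uniform_tube[OF \<psi>] tube b(2)] by blast
    \<comment> \<open>Radius \<open>k * r\<close>, because dividing the values by \<open>k\<close>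
      turns this tube into one of radius \<open>r\<close> around \<open>\<psi>\<close>.\<close>
    obtain \<rho> where \<rho>: "\<rho> > 0" "{\<eta> \<in> cadlag T S. skorohod_dist T \<phi> \<eta> < \<rho>} \<subseteq> uniform_tube T S \<phi> (k * r)"
      using skorohod_ball_subset_uniform_tube[OF \<phi>, of "k * r"] k r by auto
    let ?U = "{\<eta> \<in> cadlag T S. skorohod_dist T \<phi> \<eta> < \<rho>}"
    have \<phi>c: "\<phi> \<in> cadlag T S" using \<phi> cont_paths_subset_cadlag by blast
    have \<phi>U: "\<phi> \<in> ?U"
      using \<phi>c skorohod_dist_le_uniform[of T \<phi> \<phi> 0] \<rho>(1) by auto
    have \<phi>0: "\<phi> 0 \<in> S" using \<phi> T by (auto simp: cont_paths_def)
    obtain e1 where e1: "e1 > 0" "\<forall>\<^sub>F a in at_top. \<forall>z\<in>starts_near E a (\<phi> 0) e1.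
        exp (- c * a) < measure (P (a *\<^sub>R z)) {\<omega> \<in> space M. rescaled_path X a T \<omega> \<in> ?U}"
      using LDP_lower[OF LDP[OF T] \<phi>0 openin_skorohod_ball[OF \<phi>c] \<phi>U c] by blast
    have "filterlim (\<lambda>a. k * a) at_top at_top"
      by (rule filterlim_tendsto_pos_mult_at_top[OF tendsto_const k filterlim_ident])
    then have "\<forall>\<^sub>F a in at_top. \<forall>z\<in>starts_near E (k * a) (\<psi> 0) e2.
        measure (P ((k * a) *\<^sub>R z)) {\<omega> \<in> space M. rescaled_path X (k * a) (T / k) \<omega> \<in> uniform_tube (T / k) S \<psi> r}
          \<le> exp (- b * (k * a))"
      using e2(2) by (rule eventually_compose_filterlim[rotated])
    \<comment> \<open>Both bounds must speak of the same starting point. A point \<open>z\<close> at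
      distance less than \<open>k * e2\<close> from \<open>\<phi> 0\<close> becomes, after division
      by \<open>k\<close>, a point within \<open>e2\<close> of \<open>\<psi> 0\<close>, and
      \<open>a *\<^sub>R z\<close> is unchanged.\<close>
    moreover have "\<forall>\<^sub>F a in at_top. starts_near E a (\<phi> 0) (min e1 (k * e2)) \<noteq> {}"
      using e1 e2 k by (intro eventually_starts_near_nonempty[OF \<phi>0]) simp
    moreover note e1(2) eventually_gt_at_top[of 0]
    ultimately have "\<exists>a. (\<forall>z\<in>starts_near E (k * a) (\<psi> 0) e2.
        measure (P ((k * a) *\<^sub>R z)) {\<omega> \<in> space M. rescaled_path X (k * a) (T / k) \<omega> \<in> uniform_tube (T / k) S \<psi> r}
          \<le> exp (- b * (k * a))) \<and> starts_near E a (\<phi> 0) (min e1 (k * e2)) \<noteq> {} \<and>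
        (\<forall>z\<in>starts_near E a (\<phi> 0) e1.
          exp (- c * a) < measure (P (a *\<^sub>R z)) {\<omega> \<in> space M. rescaled_path X a T \<omega> \<in> ?U}) \<and> 0 < a"
      by (intro eventually_happens'[OF trivial_limit_at_top_linorder] eventually_conj)
    then show False
    proof (elim exE conjE, goal_cases)
      case elim: (1 a)
      obtain z where z: "z \<in> starts_near E a (\<phi> 0) (min e1 (k * e2))" using elim(2) by blast
      have az: "a *\<^sub>R z \<in> E" using z by (simp add: starts_near_def)
      have z1: "z \<in> starts_near E a (\<phi> 0) e1" using z by (simp add: starts_near_def)
      have "norm (z /\<^sub>R k - \<psi> 0) = norm ((z - \<phi> 0) /\<^sub>R k)"
        using Tk by (simp add: \<psi>_def scaleR_right_diff_distrib)
      also have "\<dots> = norm (z - \<phi> 0) / k"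
        using k by (simp only: norm_scaleR) (simp add: divide_inverse mult.commute)
      also have "\<dots> < e2" using z k by (simp add: starts_near_def pos_divide_less_eq mult.commute)
      finally have "norm (z /\<^sub>R k - \<psi> 0) < e2" .
      moreover have kaz: "(k * a) *\<^sub>R (z /\<^sub>R k) = a *\<^sub>R z" using k by (simp add: field_simps)
      ultimately have z2: "z /\<^sub>R k \<in> starts_near E (k * a) (\<psi> 0) e2"
        using az by (simp only: starts_near_def mem_Collect_eq)
      interpret prob_space "P (a *\<^sub>R z)" using prob[OF az] .
      let ?C = "{\<omega> \<in> space M. rescaled_path X (k * a) (T / k) \<omega> \<in> uniform_tube (T / k) S \<psi> r}"
      let ?A = "{\<omega> \<in> space M. rescaled_path X a T \<omega> \<in> ?U}"
      have "?A \<subseteq> ?C"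
      proof safe
        fix \<omega> assume \<omega>: "\<omega> \<in> space M" "rescaled_path X a T \<omega> \<in> cadlag T S"
          "skorohod_dist T \<phi> (rescaled_path X a T \<omega>) < \<rho>"
        then have *: "dist (rescaled_path X a T \<omega> t) (\<phi> t) \<le> k * r" if "t \<in> {0..T}" for t
          using \<rho>(2) that unfolding uniform_tube_def by blast
        have "dist (rescaled_path X (k * a) (T / k) \<omega> t) (\<psi> t) \<le> r" if t: "t \<in> {0..T / k}" for t
        proof -
          have "rescaled_path X (k * a) (T / k) \<omega> t = rescaled_path X a T \<omega> (k * t) /\<^sub>R k"
            using t kt[OF t] by (simp add: rescaled_path_def mult.commute mult.left_commute)
          then have "dist (rescaled_path X (k * a) (T / k) \<omega> t) (\<psi> t) =
              \<bar>inverse k\<bar> * dist (rescaled_path X a T \<omega> (k * t)) (\<phi> (k * t))"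
            using t by (simp add: \<psi>_def dist_scaleR_left)
          also have "\<dots> \<le> \<bar>inverse k\<bar> * (k * r)" by (intro mult_left_mono * kt t) auto
          also have "\<dots> = r"
          proof -
            have "\<bar>inverse k\<bar> = 1 / k" using k by (simp add: inverse_eq_divide)
            then show ?thesis using k by simp
          qed
          finally show ?thesis .
        qed
        then show "rescaled_path X (k * a) (T / k) \<omega> \<in> uniform_tube (T / k) S \<psi> r"
          using rescaled_path_cadlag[OF \<omega>(1), of "k * a"] elim(4) k by (simp add: uniform_tube_def)
      qed
      \<comment> \<open>Monotonicity needs only the larger set to be an event; the Skorohod ball
        behind \<open>?A\<close> may fail to give one.\<close>
      moreover have "?C \<in> sets (P (a *\<^sub>R z))"
        unfolding sets_P[OF az] using elim(4) k Tk by (intro uniform_tube_event[OF \<psi>]) auto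
      ultimately have "measure (P (a *\<^sub>R z)) ?A \<le> measure (P (a *\<^sub>R z)) ?C"
        by (rule finite_measure_mono)
      moreover have "exp (- c * a) < measure (P (a *\<^sub>R z)) ?A" using elim(3) z1 by blast
      moreover have "measure (P (a *\<^sub>R z)) ?C \<le> exp (- b * (k * a))"
        using bspec[OF elim(1) z2] by (simp only: kaz)
      ultimately have "exp (- c * a) < exp (- b * (k * a))" by linarith
      then have "b * k * a < c * a" by simp
      then have "b * k < c" using elim(4) by simp
      then show False using b(1) k by (simp add: field_simps)
    qed
  qed
qed

text \<open>The bound \<open>\<rho>\<close> is carried through the induction because smallness of
  all repetitions is what later yields uniform convergence to the path at rest.\<close>

lemma iterate_loop:
  assumes \<psi>: "\<psi> \<in> cont_paths \<tau> S" "\<psi> \<tau> = \<psi> 0" "0 < \<tau>" "I \<tau> \<psi> \<le> ereal c"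
    and \<rho>: "\<And>t. t \<in> {0..\<tau>} \<Longrightarrow> norm (\<psi> t) \<le> \<rho>"
  shows "0 < n \<Longrightarrow> \<exists>\<eta>\<in>cont_paths (real n * \<tau>) S. \<eta> 0 = \<psi> 0 \<and> \<eta> (real n * \<tau>) = \<psi> 0 \<and>
    (\<forall>t\<in>{0..real n * \<tau>}. norm (\<eta> t) \<le> \<rho>) \<and> I (real n * \<tau>) \<eta> \<le> ereal (real n * c)"
proof (induction n)
  case (Suc n)
  show ?case
  \<comment> \<open>Costs of concatenations are controlled only for positive durations, so the
    induction effectively starts with one round.\<close>
  proof (cases "n = 0")
    case True
    then show ?thesis using assms by (intro bexI[of _ \<psi>]) auto
  next
    case False
    then obtain \<eta> where \<eta>: "\<eta> \<in> cont_paths (real n * \<tau>) S" "\<eta> 0 = \<psi> 0" "\<eta> (real n * \<tau>) = \<psi> 0"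
      "\<And>t. t \<in> {0..real n * \<tau>} \<Longrightarrow> norm (\<eta> t) \<le> \<rho>" "I (real n * \<tau>) \<eta> \<le> ereal (real n * c)"
      using Suc.IH by blast
    have n\<tau>: "0 < real n * \<tau>" using False \<psi>(3) by simp
    let ?\<eta> = "concat_path (real n * \<tau>) \<tau> \<eta> \<psi>"
    have len: "real (Suc n) * \<tau> = real n * \<tau> + \<tau>" by (simp add: algebra_simps)
    have "I (real n * \<tau> + \<tau>) ?\<eta> \<le> I (real n * \<tau>) \<eta> + I \<tau> \<psi>"
      by (rule I_concat_path_le[OF \<eta>(1) \<psi>(1) _ n\<tau> \<psi>(3)]) (rule \<eta>(3))
    also have "\<dots> \<le> ereal (real n * c) + ereal c" by (intro add_mono \<eta>(5) \<psi>(4))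
    also have "\<dots> = ereal (real (Suc n) * c)" by (simp add: algebra_simps)
    finally have "I (real n * \<tau> + \<tau>) ?\<eta> \<le> ereal (real (Suc n) * c)" .
    moreover have "?\<eta> \<in> cont_paths (real n * \<tau> + \<tau>) S"
      using n\<tau> \<psi>(3) by (intro concat_path_cont_paths \<eta>(1) \<psi>(1)) (auto simp: \<eta>(3))
    moreover have "?\<eta> 0 = \<psi> 0" using n\<tau> \<psi>(3) \<eta>(2) by (simp add: concat_path_left)
    moreover have "?\<eta> (real n * \<tau> + \<tau>) = \<psi> 0"
      using n\<tau> \<psi>(2,3) \<eta>(3) by (simp add: concat_path_right)
    moreover have "norm (?\<eta> t) \<le> \<rho>" if "t \<in> {0..real n * \<tau> + \<tau>}" for t
      using that \<eta>(4)[of t] \<rho>[of "t - real n * \<tau>"] by (auto simp: concat_path_def)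
    ultimately show ?thesis unfolding len by blast
  qed
qed simp

text \<open>Running a loop \<open>n\<close> times on the scale \<open>1 / n\<close> costs the same and converges to the path at rest
  in the origin, so lower semicontinuity applies.\<close>

lemma loop_cost:
  assumes \<phi>: "\<phi> \<in> cont_paths T S" "\<phi> 0 = \<phi> T" and T: "0 < T"
  shows "ereal (T * rest_rate) \<le> I T \<phi>"
proof (rule dense_ge)
  \<comment> \<open>A real bound strictly above the cost of the loop leaves the margin that
    rescaling requires.\<close>
  fix z assume z: "I T \<phi> < z"
  have nonneg: "0 \<le> I T \<phi>" using I_nonneg[OF T] \<phi>(1) cont_paths_subset_cadlag by blast
  show "ereal (T * rest_rate) \<le> z"
  proof (cases z)
    case (real c)
    have c: "0 < c" "I T \<phi> < ereal c" using z nonneg real by (auto dest: le_less_trans)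
    obtain B where B: "\<And>t. t \<in> {0..T} \<Longrightarrow> norm (\<phi> t) \<le> B"
      using cadlag_bounded[OF subsetD[OF cont_paths_subset_cadlag \<phi>(1)]]
      unfolding bounded_iff by blast
    have B0: "0 \<le> B" using B[of 0] T by (meson atLeastAtMost_iff less_imp_le norm_ge_zero order_refl order_trans)
    have \<phi>0: "\<phi> 0 \<in> S" using \<phi> T by (auto simp: cont_paths_def)
    have "I T (rest T) \<le> ereal c"
    proof (rule LDP_lower_semicontinuous[OF LDP[OF T] subsetD[OF cont_paths_subset_cadlag rest_cont_path] c(1)])
      show "compact (S \<inter> cball 0 B)"
        by (intro closed_Int_compact closed_limit_cone closed_E compact_cball)
      show "S \<inter> cball 0 B \<subseteq> S" by blast
      fix r :: real assume r: "r > 0"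
      \<comment> \<open>The first inequality brings the shrunken loop within \<open>r\<close> of the
        origin. The second keeps its initial point in the ball of radius \<open>B\<close>, so that
        one compact set serves for all \<open>r\<close>.\<close>
      obtain n :: nat where n: "B / r < real n" "1 \<le> n"
        using reals_Archimedean2[of "max (B / r) 1"] by (metis max_less_iff_conj of_nat_1 of_nat_le_iff less_imp_le)
      have n0: "0 < real n" "0 < n" using n by auto
      have Bn: "B / real n \<le> r" using n r by (simp add: field_simps)
      have Bn': "B / real n \<le> B" using n B0 mult_left_mono[of 1 "real n" B] by (simp add: divide_le_eq)
      let ?\<psi> = "\<lambda>t\<in>{0..T / real n}. \<phi> (real n * t) /\<^sub>R real n"
      have Tn: "0 < T / real n" using T n0 by simp
      have ends: "?\<psi> (T / real n) = ?\<psi> 0" using T n0 \<phi>(2) by simp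
      have bound: "norm (?\<psi> t) \<le> B / real n" if "t \<in> {0..T / real n}" for t
      proof -
        have "real n * t \<in> {0..T}" using that n0 by (auto simp: field_simps)
        then show ?thesis using B n0 that by (simp add: divide_simps)
      qed
      have "\<exists>\<eta>\<in>cont_paths (real n * (T / real n)) S. \<eta> 0 = ?\<psi> 0 \<and> \<eta> (real n * (T / real n)) = ?\<psi> 0 \<and>
          (\<forall>t\<in>{0..real n * (T / real n)}. norm (\<eta> t) \<le> B / real n) \<and>
          I (real n * (T / real n)) \<eta> \<le> ereal (real n * (c / real n))"
        by (rule iterate_loop[OF I_rescale_le(1)[OF \<phi>(1) T n0(1) c(2)] ends Tn
              I_rescale_le(2)[OF \<phi>(1) T n0(1) c(2)] bound n0(2)])
      then obtain \<eta> where \<eta>: "\<eta> \<in> cont_paths T S" "\<eta> 0 = ?\<psi> 0"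
          "\<And>t. t \<in> {0..T} \<Longrightarrow> norm (\<eta> t) \<le> B / real n" "I T \<eta> \<le> ereal c"
        using n0 by auto
      have "\<eta> 0 \<in> S" using \<eta>(1) T by (auto simp: cont_paths_def)
      moreover have "norm (\<eta> 0) \<le> B" using \<eta>(3)[of 0] T Bn' by simp
      moreover have "dist (\<eta> t) (rest T t) \<le> r" if "t \<in> {0..T}" for t
        using \<eta>(3)[OF that] Bn that by simp
      ultimately show "\<exists>\<eta>\<in>cadlag T S. \<eta> 0 \<in> S \<inter> cball 0 B \<and> I T \<eta> \<le> ereal c \<and>
          (\<forall>t\<in>{0..T}. dist (\<eta> t) (rest T t) \<le> r)"
        using \<eta>(1,4) subsetD[OF cont_paths_subset_cadlag] by (intro bexI[of _ \<eta>]) auto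
    qed
    then show ?thesis using I_rest[OF T] real by simp
  qed (use z nonneg in auto)
qed

section \<open>Travel costs\<close>

text \<open>A real budget instead of an extended infimum: no minimiser has to be chosen, and budgets
  simply add along chains of paths.\<close>

definition reachable :: "real \<Rightarrow> 'a \<Rightarrow> 'a \<Rightarrow> real \<Rightarrow> bool" where
  "reachable T x y k \<longleftrightarrow> (\<exists>\<phi>\<in>cont_paths T S. \<phi> 0 = x \<and> \<phi> T = y \<and> I T \<phi> \<le> ereal k)"

lemma reachable_trans:
  assumes "reachable T1 x y k1" "reachable T2 y z k2" and T: "0 < T1" "0 < T2"
  shows "reachable (T1 + T2) x z (k1 + k2)"
proof -
  obtain \<phi>1 \<phi>2 where \<phi>: "\<phi>1 \<in> cont_paths T1 S" "\<phi>2 \<in> cont_paths T2 S"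
    and ends: "\<phi>1 0 = x" "\<phi>1 T1 = y" "\<phi>2 0 = y" "\<phi>2 T2 = z"
    and I: "I T1 \<phi>1 \<le> ereal k1" "I T2 \<phi>2 \<le> ereal k2"
    using assms unfolding reachable_def by blast
  have eq: "\<phi>1 T1 = \<phi>2 0" using ends by simp
  have "I (T1 + T2) (concat_path T1 T2 \<phi>1 \<phi>2) \<le> I T1 \<phi>1 + I T2 \<phi>2"
    by (rule I_concat_path_le[OF \<phi> eq T])
  also have "\<dots> \<le> ereal (k1 + k2)" using add_mono[OF I] by simp
  finally have "I (T1 + T2) (concat_path T1 T2 \<phi>1 \<phi>2) \<le> ereal (k1 + k2)" .
  moreover have "concat_path T1 T2 \<phi>1 \<phi>2 \<in> cont_paths (T1 + T2) S"
    using T by (intro concat_path_cont_paths \<phi> eq) auto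
  ultimately show ?thesis unfolding reachable_def using T ends eq
    by (intro bexI[of _ "concat_path T1 T2 \<phi>1 \<phi>2"]) (auto simp: concat_path_left concat_path_right)
qed

lemma reachable_loop: "reachable T x x k \<Longrightarrow> 0 < T \<Longrightarrow> T * rest_rate \<le> k"
  unfolding reachable_def using loop_cost by (metis ereal_less_eq(3) order_trans)

lemma reachable_rest: "0 < T \<Longrightarrow> reachable T 0 0 (T * rest_rate)"
  unfolding reachable_def using rest_cont_path[of T] I_rest[of T]
  by (intro bexI[of _ "rest T"]) auto

lemma reachable_travel:
  obtains c B where "0 < c" "0 < B"
    "\<And>s x. 0 < s \<Longrightarrow> x \<in> S \<Longrightarrow> norm x \<le> c * s \<Longrightarrow> reachable s x 0 (B * s)"
    "\<And>s x. 0 < s \<Longrightarrow> x \<in> S \<Longrightarrow> norm x \<le> c * s \<Longrightarrow> reachable s 0 x (B * s)"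
  unfolding reachable_def by (rule travel_cost) blast

lemma I_finite_imp_reachable:
  assumes "0 < T" "\<phi> \<in> cadlag T S" "I T \<phi> \<noteq> \<infinity>"
  obtains k where "I T \<phi> = ereal k" "reachable T (\<phi> 0) (\<phi> T) k"
proof -
  obtain k where "I T \<phi> = ereal k"
    using I_nonneg[OF assms(1,2)] assms(3) by (cases "I T \<phi>") auto
  then show thesis using that I_finite_imp_cont_path[OF assms] unfolding reachable_def by force
qed

section \<open>The variational expressions\<close>

lemma min_cost_origin: "min_cost S I 1 0 0 = ereal rest_rate"
proof (rule antisym)
  have "min_cost S I 1 0 0 \<le> I 1 (rest 1)"
    unfolding min_cost_def by (intro INF_lower) (use rest_cont_path[of 1] in auto)
  then show "min_cost S I 1 0 0 \<le> ereal rest_rate" by (simp add: I_rest)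
  show "ereal rest_rate \<le> min_cost S I 1 0 0"
    unfolding min_cost_def using loop_cost[of _ 1] by (intro INF_greatest) auto
qed

lemma INF_loops: "(INF \<phi>\<in>{\<phi> \<in> cont_paths 1 S. \<phi> 0 = \<phi> 1}. I 1 \<phi>) = ereal rest_rate"
proof (rule antisym)
  have "(INF \<phi>\<in>{\<phi> \<in> cont_paths 1 S. \<phi> 0 = \<phi> 1}. I 1 \<phi>) \<le> I 1 (rest 1)"
    by (intro INF_lower) (use rest_cont_path[of 1] in auto)
  then show "(INF \<phi>\<in>{\<phi> \<in> cont_paths 1 S. \<phi> 0 = \<phi> 1}. I 1 \<phi>) \<le> ereal rest_rate"
    by (simp add: I_rest)
  show "ereal rest_rate \<le> (INF \<phi>\<in>{\<phi> \<in> cont_paths 1 S. \<phi> 0 = \<phi> 1}. I 1 \<phi>)"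
    using loop_cost[of _ 1] by (intro INF_greatest) auto
qed

text \<open>Detours of length \<open>s\<close> through the origin, used in both directions. Above:
  go to 0, rest there, go on to \<open>y\<close>. Below: any path from \<open>x\<close> to
  \<open>y\<close> continued by \<open>y\<close>, 0, \<open>x\<close> is a loop of duration
  \<open>t + 2 * s\<close>, to which the loop inequality applies.\<close>

lemma min_cost_bounds:
  assumes x: "x \<in> S" and y: "y \<in> S"
  obtains s B where "0 < s"
    "\<And>t. 2 * s < t \<Longrightarrow> min_cost S I t x y \<le> ereal ((t - 2 * s) * rest_rate + 2 * (B * s))"
    "\<And>t. 2 * s < t \<Longrightarrow> ereal ((t + 2 * s) * rest_rate - 2 * (B * s)) \<le> min_cost S I t x y"
proof -
  obtain c B where cB: "0 < c" "0 < B"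
    and to0: "\<And>s x. 0 < s \<Longrightarrow> x \<in> S \<Longrightarrow> norm x \<le> c * s \<Longrightarrow> reachable s x 0 (B * s)"
    and from0: "\<And>s x. 0 < s \<Longrightarrow> x \<in> S \<Longrightarrow> norm x \<le> c * s \<Longrightarrow> reachable s 0 x (B * s)"
    by (rule reachable_travel) blast
  \<comment> \<open>Long enough to reach either point from 0 at speed at most \<open>c\<close>; the
    summand 1 keeps it positive when both points are 0.\<close>
  define s where "s = (norm x + norm y) / c + 1"
  have s: "0 < s" using cB by (simp add: s_def add_nonneg_pos)
  have cs: "norm x \<le> c * s" "norm y \<le> c * s" using cB by (auto simp: s_def field_simps)
  show thesis
  proof (rule that[OF s, of B])
    fix t assume t: "2 * s < t"
    have "reachable (s + (t - 2 * s) + s) x y (B * s + (t - 2 * s) * rest_rate + B * s)"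
      by (intro reachable_trans[where y = 0] to0 from0 reachable_rest x y cs) (use s t in auto)
    then have "reachable t x y ((t - 2 * s) * rest_rate + 2 * (B * s))" by (simp add: algebra_simps)
    then obtain \<phi> where "\<phi> \<in> cont_paths t S" "\<phi> 0 = x" "\<phi> t = y"
        "I t \<phi> \<le> ereal ((t - 2 * s) * rest_rate + 2 * (B * s))"
      unfolding reachable_def by blast
    then show "min_cost S I t x y \<le> ereal ((t - 2 * s) * rest_rate + 2 * (B * s))"
      unfolding min_cost_def by (intro INF_lower2[of \<phi>]) auto
    show "ereal ((t + 2 * s) * rest_rate - 2 * (B * s)) \<le> min_cost S I t x y"
      unfolding min_cost_def
    proof (intro INF_greatest)
      fix \<phi> assume "\<phi> \<in> {\<phi> \<in> cont_paths t S. \<phi> 0 = x \<and> \<phi> t = y}"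
      then have \<phi>: "\<phi> \<in> cadlag t S" "\<phi> 0 = x" "\<phi> t = y" using cont_paths_subset_cadlag by blast+
      have t0: "0 < t" using s t by simp
      show "ereal ((t + 2 * s) * rest_rate - 2 * (B * s)) \<le> I t \<phi>"
      proof (cases "I t \<phi> = \<infinity>")
        case False
        then obtain k where k: "I t \<phi> = ereal k" "reachable t (\<phi> 0) (\<phi> t) k"
          using I_finite_imp_reachable[OF t0 \<phi>(1)] by blast
        then have "reachable (t + s + s) x x (k + B * s + B * s)"
          using \<phi> s t0 by (intro reachable_trans[where y = 0] reachable_trans[where y = y] to0 from0 x y cs) auto
        then have "(t + s + s) * rest_rate \<le> k + B * s + B * s"
          by (rule reachable_loop) (use s t0 in auto)
        then show ?thesis using k by (simp add: algebra_simps)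
      qed simp
    qed
  qed
qed

lemma Limsup_min_cost:
  assumes "x \<in> S" "y \<in> S"
  shows "Limsup at_top (\<lambda>t. min_cost S I t x y / ereal t) = ereal rest_rate"
proof (rule lim_imp_Limsup)
  obtain s B where s: "0 < s"
    and upper: "\<And>t. 2 * s < t \<Longrightarrow> min_cost S I t x y \<le> ereal ((t - 2 * s) * rest_rate + 2 * (B * s))"
    and lower: "\<And>t. 2 * s < t \<Longrightarrow> ereal ((t + 2 * s) * rest_rate - 2 * (B * s)) \<le> min_cost S I t x y"
    using min_cost_bounds[OF assms] by blast
  \<comment> \<open>With this constant the two bounds are exactly \<open>t * rest_rate + K\<close>
    and \<open>t * rest_rate - K\<close>, so the quotient even converges.\<close>
  define K where "K = 2 * (B * s) - 2 * s * rest_rate"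
  have lim: "((\<lambda>t. ereal (rest_rate + C / t)) \<longlongrightarrow> ereal rest_rate) at_top" for C
  proof -
    have "((\<lambda>t::real. C / t) \<longlongrightarrow> 0) at_top"
      by (rule tendsto_divide_0[OF tendsto_const filterlim_at_top_imp_at_infinity[OF filterlim_ident]])
    then have "((\<lambda>t. rest_rate + C / t) \<longlongrightarrow> rest_rate + 0) at_top" by (intro tendsto_intros)
    then show ?thesis by simp
  qed
  have "\<forall>\<^sub>F t in at_top. ereal (rest_rate + (- K) / t) \<le> min_cost S I t x y / ereal t \<and>
      min_cost S I t x y / ereal t \<le> ereal (rest_rate + K / t)"
    using eventually_gt_at_top[of "2 * s"]
  proof eventually_elim
    case (elim t)
    have t: "0 < t" using elim s by simp
    have "ereal (rest_rate + (- K) / t) = ereal ((t + 2 * s) * rest_rate - 2 * (B * s)) / ereal t"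
      "ereal (rest_rate + K / t) = ereal ((t - 2 * s) * rest_rate + 2 * (B * s)) / ereal t"
      using t by (auto simp: K_def field_simps)
    then show ?case
      using ereal_divide_right_mono[OF lower[OF elim], of "ereal t"]
        ereal_divide_right_mono[OF upper[OF elim], of "ereal t"] t
      by (simp only: ereal_less(2) simp_thms)
  qed
  then show "((\<lambda>t. min_cost S I t x y / ereal t) \<longlongrightarrow> ereal rest_rate) at_top"
    by (intro tendsto_sandwich[OF _ _ lim[of "- K"] lim[of K]]) (auto elim: eventually_mono)
qed simp

section \<open>Transition probabilities\<close>

lemma X_event: "0 \<le> t \<Longrightarrow> B \<in> sets borel \<Longrightarrow> {\<omega> \<in> space M. X t \<omega> \<in> B} \<in> sets M"
  using measurable_sets[OF X_measurable, of t B] by (simp add: vimage_def Int_def conj_commute)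

text \<open>A return to 0 in time \<open>s\<close> closes the path to a loop, which costs at least
  \<open>rest_rate\<close>. The return costs at most \<open>B * s\<close>, and \<open>s\<close> is
  chosen to make this equal to \<open>rest_rate - b\<close>.\<close>

lemma rate_near_origin:
  assumes "b < rest_rate"
  obtains \<delta> where "0 < \<delta>"
    "\<And>\<phi>. \<phi> \<in> cadlag 1 S \<Longrightarrow> norm (\<phi> 1) \<le> \<delta> \<Longrightarrow> \<phi> 0 = 0 \<Longrightarrow> ereal b \<le> I 1 \<phi>"
proof -
  obtain c B where cB: "0 < c" "0 < B"
    and to0: "\<And>s x. 0 < s \<Longrightarrow> x \<in> S \<Longrightarrow> norm x \<le> c * s \<Longrightarrow> reachable s x 0 (B * s)"
    by (rule reachable_travel) blast
  define s where "s = (rest_rate - b) / B"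
  have s: "0 < s" using assms cB by (simp add: s_def)
  have "ereal b \<le> I 1 \<phi>" if \<phi>: "\<phi> \<in> cadlag 1 S" "norm (\<phi> 1) \<le> c * s" "\<phi> 0 = 0" for \<phi>
  proof (cases "I 1 \<phi> = \<infinity>")
    case False
    then obtain k where k: "I 1 \<phi> = ereal k" "reachable 1 (\<phi> 0) (\<phi> 1) k"
      using I_finite_imp_reachable[of 1 \<phi>] \<phi>(1) by auto
    have "\<phi> 1 \<in> S" using \<phi>(1) by (auto simp: cadlag_def)
    then have "reachable (1 + s) 0 0 (k + B * s)"
      using k(2) \<phi> s by (intro reachable_trans[where y = "\<phi> 1"] to0) auto
    then have "(1 + s) * rest_rate \<le> k + B * s" by (rule reachable_loop) (use s in simp)
    moreover have "B * s = rest_rate - b" using cB by (simp add: s_def)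
    moreover have "0 \<le> s * rest_rate" using s rest_rate_nonneg by simp
    ultimately have "b \<le> k" by (simp add: algebra_simps)
    then show ?thesis using k by simp
  qed simp
  then show thesis using that[of "c * s"] cB s by simp
qed

text \<open>Divided by \<open>t\<close>, both compact sets shrink into arbitrarily small balls
  around 0. Hence the upper bound at the single starting point 0 is automatically uniform over
  \<open>K\<close>.\<close>

lemma compact_transition_upper:
  assumes K: "compact K" "K \<subseteq> E" and W: "compact W" and b: "b < rest_rate"
  obtains t0 where "0 \<le> t0"
    "\<And>t x. t0 \<le> t \<Longrightarrow> x \<in> K \<Longrightarrow> measure (P x) {\<omega> \<in> space M. X t \<omega> \<in> W} \<le> exp (- b * t)"
proof -
  obtain b' where b': "b < b'" "b' < rest_rate" using b dense by blast
  obtain \<delta> where \<delta>: "0 < \<delta>"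
    "\<And>\<phi>. \<phi> \<in> cadlag 1 S \<Longrightarrow> norm (\<phi> 1) \<le> \<delta> \<Longrightarrow> \<phi> 0 = 0 \<Longrightarrow> ereal b' \<le> I 1 \<phi>"
    using rate_near_origin[OF b'(2)] by blast
  let ?C = "{\<phi> \<in> cadlag 1 S. norm (\<phi> 1) \<le> \<delta>}"
  have "\<exists>\<epsilon>>0. \<forall>\<^sub>F a in at_top. \<forall>z\<in>starts_near E a 0 \<epsilon>.
      measure (P (a *\<^sub>R z)) {\<omega> \<in> space M. rescaled_path X a 1 \<omega> \<in> ?C} \<le> exp (- b * a)"
    by (rule LDP_upper[OF LDP zero_in_S closedin_skorohod_end _ b'(1)]) (use \<delta>(2) in auto)
  then obtain \<epsilon> where \<epsilon>: "0 < \<epsilon>" "\<forall>\<^sub>F a in at_top. \<forall>z\<in>starts_near E a 0 \<epsilon>.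
      measure (P (a *\<^sub>R z)) {\<omega> \<in> space M. rescaled_path X a 1 \<omega> \<in> ?C} \<le> exp (- b * a)"
    by blast
  obtain R where R: "0 < R" "\<And>x. x \<in> K \<union> W \<Longrightarrow> norm x \<le> R"
    using bounded_pos[of "K \<union> W"] K W compact_imp_bounded by (metis bounded_Un)
  have "\<forall>\<^sub>F t in at_top. \<forall>x\<in>K. measure (P x) {\<omega> \<in> space M. X t \<omega> \<in> W} \<le> exp (- b * t)"
    using \<epsilon>(2) eventually_gt_at_top[of 0] eventually_gt_at_top[of "R / \<epsilon>"] eventually_gt_at_top[of "R / \<delta>"]
  proof eventually_elim
    case (elim t)
    show ?case
    proof
      fix x assume x: "x \<in> K"
      have xE: "x \<in> E" using x K by blast
      have "norm x \<le> R" using x R by blast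
      also have "R < \<epsilon> * t" using elim \<epsilon>(1) by (simp add: field_simps)
      finally have "x /\<^sub>R t \<in> starts_near E t 0 \<epsilon>"
        using elim(2) xE by (simp add: starts_near_def field_simps)
      moreover have tx: "t *\<^sub>R (x /\<^sub>R t) = x" using elim by simp
      ultimately have le: "measure (P x) {\<omega> \<in> space M. norm (X t \<omega>) \<le> \<delta> * t} \<le> exp (- b * t)"
        using bspec[OF elim(1), of "x /\<^sub>R t"] unfolding end_event(2)[OF elim(2)] by (simp only: tx)
      interpret prob_space "P x" using prob[OF xE] .
      have "R \<le> \<delta> * t" using elim \<delta>(1) by (simp add: field_simps)
      then have sub: "{\<omega> \<in> space M. X t \<omega> \<in> W} \<subseteq> {\<omega> \<in> space M. norm (X t \<omega>) \<le> \<delta> * t}"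
        using R(2) by (auto intro: order_trans)
      have "{\<omega> \<in> space M. X t \<omega> \<in> cball 0 (\<delta> * t)} \<in> sets (P x)"
        unfolding sets_P[OF xE] using elim by (intro X_event) auto
      then have "measure (P x) {\<omega> \<in> space M. X t \<omega> \<in> W} \<le> measure (P x) {\<omega> \<in> space M. norm (X t \<omega>) \<le> \<delta> * t}"
        by (intro finite_measure_mono[OF sub]) simp
      then show "measure (P x) {\<omega> \<in> space M. X t \<omega> \<in> W} \<le> exp (- b * t)" using le by simp
    qed
  qed
  then obtain t1 where t1: "\<And>t. t1 \<le> t \<Longrightarrow> \<forall>x\<in>K. measure (P x) {\<omega> \<in> space M. X t \<omega> \<in> W} \<le> exp (- b * t)"
    unfolding eventually_at_top_linorder by blast
  show thesis by (rule that[of "max t1 0"]) (use t1 in auto)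
qed

text \<open>The lower bound at a single starting point only covers a small neighbourhood of it;
  uniformity over the ball \<open>norm z \<le> \<delta>\<close> comes from compactness of its trace on the cone.\<close>

lemma return_probability_one_step:
  assumes \<eta>: "0 < \<eta>"
  obtains \<delta> a0 where "0 < \<delta>" "0 < a0"
    "\<And>a x. a0 \<le> a \<Longrightarrow> x \<in> E \<Longrightarrow> norm x \<le> \<delta> * a \<Longrightarrow>
      exp (- (rest_rate + \<eta>) * a) \<le> measure (P x) {\<omega> \<in> space M. norm (X a \<omega>) < \<delta> / 2 * a}"
proof -
  obtain c B where cB: "0 < c" "0 < B"
    and to0: "\<And>s x. 0 < s \<Longrightarrow> x \<in> S \<Longrightarrow> norm x \<le> c * s \<Longrightarrow> reachable s x 0 (B * s)"
    by (rule reachable_travel) blast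
  \<comment> \<open>At most 1/2 to leave time for resting within the unit interval, and small enough
    that the approach costs at most half of \<open>\<eta>\<close>.\<close>
  define s where "s = min (1 / 2) (\<eta> / (2 * B))"
  have s: "0 < s" "s < 1" using cB \<eta> by (auto simp: s_def)
  have "B * s \<le> B * (\<eta> / (2 * B))" using cB by (intro mult_left_mono) (auto simp: s_def)
  then have Bs: "B * s < \<eta>" using cB \<eta> by simp
  define \<delta> where "\<delta> = c * s"
  have \<delta>: "0 < \<delta>" using cB s by (simp add: \<delta>_def)
  \<comment> \<open>The target has half the radius of the starting ball; this slack allows step
    lengths that vary by a factor of 2.\<close>
  let ?U = "{\<phi> \<in> cadlag 1 S. norm (\<phi> 1) < \<delta> / 2}"
  have "\<forall>y\<in>S \<inter> cball 0 \<delta>. \<exists>\<epsilon>>0. \<forall>\<^sub>F a in at_top. \<forall>z\<in>starts_near E a y \<epsilon>.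
      exp (- (rest_rate + \<eta>) * a) < measure (P (a *\<^sub>R z)) {\<omega> \<in> space M. rescaled_path X a 1 \<omega> \<in> ?U}"
  proof
    fix y assume y: "y \<in> S \<inter> cball 0 \<delta>"
    have "reachable (s + (1 - s)) y 0 (B * s + (1 - s) * rest_rate)"
      using y s by (intro reachable_trans[where y = 0] to0 reachable_rest) (auto simp: \<delta>_def)
    then obtain \<phi> where \<phi>: "\<phi> \<in> cont_paths 1 S" "\<phi> 0 = y" "\<phi> 1 = 0"
        "I 1 \<phi> \<le> ereal (B * s + (1 - s) * rest_rate)"
      unfolding reachable_def by auto
    have "(1 - s) * rest_rate \<le> rest_rate"
      using s rest_rate_nonneg by (simp add: mult_left_le_one_le)
    then have "ereal (B * s + (1 - s) * rest_rate) < ereal (rest_rate + \<eta>)" using Bs by simp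
    with \<phi>(4) have I: "I 1 \<phi> < ereal (rest_rate + \<eta>)" by (rule le_less_trans)
    have \<phi>U: "\<phi> \<in> ?U" using \<phi> \<delta> subsetD[OF cont_paths_subset_cadlag] by auto
    have y': "\<phi> 0 \<in> S" using y \<phi> by simp
    show "\<exists>\<epsilon>>0. \<forall>\<^sub>F a in at_top. \<forall>z\<in>starts_near E a y \<epsilon>.
        exp (- (rest_rate + \<eta>) * a) < measure (P (a *\<^sub>R z)) {\<omega> \<in> space M. rescaled_path X a 1 \<omega> \<in> ?U}"
      using LDP_lower[OF LDP y' openin_skorohod_end \<phi>U I] unfolding \<phi>(2) by simp
  qed
  from bchoice[OF this] obtain \<epsilon> where \<epsilon>: "\<And>y. y \<in> S \<inter> cball 0 \<delta> \<Longrightarrow> 0 < \<epsilon> y"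
    and rate: "\<And>y. y \<in> S \<inter> cball 0 \<delta> \<Longrightarrow> \<forall>\<^sub>F a in at_top. \<forall>z\<in>starts_near E a y (\<epsilon> y).
      exp (- (rest_rate + \<eta>) * a) < measure (P (a *\<^sub>R z)) {\<omega> \<in> space M. rescaled_path X a 1 \<omega> \<in> ?U}"
    by blast
  have comp: "compact (S \<inter> cball 0 \<delta>)"
    by (intro closed_Int_compact closed_limit_cone closed_E compact_cball)
  have cover: "S \<inter> cball 0 \<delta> \<subseteq> (\<Union>y\<in>S \<inter> cball 0 \<delta>. ball y (\<epsilon> y))" using \<epsilon> by force
  obtain Y where Y: "Y \<subseteq> S \<inter> cball 0 \<delta>" "finite Y" "S \<inter> cball 0 \<delta> \<subseteq> (\<Union>y\<in>Y. ball y (\<epsilon> y))"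
    by (rule compactE_image[OF comp _ cover]) auto
  have "\<forall>\<^sub>F a in at_top. \<forall>y\<in>Y. \<forall>z\<in>starts_near E a y (\<epsilon> y).
      exp (- (rest_rate + \<eta>) * a) < measure (P (a *\<^sub>R z)) {\<omega> \<in> space M. rescaled_path X a 1 \<omega> \<in> ?U}"
    using Y by (intro eventually_ball_finite ballI rate) auto
  then obtain a1 where a1: "\<And>a y z. a1 \<le> a \<Longrightarrow> y \<in> Y \<Longrightarrow> z \<in> starts_near E a y (\<epsilon> y) \<Longrightarrow>
      exp (- (rest_rate + \<eta>) * a) < measure (P (a *\<^sub>R z)) {\<omega> \<in> space M. rescaled_path X a 1 \<omega> \<in> ?U}"
    unfolding eventually_at_top_linorder by blast
  show thesis
  proof (rule that[OF \<delta>, of "max a1 1"])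
    fix a x assume a: "max a1 1 \<le> a" and x: "x \<in> E" "norm x \<le> \<delta> * a"
    have a0: "0 < a" using a by simp
    have "x /\<^sub>R a \<in> S" using x E_subset_S a0 by (intro scaleR_in_limit_cone) auto
    then have "x /\<^sub>R a \<in> S \<inter> cball 0 \<delta>" using x(2) a0 by (simp add: field_simps)
    then obtain y where y: "y \<in> Y" "x /\<^sub>R a \<in> ball y (\<epsilon> y)" using Y by blast
    have ax: "a *\<^sub>R (x /\<^sub>R a) = x" using a0 by simp
    have "x /\<^sub>R a \<in> starts_near E a y (\<epsilon> y)"
      using y(2) x(1) unfolding starts_near_def mem_Collect_eq ax
      by (simp add: dist_norm norm_minus_commute)
    then have "exp (- (rest_rate + \<eta>) * a) <
        measure (P (a *\<^sub>R (x /\<^sub>R a))) {\<omega> \<in> space M. rescaled_path X a 1 \<omega> \<in> ?U}"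
      using a y(1) by (intro a1) auto
    then show "exp (- (rest_rate + \<eta>) * a) \<le> measure (P x) {\<omega> \<in> space M. norm (X a \<omega>) < \<delta> / 2 * a}"
      unfolding ax end_event(1)[OF a0] by simp
  qed simp
qed

text \<open>The strong Markov property at the constant time \<open>s\<close>: on the event
  \<open>X s \<omega> \<in> W\<close> the conditional probability is at least \<open>p\<close>
  almost surely, and integration preserves this.\<close>

lemma markov_lower_bound:
  assumes x: "x \<in> E" and st: "0 \<le> s" "0 \<le> t" and B: "B \<in> sets borel" and W: "W \<in> sets borel"
    and p: "\<And>y. y \<in> E \<inter> W \<Longrightarrow> p \<le> measure (P y) {\<omega> \<in> space M. X t \<omega> \<in> B}"
  shows "p * measure (P x) {\<omega> \<in> space M. X s \<omega> \<in> W} \<le> measure (P x) {\<omega> \<in> space M. X (s + t) \<omega> \<in> B}"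
proof -
  interpret prob_space "P x" using prob[OF x] .
  let ?\<tau> = "\<lambda>_::'w. ennreal s"
  have \<tau>: "stopping_time F ?\<tau>" by (rule stopping_time_const)
  have spP: "space (P x) = space M" by (rule sets_eq_imp_space_eq[OF sets_P[OF x]])
  have "sets (pre_sigma ?\<tau>) \<subseteq> sets M"
  proof
    fix A assume "A \<in> sets (pre_sigma ?\<tau>)"
    then have "{\<omega> \<in> A. ennreal s \<le> ennreal s} \<in> sets (F (ennreal s))" by (rule sets_pre_sigmaD[OF \<tau>])
    then show "A \<in> sets M" using F_sub by auto
  qed
  then have "subalgebra (P x) (pre_sigma ?\<tau>)"
    unfolding subalgebra_def by (simp add: space_pre_sigma spP sets_P[OF x])
  \<comment> \<open>The integral identity for conditional expectations requires a sigma-finite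
    restriction, which holds because \<open>P x\<close> is finite.\<close>
  then interpret sigma_finite_subalgebra "P x" "pre_sigma ?\<tau>"
    by (intro finite_measure_subalgebra_is_sigma_finite)
       (auto simp: finite_measure_subalgebra_def finite_measure_subalgebra_axioms_def finite_measure_axioms)
  let ?A = "{\<omega> \<in> space M. X (s + t) \<omega> \<in> B}" and ?W = "{\<omega> \<in> space M. X s \<omega> \<in> W}"
  have A: "?A \<in> sets (P x)" and Ws: "?W \<in> sets (P x)"
    unfolding sets_P[OF x] using X_event st B W by auto
  have ind: "integrable (P x) (indicator ?A :: 'w \<Rightarrow> real)" "integrable (P x) (\<lambda>\<omega>. p * indicator ?W \<omega> :: real)"
    using A Ws by (auto simp: emeasure_eq_measure)
  have "AE \<omega> in P x. real_cond_exp (P x) (pre_sigma ?\<tau>) (indicator ?A) \<omega> =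
      measure (P (X s \<omega>)) {\<omega>' \<in> space M. X t \<omega>' \<in> B}"
    using strong_markov[OF x \<tau> st(2) B] st by simp
  then have "AE \<omega> in P x. p * indicator ?W \<omega> \<le> real_cond_exp (P x) (pre_sigma ?\<tau>) (indicator ?A) \<omega>"
    using AE_space[of "P x"]
  proof eventually_elim
    case (elim \<omega>)
    have "X s \<omega> \<in> E" using elim(2) in_E st spP by auto
    then show ?case using elim(1) p[of "X s \<omega>"] by (auto simp: indicator_def)
  qed
  then have "(\<integral>\<omega>. p * indicator ?W \<omega> \<partial>P x) \<le> (\<integral>\<omega>. real_cond_exp (P x) (pre_sigma ?\<tau>) (indicator ?A) \<omega> \<partial>P x)"
    by (intro integral_mono_AE ind real_cond_exp_int(1))
  also have "\<dots> = (\<integral>\<omega>. indicator ?A \<omega> \<partial>P x)" by (rule real_cond_exp_int(2)[OF ind(1)])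
  finally show ?thesis using A Ws by (simp add: sets.Int_space_eq2)
qed

text \<open>For \<open>a\<close> between \<open>t0\<close> and \<open>2 * t0\<close> the ball of
  radius \<open>R = \<delta> * t0\<close> lies inside the starting ball \<open>\<delta> * a\<close>
  and contains the target \<open>\<delta> / 2 * a\<close>. Steps can therefore be chained with no
  loss beyond the product of their probabilities.\<close>

lemma return_probability:
  assumes \<eta>: "0 < \<eta>"
  obtains R t0 where "E \<inter> ball 0 R \<noteq> {}"
    "\<And>t x. t0 \<le> t \<Longrightarrow> x \<in> E \<inter> cball 0 R \<Longrightarrow>
      exp (- (rest_rate + \<eta>) * t) \<le> measure (P x) {\<omega> \<in> space M. X t \<omega> \<in> E \<inter> cball 0 R}"
proof -
  obtain \<delta> a0 where \<delta>: "0 < \<delta>" and a0: "0 < a0" and step: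
    "\<And>a x. a0 \<le> a \<Longrightarrow> x \<in> E \<Longrightarrow> norm x \<le> \<delta> * a \<Longrightarrow>
      exp (- (rest_rate + \<eta>) * a) \<le> measure (P x) {\<omega> \<in> space M. norm (X a \<omega>) < \<delta> / 2 * a}"
    using return_probability_one_step[OF \<eta>] by blast
  obtain e where e: "e \<in> E" using E_nonempty by blast
  \<comment> \<open>The second entry makes the open ball of radius \<open>R\<close> meet
    \<open>E\<close>; openness matters later, when this set must have positive mass.\<close>
  define t0 where "t0 = max a0 (norm e / \<delta> + 1)"
  have t0: "a0 \<le> t0" "0 < t0" using a0 by (auto simp: t0_def)
  define R where "R = \<delta> * t0"
  have "norm e < \<delta> * (norm e / \<delta> + 1)" using \<delta> by (simp add: field_simps)
  also have "\<dots> \<le> R" unfolding R_def using \<delta> by (intro mult_left_mono) (auto simp: t0_def)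
  finally have ne: "E \<inter> ball 0 R \<noteq> {}" using e by auto
  let ?W = "E \<inter> cball 0 R"
  have W: "?W \<in> sets borel" using closed_E by auto
  have one: "exp (- (rest_rate + \<eta>) * a) \<le> measure (P x) {\<omega> \<in> space M. X a \<omega> \<in> ?W}"
    if a: "t0 \<le> a" "a \<le> 2 * t0" and x: "x \<in> ?W" for a x
  proof -
    interpret prob_space "P x" using prob x by blast
    have "\<delta> * t0 \<le> \<delta> * a" using \<delta> a by simp
    then have "norm x \<le> \<delta> * a" using x by (simp add: R_def)
    then have "exp (- (rest_rate + \<eta>) * a) \<le> measure (P x) {\<omega> \<in> space M. norm (X a \<omega>) < \<delta> / 2 * a}"
      using x a t0 by (intro step) auto
    also have "\<dots> \<le> measure (P x) {\<omega> \<in> space M. X a \<omega> \<in> ?W}"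
    proof (rule finite_measure_mono)
      have "\<delta> * a \<le> \<delta> * (2 * t0)" using \<delta> a by simp
      then show "{\<omega> \<in> space M. norm (X a \<omega>) < \<delta> / 2 * a} \<subseteq> {\<omega> \<in> space M. X a \<omega> \<in> ?W}"
        using in_E a t0 by (auto simp: R_def)
      show "{\<omega> \<in> space M. X a \<omega> \<in> ?W} \<in> sets (P x)"
        using x a t0 W sets_P[of x] X_event[of a ?W] by auto
    qed
    finally show ?thesis .
  qed
  have iter: "exp (- (rest_rate + \<eta>) * a) ^ Suc n \<le> measure (P x) {\<omega> \<in> space M. X (real (Suc n) * a) \<omega> \<in> ?W}"
    if a: "t0 \<le> a" "a \<le> 2 * t0" and x: "x \<in> ?W" for a x n
  proof (induction n)
    case 0 then show ?case using one[OF a x] by simp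
  next
    case (Suc n)
    let ?p = "exp (- (rest_rate + \<eta>) * a)"
    have "?p ^ Suc (Suc n) \<le> ?p * measure (P x) {\<omega> \<in> space M. X (real (Suc n) * a) \<omega> \<in> ?W}"
      unfolding power_Suc[of ?p "Suc n"] using Suc by (intro mult_left_mono) auto
    also have "\<dots> \<le> measure (P x) {\<omega> \<in> space M. X (real (Suc n) * a + a) \<omega> \<in> ?W}"
      using x a t0 by (intro markov_lower_bound W one) auto
    also have "real (Suc n) * a + a = real (Suc (Suc n)) * a" by (simp add: algebra_simps)
    finally show ?case .
  qed
  have "exp (- (rest_rate + \<eta>) * t) \<le> measure (P x) {\<omega> \<in> space M. X t \<omega> \<in> ?W}"
    if t: "t0 \<le> t" and x: "x \<in> ?W" for t x
  proof -
    \<comment> \<open>\<open>Suc n\<close> is the integer part of \<open>t / t0\<close>. Cutting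
      \<open>t\<close> into that many equal steps gives a step length between \<open>t0\<close> and
      \<open>2 * t0\<close>.\<close>
    define n where "n = nat \<lfloor>t / t0\<rfloor> - 1"
    have "1 \<le> t / t0" using t t0 by simp
    then have "1 \<le> nat \<lfloor>t / t0\<rfloor>" by (simp add: le_nat_iff le_floor_iff)
    then have n: "real (Suc n) = of_int \<lfloor>t / t0\<rfloor>" by (simp add: n_def)
    have "real (Suc n) \<le> t / t0" "t / t0 \<le> real (Suc n) + 1"
      unfolding n by linarith+
    then have n1: "real (Suc n) * t0 \<le> t" "t \<le> (real (Suc n) + 1) * t0"
      using t0 by (simp_all add: field_simps)
    define a where "a = t / real (Suc n)"
    have "(real (Suc n) + 1) * t0 \<le> (2 * real (Suc n)) * t0" using t0 by (intro mult_right_mono) auto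
    then have a: "t0 \<le> a" "a \<le> 2 * t0"
      using n1 by (auto simp: a_def pos_le_divide_eq pos_divide_le_eq mult.commute mult.left_commute simp del: of_nat_Suc)
    have ta: "real (Suc n) * a = t" by (simp add: a_def)
    have "exp (- (rest_rate + \<eta>) * a) ^ Suc n = exp (real (Suc n) * (- (rest_rate + \<eta>) * a))"
      by (rule exp_of_nat_mult[symmetric])
    also have "real (Suc n) * (- (rest_rate + \<eta>) * a) = - (rest_rate + \<eta>) * t"
      unfolding ta[symmetric] by (simp only: mult.left_commute)
    finally show ?thesis using iter[OF a x, of n] unfolding ta by simp
  qed
  then show thesis using that[OF ne] by blast
qed

section \<open>The spectral radius\<close>

lemma green_function_measurable:
  assumes m: "radon_measure_on E m" and W: "closed W"
  shows "green_function M P X r W \<in> borel_measurable m"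
proof -
  have spm: "space m = E" and sm: "sets m = sets (restrict_space borel E)"
    using m by (auto simp: radon_measure_on_def)
  \<comment> \<open>The empty set is never hit, its hitting time being an infimum over the empty
    set; killing is switched off and \<open>f\<close> is the transition probability into
    \<open>W\<close>, jointly measurable in time and starting point.\<close>
  define f where "f = (\<lambda>(t, x). LINT \<omega>:{\<omega> \<in> space M. ennreal t < hitting_time X {} \<omega>}|P x. (indicator W (X t \<omega>) :: real))"
  have "indicator W \<in> borel_measurable (borel :: 'a measure)" using W by simp
  then have "(indicator W :: 'a \<Rightarrow> real) \<in> borel_measurable (restrict_space borel E)"
    by (rule measurable_restrict_space1)
  moreover have "bounded ((indicator W :: 'a \<Rightarrow> real) ` E)"
    by (auto simp: bounded_iff indicator_def intro!: exI[of _ 1])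
  ultimately have "f \<in> borel_measurable (restrict_space borel ({0..} \<times> E))"
    unfolding f_def by (intro killed_measurable) auto
  \<comment> \<open>Extension by 0 off a closed set moves the question to the product Borel space,
    where measurability of parametrised integrals applies.\<close>
  then have "(\<lambda>z. indicator ({0..} \<times> E) z *\<^sub>R f z) \<in> borel_measurable borel"
    using closed_E by (subst (asm) borel_measurable_restrict_space_iff) (auto intro!: borel_closed closed_Times)
  then have [measurable]: "(\<lambda>z. indicator ({0..} \<times> E) z *\<^sub>R f z) \<in> borel_measurable (borel \<Otimes>\<^sub>M borel)"
    by (simp add: borel_prod)
  have f: "f (t, x) = measure (P x) {\<omega> \<in> space M. X t \<omega> \<in> W}" if t: "0 \<le> t" and x: "x \<in> E" for t x
  proof -
    interpret prob_space "P x" using prob[OF x] .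
    have sp: "space (P x) = space M" by (rule sets_eq_imp_space_eq[OF sets_P[OF x]])
    have top: "hitting_time X {} \<omega> = top" for \<omega> by (simp add: hitting_time_def)
    have "f (t, x) = (\<integral>\<omega>. indicator {\<omega> \<in> space M. X t \<omega> \<in> W} \<omega> \<partial>P x)"
      unfolding f_def set_lebesgue_integral_def prod.case top
      by (intro Bochner_Integration.integral_cong) (auto simp: sp indicator_def)
    also have "\<dots> = measure (P x) {\<omega> \<in> space M. X t \<omega> \<in> W}"
      using X_event[OF t, of W] W by (simp add: sets_P[OF x] sp[symmetric])
    finally show ?thesis .
  qed
  have "(\<lambda>x. \<integral>\<^sup>+t. ennreal (r powr (- t) * (indicator ({0..} \<times> E) (t, x) *\<^sub>R f (t, x))) \<partial>lborel)
      \<in> borel_measurable (borel :: 'a measure)"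
    by (rule lborel.borel_measurable_nn_integral) measurable
  then have "(\<lambda>x. \<integral>\<^sup>+t. ennreal (r powr (- t) * (indicator ({0..} \<times> E) (t, x) *\<^sub>R f (t, x))) \<partial>lborel)
      \<in> borel_measurable m"
    unfolding measurable_cong_sets[OF sm refl] by (rule measurable_restrict_space1)
  then show ?thesis
  proof (rule measurable_cong[THEN iffD1, rotated])
    fix x assume "x \<in> space m"
    then show "(\<integral>\<^sup>+t. ennreal (r powr (- t) * (indicator ({0..} \<times> E) (t, x) *\<^sub>R f (t, x))) \<partial>lborel) =
        green_function M P X r W x"
      unfolding green_function_def by (intro nn_integral_cong) (auto simp: spm f indicator_def)
  qed
qed

lemma green_function_bounded:
  assumes K: "compact K" "K \<subseteq> E" and W: "compact W" and r: "0 < r" "- rest_rate < ln r"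
  obtains C where "\<And>x. x \<in> K \<Longrightarrow> green_function M P X r W x \<le> ennreal C"
proof -
  \<comment> \<open>Below the true decay rate, so that the probability estimate applies, yet large
    enough that a decay rate \<open>\<kappa>\<close> remains after multiplication by
    \<open>r powr (- t)\<close>.\<close>
  obtain b where b: "- ln r < b" "b < rest_rate" using r(2) dense[of "- ln r" rest_rate] by auto
  obtain t0 where t0: "0 \<le> t0"
    "\<And>t x. t0 \<le> t \<Longrightarrow> x \<in> K \<Longrightarrow> measure (P x) {\<omega> \<in> space M. X t \<omega> \<in> W} \<le> exp (- b * t)"
    using compact_transition_upper[OF K W b(2)] by blast
  define \<kappa> where "\<kappa> = ln r + b"
  have \<kappa>: "0 < \<kappa>" using b by (simp add: \<kappa>_def)
  \<comment> \<open>Covers the times before \<open>t0\<close>, where a probability is merely at most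
    1; the absolute value is there because \<open>b\<close> may be negative.\<close>
  define C where "C = exp (\<bar>b\<bar> * t0)"
  have C: "1 \<le> C" using t0 by (simp add: C_def)
  have le: "r powr (- t) * measure (P x) {\<omega> \<in> space M. X t \<omega> \<in> W} \<le> C * exp (- \<kappa> * t)"
    if t: "0 \<le> t" and x: "x \<in> K" for t x
  proof -
    interpret prob_space "P x" using prob x K by blast
    have rt: "r powr (- t) = exp (- \<kappa> * t) * exp (b * t)"
      using r by (simp add: powr_def \<kappa>_def exp_add[symmetric] algebra_simps)
    have "exp (b * t) * measure (P x) {\<omega> \<in> space M. X t \<omega> \<in> W} \<le> C"
    proof (cases "t0 \<le> t")
      case True
      have "exp (b * t) * measure (P x) {\<omega> \<in> space M. X t \<omega> \<in> W} \<le> exp (b * t) * exp (- b * t)"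
        using t0(2)[OF True x] by (intro mult_left_mono) auto
      also have "\<dots> = 1" by (simp add: exp_add[symmetric])
      finally show ?thesis using C by simp
    next
      case False
      have "b * t \<le> \<bar>b\<bar> * t" using t by (intro mult_right_mono) auto
      also have "\<dots> \<le> \<bar>b\<bar> * t0" using False by (intro mult_left_mono) auto
      finally have "exp (b * t) \<le> C" by (simp add: C_def)
      then have "exp (b * t) * measure (P x) {\<omega> \<in> space M. X t \<omega> \<in> W} \<le> C * 1"
        using C by (intro mult_mono prob_le_1) auto
      then show ?thesis by simp
    qed
    then have "exp (- \<kappa> * t) * (exp (b * t) * measure (P x) {\<omega> \<in> space M. X t \<omega> \<in> W}) \<le> exp (- \<kappa> * t) * C"
      by (intro mult_left_mono) auto
    then show ?thesis unfolding rt by (simp add: mult.assoc mult.commute)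
  qed
  have lim: "((\<lambda>t. - C / \<kappa> * exp (- \<kappa> * t)) \<longlongrightarrow> - C / \<kappa> * 0) at_top"
  proof (intro tendsto_mult tendsto_const)
    have "filterlim (\<lambda>t. - \<kappa> * t) at_bot at_top"
      using \<kappa> by (intro filterlim_tendsto_neg_mult_at_bot[OF tendsto_const _ filterlim_ident]) simp
    then show "((\<lambda>t. exp (- \<kappa> * t)) \<longlongrightarrow> 0) at_top" by (rule filterlim_compose[OF exp_at_bot])
  qed
  have int: "(\<integral>\<^sup>+t. ennreal (C * exp (- \<kappa> * t)) * indicator {0..} t \<partial>lborel) = ennreal (C / \<kappa>)"
  proof -
    have "(\<integral>\<^sup>+t. ennreal (C * exp (- \<kappa> * t)) * indicator {0..} t \<partial>lborel) =
        ennreal (- C / \<kappa> * 0 - - C / \<kappa> * exp (- \<kappa> * 0))"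
      by (rule nn_integral_FTC_atLeast[OF _ _ _ lim])
         (use C \<kappa> in \<open>auto intro!: derivative_eq_intros simp: field_simps\<close>)
    then show ?thesis by simp
  qed
  have "green_function M P X r W x \<le> ennreal (C / \<kappa>)" if x: "x \<in> K" for x
    unfolding green_function_def int[symmetric] using le[OF _ x]
    by (intro nn_integral_mono) (auto simp: indicator_def intro!: ennreal_leI)
  then show thesis by (rule that)
qed

lemma green_function_infinite:
  assumes r: "0 < r" "ln r < - rest_rate"
  obtains R where "E \<inter> ball 0 R \<noteq> {}"
    "\<And>x. x \<in> E \<inter> cball 0 R \<Longrightarrow> green_function M P X r (E \<inter> cball 0 R) x = \<infinity>"
proof -
  \<comment> \<open>Chosen so that \<open>r powr (- t)\<close> exactly cancels the exponential lower
    bound: the integrand is at least 1 from \<open>t0\<close> on.\<close>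
  define \<eta> where "\<eta> = - rest_rate - ln r"
  have \<eta>: "0 < \<eta>" using r by (simp add: \<eta>_def)
  obtain R t0 where R: "E \<inter> ball 0 R \<noteq> {}" and lower:
    "\<And>t x. t0 \<le> t \<Longrightarrow> x \<in> E \<inter> cball 0 R \<Longrightarrow>
      exp (- (rest_rate + \<eta>) * t) \<le> measure (P x) {\<omega> \<in> space M. X t \<omega> \<in> E \<inter> cball 0 R}"
    using return_probability[OF \<eta>] by blast
  have "green_function M P X r (E \<inter> cball 0 R) x = \<infinity>" if x: "x \<in> E \<inter> cball 0 R" for x
  proof -
    have "(\<integral>\<^sup>+t. indicator {max t0 0..} t \<partial>lborel) \<le> green_function M P X r (E \<inter> cball 0 R) x"
      unfolding green_function_def
    proof (rule nn_integral_mono)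
      fix t :: real
      have "1 \<le> r powr (- t) * measure (P x) {\<omega> \<in> space M. X t \<omega> \<in> E \<inter> cball 0 R}" if t: "t0 \<le> t"
      proof -
        have "1 = r powr (- t) * exp (- (rest_rate + \<eta>) * t)"
          using r by (simp add: powr_def \<eta>_def exp_add[symmetric] algebra_simps)
        also have "\<dots> \<le> r powr (- t) * measure (P x) {\<omega> \<in> space M. X t \<omega> \<in> E \<inter> cball 0 R}"
          using lower[OF t x] by (intro mult_left_mono) auto
        finally show ?thesis .
      qed
      then show "indicator {max t0 0..} t \<le>
          ennreal (r powr (- t) * measure (P x) {\<omega> \<in> space M. X t \<omega> \<in> E \<inter> cball 0 R}) * indicator {0..} t"
        by (auto simp: indicator_def)
    qed
    moreover have "(\<integral>\<^sup>+t. indicator {max t0 0..} t \<partial>lborel) = (\<infinity> :: ennreal)"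
    proof -
      have "emeasure lborel {max t0 0..} = \<infinity>"
      proof (rule ccontr)
        assume "emeasure lborel {max t0 0..} \<noteq> \<infinity>"
        then obtain k where k: "0 \<le> k" "emeasure lborel {max t0 0..} = ennreal k"
          by (cases "emeasure lborel {max t0 0..}") auto
        have "emeasure lborel {max t0 0..max t0 0 + (k + 1)} \<le> emeasure lborel {max t0 0..}"
          by (intro emeasure_mono) auto
        then show False using k by (simp add: ennreal_le_iff)
      qed
      then show ?thesis by simp
    qed
    ultimately show ?thesis by (simp add: top_unique)
  qed
  then show thesis using that[OF R] by blast
qed

text \<open>Above the threshold the Green function is bounded on compact sets, which have finite
  mass. Below it the function is infinite on a compact set that contains a non-empty relatively open
  one, hence on a set of positive mass. The value at the threshold itself does not affect the
  infimum.\<close>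

lemma spectral_radius_eq:
  assumes m: "radon_measure_on E m"
    and pos: "\<And>U. openin (top_of_set E) U \<Longrightarrow> U \<noteq> {} \<Longrightarrow> emeasure m U \<noteq> 0"
  shows "spectral_radius M P X E m = exp (- rest_rate)"
proof -
  define A where "A = {r. 0 < r \<and> (\<forall>W. compact W \<and> W \<subseteq> E \<longrightarrow>
       green_function M P X r W \<in> borel_measurable m \<and>
       (\<forall>K. compact K \<and> K \<subseteq> E \<longrightarrow> (\<integral>\<^sup>+x\<in>K. green_function M P X r W x \<partial>m) < \<infinity>))}"
  have spm: "space m = E" and sm: "sets m = sets (restrict_space borel E)"
    and fin: "\<And>K. compact K \<Longrightarrow> K \<subseteq> E \<Longrightarrow> emeasure m K < \<infinity>"
    using m by (auto simp: radon_measure_on_def)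
  have sets: "K \<in> sets m" if "closed K" "K \<subseteq> E" for K
    using that by (auto simp: sm sets_restrict_space image_iff intro!: bexI[of _ K])
  have upper: "r \<in> A" if r: "exp (- rest_rate) < r" for r
  proof -
    have r0: "0 < r" using r by (meson exp_gt_zero less_trans)
    then have ln: "- rest_rate < ln r" using r by (metis exp_less_cancel_iff exp_ln)
    have "(\<integral>\<^sup>+x\<in>K. green_function M P X r W x \<partial>m) < \<infinity>"
      if W: "compact W" and K: "compact K" "K \<subseteq> E" for W K
    proof -
      obtain C where C: "\<And>x. x \<in> K \<Longrightarrow> green_function M P X r W x \<le> ennreal C"
        using green_function_bounded[OF K W r0 ln] by blast
      have "(\<integral>\<^sup>+x\<in>K. green_function M P X r W x \<partial>m) \<le> (\<integral>\<^sup>+x. ennreal C * indicator K x \<partial>m)"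
        by (intro nn_integral_mono) (auto simp: indicator_def intro: C)
      also have "\<dots> = ennreal C * emeasure m K"
        by (intro nn_integral_cmult_indicator sets compact_imp_closed K)
      also have "\<dots> < \<infinity>" using fin[OF K] by (simp add: ennreal_mult_less_top)
      finally show ?thesis .
    qed
    then show ?thesis
      unfolding A_def using r0 green_function_measurable[OF m] compact_imp_closed by blast
  qed
  have lower: "exp (- rest_rate) \<le> r" if r: "r \<in> A" for r
  proof (rule ccontr)
    assume "\<not> exp (- rest_rate) \<le> r"
    moreover have r0: "0 < r" using r by (simp add: A_def)
    ultimately have "ln r < - rest_rate" by (metis exp_less_cancel_iff exp_ln not_le)
    then obtain R where R: "E \<inter> ball 0 R \<noteq> {}"
      "\<And>x. x \<in> E \<inter> cball 0 R \<Longrightarrow> green_function M P X r (E \<inter> cball 0 R) x = \<infinity>"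
      using green_function_infinite[OF r0] by blast
    let ?K = "E \<inter> cball 0 R"
    have K: "compact ?K" using closed_E by (intro closed_Int_compact compact_cball)
    have Km: "?K \<in> sets m" using K by (intro sets compact_imp_closed) auto
    have "openin (top_of_set E) (E \<inter> ball 0 R)" by (auto simp: openin_open)
    then have "0 < emeasure m (E \<inter> ball 0 R)" using pos R(1) by (simp add: zero_less_iff_neq_zero)
    also have "\<dots> \<le> emeasure m ?K" by (intro emeasure_mono Km) auto
    finally have "(\<integral>\<^sup>+x. \<infinity> * indicator ?K x \<partial>m) = \<infinity>"
      by (subst nn_integral_cmult_indicator[OF Km]) (auto simp: ennreal_top_mult)
    moreover have "(\<integral>\<^sup>+x\<in>?K. green_function M P X r ?K x \<partial>m) = (\<integral>\<^sup>+x. \<infinity> * indicator ?K x \<partial>m)"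
      by (intro nn_integral_cong) (auto simp: indicator_def R(2))
    moreover have "(\<integral>\<^sup>+x\<in>?K. green_function M P X r ?K x \<partial>m) < \<infinity>"
      using r K unfolding A_def by auto
    ultimately show False by simp
  qed
  have "Inf A = exp (- rest_rate)"
  proof (rule antisym)
    show "exp (- rest_rate) \<le> Inf A"
      using upper[of "exp (- rest_rate) + 1"] lower by (intro cInf_greatest) auto
    show "Inf A \<le> exp (- rest_rate)"
    proof (rule dense_ge)
      fix r assume "exp (- rest_rate) < r"
      then show "Inf A \<le> r" using upper lower by (intro cInf_lower) (auto intro!: bdd_belowI)
    qed
  qed
  then show ?thesis by (simp add: spectral_radius_def A_def)
qed

end

section \<open>The chain of equalities\<close>

theorem theorem1:
  fixes E :: "'a::euclidean_space set"
    and m :: "'a measure"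
    and M :: "'w measure"
    and F :: "ennreal \<Rightarrow> 'w measure"
    and P :: "'a \<Rightarrow> 'w measure"
    and X :: "real \<Rightarrow> 'w \<Rightarrow> 'a"
    and I :: "real \<Rightarrow> (real \<Rightarrow> 'a) \<Rightarrow> ereal"
    and x y :: 'a
  assumes "closed E" and "\<not> bounded E"
    and "radon_measure_on E m"
    and "\<And>U. openin (top_of_set E) U \<Longrightarrow> U \<noteq> {} \<Longrightarrow> emeasure m U \<noteq> 0"
    and "strong_markov_process M F E P X"
    and "assumption_A M P X E I"
    and "x \<in> limit_cone E" and "y \<in> limit_cone E"
  shows "elog (spectral_radius M P X E m) = - min_cost (limit_cone E) I 1 0 0
    \<and> - min_cost (limit_cone E) I 1 0 0 = - I 1 (\<lambda>t\<in>{0..1}. 0)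
    \<and> - I 1 (\<lambda>t\<in>{0..1}. 0) = - Limsup at_top (\<lambda>t. min_cost (limit_cone E) I t x y / ereal t)
    \<and> - Limsup at_top (\<lambda>t. min_cost (limit_cone E) I t x y / ereal t)
        = - (INF \<phi>\<in>{\<phi> \<in> cont_paths 1 (limit_cone E). \<phi> 0 = \<phi> 1}. I 1 \<phi>)"
proof -
  interpret strong_markov_process M F E P X by fact
  interpret sample_path_LDP_process M F E P X I
    by unfold_locales fact+
  have "spectral_radius M P X E m = exp (- rest_rate)"
    by (rule spectral_radius_eq) fact+
  then have "elog (spectral_radius M P X E m) = - ereal rest_rate"
    by (simp add: elog_def not_le)
  moreover have "I 1 (rest 1) = ereal rest_rate" by (simp add: I_rest)
  ultimately show ?thesis
    by (simp only: min_cost_origin INF_loops Limsup_min_cost[OF assms(7,8)] simp_thms)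
qed

end
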